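(* Consider the semiparametric copula generated model $\mathcal P$ built from a family $\{h_\theta\}_{|\theta|<1}$ of densities on $(0,1)^2$ with $h_0\equiv1$, as described in the context, fix $q_0,r_0\in\mathcal F$, and let $\dot\ell_0^*$ be the efficient score function at $\theta=0$ and $I^*=\mathbb E_0[\dot\ell_0^*(X,Y)^2]$. Let $T_n$ be a rank statistic (a function of the ranks of $X_1,\dots,X_n$ and the ranks of $Y_1,\dots,Y_n$) such that under $\theta=0$ (i.e. when $(X_1,Y_1),(X_2,Y_2),\ldots$ are i.i.d. with density $q_0'(x)r_0'(y)$ on $(0,1)^2$) $$\Big(\sqrt n\,T_n,\ \frac1{\sqrt n}\sum_{i=1}^n\dot\ell_0^*(X_i,Y_i)\Big)\xrightarrow{d}N\left(\begin{pmatrix}0\\0\end{pmatrix},\begin{pmatrix}\sigma^2&\rho^*\sigma\sqrt{I^*}\\\rho^*\sigma\sqrt{I^*}&I^*\end{pmatrix}\right).$$ Suppose that for every $n$ there exist (measurable) functions $q_{x,n},q_{y,n}:\mathbb R^n\to\mathbb R$ such that, under $\theta=0$, $$\sqrt n\,T_n=q_{x,n}(X_1,\ldots,X_n)+q_{y,n}(Y_1,\ldots,Y_n)+o_P(1).$$ Then under the submodel of $\mathcal P$ which has score function $\dot\ell_0^*$ at $\theta=0$, the Pitman efficiency of $T_n$ is zero: $e^*(T_n)=(\rho^* )^2=0$.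
   Context: Let $\{h_\theta:|\theta|<1\}$ be probability densities on $(0,1)^2$ with $h_0\equiv1$, such that $\dot\ell_0:=\frac{\partial}{\partial\theta}\log h_\theta|_{\theta=0}$ exists, the family is quadratic mean differentiable at $\theta=0$ with score $\dot\ell_0$, i.e. $\int\int(\sqrt{h_\theta}-\sqrt{h_0}-\frac12\theta\dot\ell_0\sqrt{h_0})^2dx\,dy=o(\theta^2)$, and $\int\int\dot\ell_0^2h_0\,dx\,dy>0$. Let $\mathcal F:=\{a:[0,1]\to[0,1]\text{ absolutely continuous},\ a'>0,\ a(0)=0,\ a(1)=1\}$. For $q,r\in\mathcal F$ put $h_\theta(x,y,q,r):=h_\theta(q(x),r(y))\,q'(x)r'(y)$ on $(0,1)^2$, and let $\mathcal P:=\{h_\theta(\cdot,\cdot,q,r):|\theta|<1,\ q,r\in\mathcal F\}$. Fix $q_0,r_0\in\mathcal F$. $\mathbb E_0$ denotes expectation under $(X,Y)$ with density $h_0(x,y,q_0,r_0)=q_0'(x)r_0'(y)$, so that $X$ and $Y$ are independent and $q_0(X),r_0(Y)$ are uniform on $(0,1)$. The efficient score function for $\mathcal P$ at $\theta=0$ is $$\dot\ell_0^*(X,Y):=\dot\ell_0(q_0(X),r_0(Y))-\mathbb E_0[\dot\ell_0(q_0(X),r_0(Y))\mid X]-\mathbb E_0[\dot\ell_0(q_0(X),r_0(Y))\mid Y].$$ The submodel in question is a one-parameter submodel $\{h_\theta(\cdot,\cdot,q_\theta,r_\theta):|\theta|<1\}$ of $\mathcal P$, with $q_\theta,r_\theta\in\mathcal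 F$ equal to $q_0,r_0$ at $\theta=0$, which is quadratic mean differentiable at $\theta=0$ with score function $\dot\ell_0^*$. For a statistic $T_n$ satisfying the joint convergence in the claim (with $\sigma>0$, $I^*>0$), the Pitman efficiency of $T_n$ with respect to the asymptotically optimal test in this submodel is defined as $e^*(T_n):=(\rho^* )^2$. *)

theory Defs
  imports "HOL-Probability.Probability"
begin

section \<open>Probability preliminaries\<close>

definition converges_in_distribution ::
    "'a measure \<Rightarrow> (nat \<Rightarrow> 'a \<Rightarrow> 'b::metric_space) \<Rightarrow> 'b measure \<Rightarrow> bool" where
  "converges_in_distribution M Z N \<longleftrightarrow>
     (\<forall>n. Z n \<in> borel_measurable M) \<and>
     (\<forall>f :: 'b \<Rightarrow> real. continuous_on UNIV f \<and> bounded (range f) \<longrightarrow>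
        (\<lambda>n. LINT \<omega>|M. f (Z n \<omega>)) \<longlonglongrightarrow> (LINT z|N. f z))"

definition converges_in_probability_to_0 ::
    "'a measure \<Rightarrow> (nat \<Rightarrow> 'a \<Rightarrow> real) \<Rightarrow> bool" where
  "converges_in_probability_to_0 M Z \<longleftrightarrow>
     (\<forall>n. Z n \<in> borel_measurable M) \<and>
     (\<forall>\<epsilon>>0. (\<lambda>n. measure M {\<omega> \<in> space M. \<bar>Z n \<omega>\<bar> > \<epsilon>}) \<longlonglongrightarrow> 0)"

text \<open>
  The normal law is specified by its characteristic function, so that singular covariance
  matrices (correlation plus or minus one) are included.  Positive semidefiniteness of the
  covariance matrix is forced by the existence of the law.
\<close>

definition is_multivariate_normal ::
    "real^'n \<Rightarrow> real^'n^'n \<Rightarrow> (real^'n) measure \<Rightarrow> bool" where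
  "is_multivariate_normal \<mu> \<Sigma> N \<longleftrightarrow>
     prob_space N \<and> sets N = sets borel \<and> transpose \<Sigma> = \<Sigma> \<and>
     (\<forall>t. (CLINT x|N. iexp (t \<bullet> x)) =
          exp (\<i> * complex_of_real (t \<bullet> \<mu>) - complex_of_real (t \<bullet> (\<Sigma> *v t)) / 2))"


section \<open>Densities on the open unit square and quadratic mean differentiability\<close>

definition unit_square :: "(real \<times> real) set" where
  "unit_square = {0<..<1} \<times> {0<..<1}"

definition square_lborel :: "(real \<times> real) measure" where
  "square_lborel = restrict_space lborel unit_square"

definition square_law :: "(real \<times> real \<Rightarrow> real) \<Rightarrow> (real \<times> real) measure" where
  "square_law p = density square_lborel (\<lambda>z. ennreal (p z))"

text \<open>
  The remainder is integrated with the Lebesgue integral of nonnegative functions, so that the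
  condition entails that the remainder is square integrable for all small parameter values.
\<close>

definition qmd_at_0 ::
    "(real \<Rightarrow> real \<times> real \<Rightarrow> real) \<Rightarrow> (real \<times> real \<Rightarrow> real) \<Rightarrow> bool" where
  "qmd_at_0 p s \<longleftrightarrow>
     (\<forall>\<theta>. \<bar>\<theta>\<bar> < 1 \<longrightarrow> p \<theta> \<in> borel_measurable square_lborel) \<and>
     s \<in> borel_measurable square_lborel \<and>
     ((\<lambda>\<theta>. (\<integral>\<^sup>+z. ennreal ((sqrt (p \<theta> z) - sqrt (p 0 z) - 1/2 * \<theta> * s z * sqrt (p 0 z))\<^sup>2)
             \<partial>square_lborel) / ennreal (\<theta>\<^sup>2)) \<longlongrightarrow> 0) (at 0)"

definition score_at_0 :: "(real \<Rightarrow> real \<times> real \<Rightarrow> real) \<Rightarrow> real \<times> real \<Rightarrow> real" where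
  "score_at_0 h z = deriv (\<lambda>\<theta>. ln (h \<theta> z)) 0"

text \<open>
  Since \<^term>\<open>ln (0::real) = 0\<close> by convention, differentiability of the log-density has to be
  accompanied by positivity of the density near \<open>\<theta> = 0\<close>.
\<close>

definition copula_density_family :: "(real \<Rightarrow> real \<times> real \<Rightarrow> real) \<Rightarrow> bool" where
  "copula_density_family h \<longleftrightarrow>
     (\<forall>\<theta>. \<bar>\<theta>\<bar> < 1 \<longrightarrow>
        h \<theta> \<in> borel_measurable square_lborel \<and>
        (\<forall>z\<in>unit_square. 0 \<le> h \<theta> z) \<and>
        (\<integral>\<^sup>+z. ennreal (h \<theta> z) \<partial>square_lborel) = 1) \<and>
     (\<forall>z\<in>unit_square. h 0 z = 1) \<and>
     (\<forall>z\<in>unit_square. (\<forall>\<^sub>F \<theta> in nhds 0. 0 < h \<theta> z) \<and>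
        (\<lambda>\<theta>. ln (h \<theta> z)) differentiable (at 0)) \<and>
     qmd_at_0 h (score_at_0 h) \<and>
     0 < (\<integral>\<^sup>+z. ennreal ((score_at_0 h z)\<^sup>2 * h 0 z) \<partial>square_lborel)"


section \<open>The copula generated model\<close>

definition absolutely_continuous_between :: "real \<Rightarrow> real \<Rightarrow> (real \<Rightarrow> real) \<Rightarrow> bool" where
  "absolutely_continuous_between l u a \<longleftrightarrow>
     (\<forall>\<epsilon>>0. \<exists>\<delta>>0. \<forall>I. finite I \<and> (\<forall>(c, d)\<in>I. l \<le> c \<and> c \<le> d \<and> d \<le> u) \<and>
        disjoint_family_on (\<lambda>(c, d). {c<..<d}) I \<and> (\<Sum>(c, d)\<in>I. d - c) < \<delta> \<longrightarrow>
        (\<Sum>(c, d)\<in>I. \<bar>a d - a c\<bar>) < \<epsilon>)"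

text \<open>
  Members are functions on \<open>[0, 1]\<close>; their values elsewhere are irrelevant.  An absolutely
  continuous function is differentiable almost everywhere only, so positivity of the derivative
  is understood almost everywhere.
\<close>

definition margin_transforms :: "(real \<Rightarrow> real) set" where
  "margin_transforms =
     {a. a ` {0..1} \<subseteq> {0..1} \<and> absolutely_continuous_between 0 1 a \<and>
         (AE x in lborel. x \<in> {0<..<1} \<longrightarrow> (\<exists>D>0. (a has_real_derivative D) (at x))) \<and>
         a 0 = 0 \<and> a 1 = 1}"

definition generated_density ::
    "(real \<Rightarrow> real \<times> real \<Rightarrow> real) \<Rightarrow> real \<Rightarrow> (real \<Rightarrow> real) \<Rightarrow> (real \<Rightarrow> real) \<Rightarrow> real \<times> real \<Rightarrow> real" where
  "generated_density h \<theta> q r = (\<lambda>(x, y). h \<theta> (q x, r y) * deriv q x * deriv r y)"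

definition copula_model ::
    "(real \<Rightarrow> real \<times> real \<Rightarrow> real) \<Rightarrow> (real \<times> real \<Rightarrow> real) set" where
  "copula_model h =
     {generated_density h \<theta> q r | \<theta> q r.
        \<bar>\<theta>\<bar> < 1 \<and> q \<in> margin_transforms \<and> r \<in> margin_transforms}"

definition one_parameter_submodel ::
    "(real \<Rightarrow> real \<times> real \<Rightarrow> real) \<Rightarrow> (real \<Rightarrow> real) \<Rightarrow> (real \<Rightarrow> real) \<Rightarrow>
     (real \<Rightarrow> real \<times> real \<Rightarrow> real) \<Rightarrow> bool" where
  "one_parameter_submodel h q0 r0 p \<longleftrightarrow>
     (\<exists>q r. (\<forall>\<theta>. \<bar>\<theta>\<bar> < 1 \<longrightarrow>
               q \<theta> \<in> margin_transforms \<and> r \<theta> \<in> margin_transforms \<and>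
               p \<theta> = generated_density h \<theta> (q \<theta>) (r \<theta>)) \<and>
            (\<forall>x\<in>{0..1}. q 0 x = q0 x \<and> r 0 x = r0 x))"

lemma one_parameter_submodel_subset_copula_model:
  assumes "one_parameter_submodel h q0 r0 p" "\<bar>\<theta>\<bar> < 1"
  shows "p \<theta> \<in> copula_model h"
  using assms unfolding one_parameter_submodel_def copula_model_def by blast

definition null_density :: "(real \<Rightarrow> real) \<Rightarrow> (real \<Rightarrow> real) \<Rightarrow> real \<times> real \<Rightarrow> real" where
  "null_density q0 r0 = (\<lambda>(x, y). deriv q0 x * deriv r0 y)"

definition null_law :: "(real \<Rightarrow> real) \<Rightarrow> (real \<Rightarrow> real) \<Rightarrow> (real \<times> real) measure" where
  "null_law q0 r0 = square_law (null_density q0 r0)"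

text \<open>
  The efficient score is a function of a single observation \<open>(x, y)\<close>; the law of \<open>(X, Y)\<close> lives
  on the square itself, with \<open>X\<close> and \<open>Y\<close> the coordinate projections.
\<close>

definition efficient_score ::
    "(real \<Rightarrow> real \<times> real \<Rightarrow> real) \<Rightarrow> (real \<Rightarrow> real) \<Rightarrow> (real \<Rightarrow> real) \<Rightarrow> real \<times> real \<Rightarrow> real" where
  "efficient_score h q0 r0 =
     (let g = (\<lambda>(x, y). score_at_0 h (q0 x, r0 y)) in
      (\<lambda>z. g z - real_cond_exp (null_law q0 r0) (vimage_algebra unit_square fst borel) g z
               - real_cond_exp (null_law q0 r0) (vimage_algebra unit_square snd borel) g z))"


section \<open>Rank statistics and Pitman efficiency\<close>

definition ranks :: "nat \<Rightarrow> (nat \<Rightarrow> real) \<Rightarrow> nat \<Rightarrow> nat" where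
  "ranks n x = (\<lambda>i\<in>{..<n}. card {j \<in> {..<n}. x j \<le> x i})"

definition rank_statistic :: "nat \<Rightarrow> ((nat \<Rightarrow> real) \<Rightarrow> (nat \<Rightarrow> real) \<Rightarrow> real) \<Rightarrow> bool" where
  "rank_statistic n T \<longleftrightarrow> (\<exists>t. \<forall>x y. T x y = t (ranks n x) (ranks n y))"

text \<open>
  Joint weak convergence of \<open>\<surd>n T\<^sub>n\<close> and of the normalised sum of the scores \<open>s\<close> to the centred
  normal law with variances \<open>\<sigma>\<^sup>2\<close>, \<open>J\<close> and correlation \<open>\<rho>\<close>.
\<close>

definition joint_normal_limit ::
    "'a measure \<Rightarrow> (nat \<Rightarrow> 'a \<Rightarrow> real) \<Rightarrow> (nat \<Rightarrow> 'a \<Rightarrow> real) \<Rightarrow>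
     (nat \<Rightarrow> (nat \<Rightarrow> real) \<Rightarrow> (nat \<Rightarrow> real) \<Rightarrow> real) \<Rightarrow> (real \<times> real \<Rightarrow> real) \<Rightarrow>
     real \<Rightarrow> real \<Rightarrow> real \<Rightarrow> bool" where
  "joint_normal_limit M X Y T s \<sigma> \<rho> J \<longleftrightarrow>
     (\<exists>N :: (real^2) measure.
        is_multivariate_normal 0
          (vector [vector [\<sigma>\<^sup>2, \<rho> * \<sigma> * sqrt J], vector [\<rho> * \<sigma> * sqrt J, J]]) N \<and>
        converges_in_distribution M
          (\<lambda>n \<omega>. vector [sqrt (real n) * T n (\<lambda>i. X i \<omega>) (\<lambda>i. Y i \<omega>),
                         (\<Sum>i<n. s (X i \<omega>, Y i \<omega>)) / sqrt (real n)]) N)"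

text \<open>
  Pitman efficiency of \<open>T\<close> with respect to the asymptotically optimal test in a quadratic mean
  differentiable one-parameter family \<open>p\<close>: the squared asymptotic correlation with the score sum.
  The sample \<open>X\<close>, \<open>Y\<close> is drawn under \<open>\<theta> = 0\<close>.  The score is determined by the family up to null
  sets of the law at \<open>\<theta> = 0\<close>, hence the squared correlation is unique when it exists.
\<close>

definition pitman_efficiency ::
    "'a measure \<Rightarrow> (nat \<Rightarrow> 'a \<Rightarrow> real) \<Rightarrow> (nat \<Rightarrow> 'a \<Rightarrow> real) \<Rightarrow>
     (real \<Rightarrow> real \<times> real \<Rightarrow> real) \<Rightarrow> (nat \<Rightarrow> (nat \<Rightarrow> real) \<Rightarrow> (nat \<Rightarrow> real) \<Rightarrow> real) \<Rightarrow> real" where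
  "pitman_efficiency M X Y p T =
     (THE e. \<exists>s \<sigma> \<rho> J. qmd_at_0 p s \<and> J = (LINT z|square_law (p 0). (s z)\<^sup>2) \<and>
        0 < \<sigma> \<and> 0 < J \<and> joint_normal_limit M X Y T s \<sigma> \<rho> J \<and> e = \<rho>\<^sup>2)"

end

theory Submission
  imports Defs
begin

text \<open>
  The efficient score has conditional mean zero given either coordinate.  Its normalised sum is
  therefore asymptotically orthogonal to every product \<open>a (X\<^sub>1, \<dots>, X\<^sub>n) b (Y\<^sub>1, \<dots>, Y\<^sub>n)\<close> of
  functions bounded by \<open>1\<close>: Bessel's inequality in the \<open>Y\<^sub>i\<close> and orthogonality in the \<open>X\<^sub>i\<close> bound
  the inner product by \<open>sqrt (I / n)\<close>.  When \<open>\<surd>n T\<^sub>n\<close> is asymptotically a sum of a function of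
  the \<open>X\<^sub>i\<close> and a function of the \<open>Y\<^sub>i\<close>, the addition theorem writes its sine as a sum of such
  products, so the limiting characteristic function is flat to first order in the direction of
  the score and the limiting covariance vanishes.
\<close>

section \<open>Margin transforms: monotonicity and change of variables\<close>

text \<open>The assumed limit says nothing about moments of \<open>sqrt n * T n\<close>, so its
  covariance with the score sum cannot be passed to the limit; only expectations of bounded
  continuous functions can. Hence the detour through cosines. The bounded factors may depend on all
  observations at once, and Cauchy-Schwarz alone would only show that their inner product with the
  score sum stays bounded.

  That the conditional means vanish is itself derived. Both equal minus the mean of the original
  score, and this mean is zero because otherwise the normalised score sums could not converge in
  law. Identifying the conditional expectations requires the score composed with the margins to be
  integrable under the null law. Quadratic mean differentiability gives integrability in uniform
  coordinates, and an inequality between integrals carries it through the margins. For that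
  inequality, monotonicity has to be deduced from a derivative that is positive only almost
  everywhere.

  The efficiency is a definite description, so every admissible score has to be compared with the
  efficient one.\<close>

lemma absolutely_continuous_tagged_division_sum_less:
  fixes a :: "real \<Rightarrow> real"
  assumes ac: "\<And>I. finite I \<Longrightarrow> (\<forall>(c, d)\<in>I. l \<le> c \<and> c \<le> d \<and> d \<le> u) \<Longrightarrow>
        disjoint_family_on (\<lambda>(c, d). {c<..<d}) I \<Longrightarrow> (\<Sum>(c, d)\<in>I. d - c) < \<delta> \<Longrightarrow>
        (\<Sum>(c, d)\<in>I. \<bar>a d - a c\<bar>) < \<epsilon>"
    and P: "P tagged_partial_division_of {x..y}" and xy: "l \<le> x" "y \<le> u"
    and sub: "\<And>t K. (t, K) \<in> P \<Longrightarrow> K \<subseteq> U"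
    and U: "U \<in> lmeasurable" "measure lebesgue U < \<delta>"
  shows "(\<Sum>(t, K)\<in>P. \<bar>a (Sup K) - a (Inf K)\<bar>) < \<epsilon>"
proof -
  note Pd = tagged_partial_division_ofD[OF P]
  \<comment> \<open>Distinct members of \<open>P\<close> have disjoint interiors, so nonempty
    interiors make \<open>ends\<close> injective. One-point intervals have increment 0 and are
    restored at the end.\<close>
  define P' where "P' = {z \<in> P. interior (snd z) \<noteq> {}}"
  define ends :: "real \<times> real set \<Rightarrow> real \<times> real" where "ends = (\<lambda>(t, K). (Inf K, Sup K))"
  have K: "\<exists>c d. c < d \<and> snd z = {c..d}" if "z \<in> P'" for z
  proof -
    have "\<exists>c d. snd z = {c..d}"
      using that Pd(4)[of "fst z" "snd z"] by (auto simp: P'_def)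
    then obtain c d where cd: "snd z = {c..d}" by blast
    have "{c<..<d} \<noteq> {}" using that by (simp add: P'_def cd)
    with cd show ?thesis by auto
  qed
  have fin: "finite P'"
    using Pd(1) by (auto simp: P'_def intro: finite_subset)
  have openI: "(case ends z of (c, d) \<Rightarrow> {c<..<d}) = interior (snd z)"
    if "z \<in> P'" for z
    using K[OF that] by (auto simp: ends_def  split: prod.splits)
  have disj: "interior (snd z) \<inter> interior (snd w) = {}" if "z \<in> P'" "w \<in> P'" "z \<noteq> w" for z w
    using Pd(5)[of "fst z" "snd z" "fst w" "snd w"] that by (auto simp: P'_def)
  have inj: "inj_on ends P'"
  proof (rule inj_onI)
    fix z w assume z: "z \<in> P'" and w: "w \<in> P'" and eq: "ends z = ends w"
    then have "interior (snd z) = interior (snd w)" "interior (snd z) \<noteq> {}"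
      using openI[OF z] openI[OF w] by (auto simp: P'_def)
    with disj[OF z w] show "z = w" by blast
  qed
  have len: "Sup (snd z) - Inf (snd z) = measure lebesgue (interior (snd z))" if "z \<in> P'" for z
    using K[OF that] by auto
  have "(\<Sum>(c, d)\<in>ends ` P'. \<bar>a d - a c\<bar>) < \<epsilon>"
  proof (rule ac)
    show "finite (ends ` P')" using fin by simp
    show "\<forall>(c, d)\<in>ends ` P'. l \<le> c \<and> c \<le> d \<and> d \<le> u"
    proof clarify
      fix c d t J assume "(c, d) = ends (t, J)" and tJ: "(t, J) \<in> P'"
      moreover obtain c' d' where "c' < d'" "J = {c'..d'}" using K[OF tJ] by auto
      moreover have "J \<subseteq> {x..y}" using Pd(3)[of t J] tJ by (auto simp: P'_def)
      ultimately show "l \<le> c \<and> c \<le> d \<and> d \<le> u"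
        using xy by (auto simp: ends_def)
    qed
    show "disjoint_family_on (\<lambda>(c, d). {c<..<d}) (ends ` P')"
      unfolding disjoint_family_on_def
    proof (intro ballI impI)
      fix m n assume "m \<in> ends ` P'" "n \<in> ends ` P'" and ne: "m \<noteq> n"
      then obtain z w where zw: "m = ends z" "z \<in> P'" "n = ends w" "w \<in> P'" by blast
      with ne have "z \<noteq> w" by auto
      from disj[OF zw(2,4) this] zw openI
      show "(case m of (c, d) \<Rightarrow> {c<..<d}) \<inter> (case n of (c, d) \<Rightarrow> {c<..<d}) = {}"
        by simp
    qed
    have "(\<Sum>(c, d)\<in>ends ` P'. d - c) = (\<Sum>z\<in>P'. Sup (snd z) - Inf (snd z))"
      by (subst sum.reindex[OF inj]) (auto simp: ends_def intro!: sum.cong)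
    also have "\<dots> = (\<Sum>z\<in>P'. measure lebesgue (interior (snd z)))"
      using len by (rule sum.cong[OF refl])
    also have "\<dots> = measure lebesgue (\<Union>z\<in>P'. interior (snd z))"
    proof (rule measure_UNION'[OF fin, symmetric])
      show "interior (snd z) \<in> lmeasurable" if "z \<in> P'" for z
        using K[OF that] by auto
      show "pairwise (\<lambda>z w. disjnt (interior (snd z)) (interior (snd w))) P'"
        using disj by (auto simp: pairwise_def disjnt_def)
    qed
    also have "\<dots> \<le> measure lebesgue U"
    proof (rule measure_mono_fmeasurable)
      show "(\<Union>z\<in>P'. interior (snd z)) \<subseteq> U"
        using sub interior_subset by (fastforce simp: P'_def)
      show "(\<Union>z\<in>P'. interior (snd z)) \<in> sets lebesgue"
        by (intro sets.finite_UN fin) auto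
    qed (use U in auto)
    finally show "(\<Sum>(c, d)\<in>ends ` P'. d - c) < \<delta>" using U(2) by simp
  qed
  also have "(\<Sum>(c, d)\<in>ends ` P'. \<bar>a d - a c\<bar>) = (\<Sum>(t, K)\<in>P'. \<bar>a (Sup K) - a (Inf K)\<bar>)"
    by (subst sum.reindex[OF inj]) (auto simp: ends_def intro!: sum.cong)
  also have "\<dots> = (\<Sum>(t, K)\<in>P. \<bar>a (Sup K) - a (Inf K)\<bar>)"
  proof (rule sum.mono_neutral_left)
    show "\<forall>z\<in>P - P'. (case z of (t, K) \<Rightarrow> \<bar>a (Sup K) - a (Inf K)\<bar>) = 0"
    proof clarify
      fix t J assume tJ: "(t, J) \<in> P" "(t, J) \<notin> P'"
      then obtain c d where "J = {c..d}" "t \<in> J" "interior J = {}"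
        using Pd(2,4)[of t J] by (auto simp: P'_def)
      then have "J = {c}" by auto
      then show "\<bar>a (Sup J) - a (Inf J)\<bar> = 0" by simp
    qed
  qed (use Pd(1) in \<open>auto simp: P'_def\<close>)
  finally show ?thesis .
qed

text \<open>
  Cousin's lemma: tags with positive derivative contribute nonnegative increments, and the
  increments at the remaining tags are small because these lie in an open set of small measure.
\<close>

lemma absolutely_continuous_between_pos_deriv_mono:
  assumes ac: "absolutely_continuous_between l u a"
    and pos: "AE x in lborel. x \<in> {l<..<u} \<longrightarrow> (\<exists>D>0. (a has_real_derivative D) (at x))"
  shows "mono_on {l..u} a"
proof (rule mono_onI)
  fix x y assume "x \<in> {l..u}" "y \<in> {l..u}" "x \<le> y"
  then have xy: "l \<le> x" "x \<le> y" "y \<le> u" by auto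
  \<comment> \<open>The endpoints are made exceptional so that every tag of \<open>{l..u}\<close>
    outside \<open>E\<close> is an interior point with a positive two-sided derivative.\<close>
  define E where "E = {t. \<not> (t \<in> {l<..<u} \<longrightarrow> (\<exists>D>0. (a has_real_derivative D) (at t)))} \<union> {l, u}"
  have "AE t in lborel. t \<noteq> l" "AE t in lborel. t \<noteq> u"
    by (auto intro: AE_lborel_singleton)
  then have "AE t in lborel. t \<notin> E"
    using pos by eventually_elim (auto simp: E_def)
  then have "AE t in lebesgue. t \<notin> E" by (rule AE_completion)
  then have E: "E \<in> null_sets lebesgue"
    by (simp add: completion.AE_iff_null_sets eventually_ae_filter completion.complete2)
       (metis (no_types, lifting) Collect_mem_eq completion.complete2)
  have "a x \<le> a y + \<epsilon>" if "\<epsilon> > 0" for \<epsilon>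
  proof -
    obtain \<delta> where "\<delta> > 0" and \<delta>: "\<And>I. finite I \<Longrightarrow> (\<forall>(c, d)\<in>I. l \<le> c \<and> c \<le> d \<and> d \<le> u) \<Longrightarrow>
        disjoint_family_on (\<lambda>(c, d). {c<..<d}) I \<Longrightarrow> (\<Sum>(c, d)\<in>I. d - c) < \<delta> \<Longrightarrow>
        (\<Sum>(c, d)\<in>I. \<bar>a d - a c\<bar>) < \<epsilon>"
      using ac[unfolded absolutely_continuous_between_def, rule_format, OF \<open>\<epsilon> > 0\<close>] by blast
    obtain U where U: "open U" "E \<subseteq> U" "U - E \<in> lmeasurable" "emeasure lebesgue (U - E) < ennreal \<delta>"
      using sets_lebesgue_outer_open[of E \<delta>] E \<open>\<delta> > 0\<close> by auto
    have "emeasure lebesgue U = emeasure lebesgue (U - E)"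
      using E U(1) by (intro emeasure_Diff_null_set[symmetric]) auto
    with U(4) have eU: "emeasure lebesgue U < ennreal \<delta>" by simp
    then have U': "U \<in> lmeasurable"
      using U(1) by (intro fmeasurableI) (auto intro: order.strict_trans)
    moreover have "measure lebesgue U < \<delta>"
      using eU emeasure_eq_measure2[OF U'] by (simp add: ennreal_less_iff)
    ultimately have U': "U \<in> lmeasurable" "measure lebesgue U < \<delta>" by auto
    \<comment> \<open>Only points on opposite sides of \<open>t\<close> are compared. A positive
      derivative at the single point \<open>t\<close> gives no monotonicity near \<open>t\<close>,
      but an interval of a fine division is tested only against the tag it contains.\<close>
    have "\<exists>d>0. \<forall>v w. v \<in> ball t d \<longrightarrow> w \<in> ball t d \<longrightarrow> v \<le> t \<longrightarrow> t \<le> w \<longrightarrow> a v \<le> a w"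
      if t: "t \<in> {l<..<u}" "t \<notin> E" for t
    proof -
      from t obtain D where D: "D > 0" "(a has_real_derivative D) (at t)" by (auto simp: E_def)
      obtain d1 where d1: "d1 > 0" "\<And>h. h > 0 \<Longrightarrow> h < d1 \<Longrightarrow> a t < a (t + h)"
        using DERIV_pos_inc_right[OF D(2,1)] by blast
      obtain d2 where d2: "d2 > 0" "\<And>h. h > 0 \<Longrightarrow> h < d2 \<Longrightarrow> a (t - h) < a t"
        using DERIV_pos_inc_left[OF D(2,1)] by blast
      show ?thesis
      proof (intro exI[of _ "min d1 d2"] conjI allI impI)
        fix v w assume vw: "v \<in> ball t (min d1 d2)" "w \<in> ball t (min d1 d2)" "v \<le> t" "t \<le> w"
        have "a v \<le> a t" using d2(2)[of "t - v"] vw by (cases "v = t") (auto simp: dist_real_def)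
        moreover have "a t \<le> a w"
          using d1(2)[of "w - t"] vw by (cases "w = t") (auto simp: dist_real_def)
        ultimately show "a v \<le> a w" by simp
      qed (use d1 d2 in auto)
    qed
    then obtain d where d: "\<And>t. t \<in> {l<..<u} \<Longrightarrow> t \<notin> E \<Longrightarrow> d t > 0"
      "\<And>t v w. t \<in> {l<..<u} \<Longrightarrow> t \<notin> E \<Longrightarrow> v \<in> ball t (d t) \<Longrightarrow> w \<in> ball t (d t) \<Longrightarrow>
          v \<le> t \<Longrightarrow> t \<le> w \<Longrightarrow> a v \<le> a w"
      by metis
    \<comment> \<open>The value \<open>UNIV\<close> is a default that no tag meets: tags lie in
      \<open>{x..y}\<close>, and those outside \<open>E\<close> are interior points of
      \<open>{l..u}\<close>.\<close>
    define g where "g t = (if t \<in> E then U else if t \<in> {l<..<u} then ball t (d t) else UNIV)" for t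
    have "gauge g" using U d by (auto simp: gauge_def g_def)
    then obtain P where P: "P tagged_division_of {x..y}" "g fine P"
      using fine_division_exists_real by blast
    note Pd = tagged_division_ofD[OF P(1)]
    define P1 where "P1 = {z \<in> P. fst z \<in> E}"
    have P1: "P1 \<subseteq> P" by (auto simp: P1_def)
    have P1t: "P1 tagged_partial_division_of {x..y}"
      using P(1) P1 tagged_partial_division_subset tagged_division_of_def by blast
    have "(\<Sum>(t, K)\<in>P1. \<bar>a (Sup K) - a (Inf K)\<bar>) < \<epsilon>"
    proof (rule absolutely_continuous_tagged_division_sum_less[OF \<delta> P1t])
      show "K \<subseteq> U" if "(t, K) \<in> P1" for t K
        using that P(2) by (fastforce simp: fine_def P1_def g_def)
    qed (use xy U' in auto)
    moreover have "(\<Sum>(t, K)\<in>P1. a (Inf K) - a (Sup K)) \<le> (\<Sum>(t, K)\<in>P1. \<bar>a (Sup K) - a (Inf K)\<bar>)"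
      by (rule sum_mono) auto
    moreover have "(\<Sum>(t, K)\<in>P1. a (Inf K) - a (Sup K)) = - (\<Sum>(t, K)\<in>P1. a (Sup K) - a (Inf K))"
      by (simp add: sum_negf[symmetric] case_prod_unfold)
    moreover have "0 \<le> (\<Sum>(t, K)\<in>P - P1. a (Sup K) - a (Inf K))"
    proof (rule sum_nonneg, clarify)
      fix t K assume tK: "(t, K) \<in> P" "(t, K) \<notin> P1"
      then obtain c e where K: "K = {c..e}" "t \<in> K" using Pd(2,4)[of t K] by auto
      have "t \<in> {l..u}" using Pd(3)[of t K] tK K xy by auto
      moreover have "t \<notin> E" using tK by (auto simp: P1_def)
      ultimately have t: "t \<in> {l<..<u}" "t \<notin> E" by (auto simp: E_def)
      then have "K \<subseteq> ball t (d t)" using P(2) tK by (fastforce simp: fine_def g_def)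
      then have "a c \<le> a e" using K \<open>K \<subseteq> ball t (d t)\<close> by (intro d(2)[OF t]) (auto simp del: mem_ball)
      then show "0 \<le> a (Sup K) - a (Inf K)" using K by auto
    qed
    moreover have "(\<Sum>(t, K)\<in>P. a (Sup K) - a (Inf K)) = a y - a x"
      using additive_tagged_division_1[OF xy(2) P(1)] .
    moreover have "(\<Sum>(t, K)\<in>P. a (Sup K) - a (Inf K)) =
        (\<Sum>(t, K)\<in>P - P1. a (Sup K) - a (Inf K)) + (\<Sum>(t, K)\<in>P1. a (Sup K) - a (Inf K))"
      by (rule sum.subset_diff[OF P1 Pd(1)])
    ultimately show ?thesis by linarith
  qed
  then show "a x \<le> a y" by (rule field_le_epsilon)
qed

lemma margin_transformsD:
  assumes "a \<in> margin_transforms"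
  shows "x \<in> {0..1} \<Longrightarrow> a x \<in> {0..1}"
    and "absolutely_continuous_between 0 1 a"
    and "AE x in lborel. x \<in> {0<..<1} \<longrightarrow> (\<exists>D>0. (a has_real_derivative D) (at x))"
  using assms unfolding margin_transforms_def by blast+

lemma margin_transform_mono:
  assumes "a \<in> margin_transforms"
  shows "mono_on {0..1} a"
  using absolutely_continuous_between_pos_deriv_mono margin_transformsD(2,3)[OF assms] .

lemma margin_transform_deriv_pos:
  assumes "a \<in> margin_transforms"
  shows "AE x in lborel. x \<in> {0<..<1} \<longrightarrow> 0 < deriv a x"
  using margin_transformsD(3)[OF assms] by eventually_elim (auto simp: DERIV_imp_deriv)

text \<open>
  A boundary value attained at an interior point would be an extremum, where the derivative
  cannot be positive.
\<close>

lemma margin_transform_interior: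
  assumes "a \<in> margin_transforms"
  shows "AE x in lborel. x \<in> {0<..<1} \<longrightarrow> a x \<in> {0<..<1}"
  using margin_transformsD(3)[OF assms]
proof eventually_elim
  case (elim x)
  show ?case
  proof
    assume x: "x \<in> {0<..<1}"
    with elim obtain D where D: "D > 0" "(a has_real_derivative D) (at x)" by blast
    obtain d1 where d1: "d1 > 0" "\<And>h. h > 0 \<Longrightarrow> h < d1 \<Longrightarrow> a x < a (x + h)"
      using DERIV_pos_inc_right[OF D(2,1)] by blast
    obtain d2 where d2: "d2 > 0" "\<And>h. h > 0 \<Longrightarrow> h < d2 \<Longrightarrow> a (x - h) < a x"
      using DERIV_pos_inc_left[OF D(2,1)] by blast
    define h where "h = min (min d1 d2) (min x (1 - x)) / 2"
    have h: "0 < h" "h < d1" "h < d2" "h \<le> x" "h \<le> 1 - x"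
      using d1(1) d2(1) x by (auto simp: h_def min_def)
    have "a x < a (x + h)" "a (x - h) < a x" using d1(2) d2(2) h by auto
    moreover have "a (x + h) \<in> {0..1}" "a (x - h) \<in> {0..1}"
      using margin_transformsD(1)[OF assms, of "x + h"] margin_transformsD(1)[OF assms, of "x - h"] h x
      by auto
    ultimately show "a x \<in> {0<..<1}" by auto
  qed
qed

text \<open>Strictness comes from the smaller of two points alone: its positive derivative gives an
  immediate increase, and monotonicity carries this increase on to the larger point.\<close>

lemma margin_transform_inj_on:
  assumes "a \<in> margin_transforms"
  shows "inj_on a {x \<in> {0<..<1}. \<exists>D>0. (a has_real_derivative D) (at x)}"
proof -
  have "a x < a y" if x: "x \<in> {0<..<1}" "D > 0" "(a has_real_derivative D) (at x)"
    and y: "y \<in> {0<..<1}" "x < y" for x y D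
  proof -
    obtain d where d: "d > 0" "\<And>h. h > 0 \<Longrightarrow> h < d \<Longrightarrow> a x < a (x + h)"
      using DERIV_pos_inc_right[OF x(3,2)] by blast
    define h where "h = min d (y - x) / 2"
    have h: "0 < h" "h < d" "x + h \<le> y" 
    proof -
      have "0 < h" "h \<le> d / 2" "h \<le> (y - x) / 2" using d(1) y by (auto simp: h_def)
      then show "0 < h" "h < d" "x + h \<le> y" using d(1) y by auto
    qed
    have "a x < a (x + h)" using d(2) h by auto
    also have "\<dots> \<le> a y"
      using h x y by (intro mono_onD[OF margin_transform_mono[OF assms]]) auto
    finally show ?thesis .
  qed
  then show ?thesis
    by (intro linorder_inj_onI) fastforce+
qed

text \<open>The values of \<open>a\<close> outside \<open>{0..1}\<close> are arbitrary, hence the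
  truncation; inside, monotonicity is enough.\<close>

lemma margin_transform_measurable:
  assumes "a \<in> margin_transforms"
  shows "(\<lambda>x. indicator {0..1} x * a x) \<in> borel_measurable borel"
proof -
  have "a \<in> borel_measurable (restrict_space borel {0..1})"
    using margin_transform_mono[OF assms] by (intro borel_measurable_mono_on_fnc)
  then show ?thesis
    by (subst (asm) borel_measurable_restrict_space_iff) (auto simp: mult.commute)
qed

text \<open>
  The library's change of variables needs injectivity only on the set of points with positive
  derivative, and the image of that set is a subset of the unit interval.
\<close>

lemma margin_transform_substitution_le:
  assumes a: "a \<in> margin_transforms"
    and Q: "Q \<in> borel_measurable borel" "\<And>x. x \<in> {0<..<1} \<Longrightarrow> Q x = ennreal (deriv a x)"
      "\<And>x. x \<notin> {0<..<1} \<Longrightarrow> Q x = 0"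
    and f: "f \<in> borel_measurable borel"
  shows "(\<integral>\<^sup>+x. f (a x) * Q x \<partial>lborel) \<le> (\<integral>\<^sup>+u. f u \<partial>lborel)"
proof -
  define a' where "a' x = indicator {0..1} x * a x" for x
  have a'[measurable]: "a' \<in> borel_measurable borel"
    using margin_transform_measurable[OF a] by (simp add: a'_def[abs_def])
  have a'_eq: "a' x = a x" if "x \<in> {0<..<1}" for x using that by (simp add: a'_def)
  note Q(1)[measurable] f[measurable]
  define m where "m = distr (density lborel Q) borel a'"
  define G where "G = {x \<in> {0<..<1}. \<exists>D>0. (a has_real_derivative D) (at x)}"
  have G: "AE x in lborel. x \<in> {0<..<1} \<longrightarrow> x \<in> G"
    using margin_transformsD(3)[OF a] by eventually_elim (auto simp: G_def)
  \<comment> \<open>It suffices to dominate the image measure on Borel sets. An inequality is enough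
    because only finiteness of an integral is transferred later, so nothing has to be said about the
    image of the points without a positive derivative.\<close>
  have "m \<le> lborel"
  proof (subst le_measure)
    show "\<forall>B\<in>sets m. emeasure m B \<le> emeasure lborel B"
    proof
      fix B assume "B \<in> sets m"
      then have B[measurable]: "B \<in> sets borel" by (simp add: m_def)
      define W where "W = a' -` B \<inter> {0<..<1}"
      have W[measurable]: "W \<in> sets borel" unfolding W_def by measurable
      define S where "S = W \<inter> G"
      \<comment> \<open>\<open>G\<close> is known only to contain almost every point of the
        interval, which makes \<open>S\<close> Lebesgue measurable; the computation therefore moves
        to the completion.\<close>
      have "AE x in lborel. \<not> (x \<in> W \<and> x \<notin> G)"
        using G by eventually_elim (auto simp: W_def)
      then have "Measurable.pred lebesgue (\<lambda>x. x \<in> W \<and> x \<notin> G)"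
        by (rule sets_completion_AE)
      then have "W - {x. x \<in> W \<and> x \<notin> G} \<in> sets lebesgue"
        by (intro sets.Diff) (simp_all add: pred_def)
      moreover have "S = W - {x. x \<in> W \<and> x \<notin> G}" by (auto simp: S_def)
      ultimately have S: "S \<in> sets lebesgue" by simp
      have der: "(a has_field_derivative deriv a x) (at x within S)" "deriv a x > 0" if "x \<in> S" for x
        using that by (auto simp: S_def G_def DERIV_imp_deriv intro: has_field_derivative_at_within)
      have inj: "inj_on a S"
        using margin_transform_inj_on[OF a] by (rule inj_on_subset) (auto simp: S_def G_def)
      have "a ` S \<in> sets lebesgue"
        by (rule differentiable_image_in_sets_lebesgue[OF S])
          (use der(1) in \<open>auto simp: differentiable_on_def real_differentiable_def\<close>)
      moreover have sub: "a ` S \<subseteq> {0..1} \<inter> B"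
        using margin_transformsD(1)[OF a] by (auto simp: S_def W_def G_def a'_eq)
      ultimately have aS: "a ` S \<in> lmeasurable"
        by (intro bounded_set_imp_lmeasurable) (auto intro: bounded_subset[of "{0..1}"])
      have "emeasure m B = (\<integral>\<^sup>+x. Q x * indicator (a' -` B) x \<partial>lborel)"
        using measurable_sets[OF a' B]
        by (simp add: m_def emeasure_distr emeasure_density)
      also have "\<dots> = (\<integral>\<^sup>+x. Q x * indicator W x \<partial>lebesgue)"
        by (subst nn_integral_completion[symmetric])
          (auto intro!: nn_integral_cong simp: W_def Q(3) split: split_indicator)
      also have "\<dots> = (\<integral>\<^sup>+x. ennreal \<bar>deriv a x\<bar> * indicator S x \<partial>lebesgue)"
        using AE_completion[OF G]
        by (intro nn_integral_cong_AE, eventually_elim)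
           (auto simp: S_def W_def Q(2) G_def DERIV_imp_deriv split: split_indicator)
      also have "\<dots> = ennreal (measure lebesgue (a ` S))"
      proof -
        have "(\<lambda>x. 1 :: real) absolutely_integrable_on a ` S \<and>
            integral (a ` S) (\<lambda>x. 1) = measure lebesgue (a ` S)"
          using aS by (simp add: lmeasure_integral absolutely_integrable_on_const)
        then have *: "(\<lambda>x. \<bar>deriv a x\<bar>) absolutely_integrable_on S"
            "integral S (\<lambda>x. \<bar>deriv a x\<bar>) = measure lebesgue (a ` S)"
          using has_absolute_integral_change_of_variables_1'[OF S der(1) inj,
              of "\<lambda>x. 1" "measure lebesgue (a ` S)"] by auto
        have "(LINT x:S|lebesgue. \<bar>deriv a x\<bar>) = measure lebesgue (a ` S)"
          using * by (simp add: set_lebesgue_integral_eq_integral)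
        moreover have "(\<integral>\<^sup>+x. ennreal \<bar>deriv a x\<bar> * indicator S x \<partial>lebesgue) =
            ennreal (LINT x:S|lebesgue. \<bar>deriv a x\<bar>)"
          using *(1) unfolding set_integrable_def set_lebesgue_integral_def
          by (subst nn_integral_eq_integral[symmetric])
            (auto intro!: nn_integral_cong split: split_indicator)
        ultimately show ?thesis by simp
      qed
      also have "\<dots> = emeasure lebesgue (a ` S)"
        using aS by (simp add: emeasure_eq_measure2)
      also have "\<dots> \<le> emeasure lebesgue B"
        using sub by (intro emeasure_mono) auto
      finally show "emeasure m B \<le> emeasure lborel B" by simp
    qed
  qed (simp add: m_def)
  have "(\<integral>\<^sup>+x. f (a x) * Q x \<partial>lborel) = (\<integral>\<^sup>+x. Q x * f (a' x) \<partial>lborel)"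
    by (intro nn_integral_cong) (metis Q(3) a'_eq mult.commute mult_zero_left)
  also have "\<dots> = (\<integral>\<^sup>+u. f u \<partial>m)"
    by (simp add: m_def nn_integral_distr nn_integral_density)
  also have "\<dots> \<le> (\<integral>\<^sup>+u. f u \<partial>lborel)"
    using \<open>m \<le> lborel\<close> by (intro nn_integral_mono_measure) (simp_all add: m_def)
  finally show ?thesis .
qed

section \<open>Quadratic mean differentiability\<close>

lemma space_square_lborel [simp]: "space square_lborel = unit_square"
  by (simp add: square_lborel_def unit_square_def space_restrict_space)

lemma unit_square_borel [measurable]: "unit_square \<in> sets borel"
  unfolding unit_square_def by (intro borel_open open_Times) auto

lemma emeasure_space_square_lborel: "emeasure square_lborel unit_square = 1"
proof -
  have "emeasure square_lborel unit_square = emeasure (lborel \<Otimes>\<^sub>M lborel) unit_square"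
    unfolding square_lborel_def lborel_prod
    by (subst emeasure_restrict_space) auto
  also have "\<dots> = 1"
    unfolding unit_square_def by (subst lborel.emeasure_pair_measure_Times) auto
  finally show ?thesis .
qed

lemma qmd_at_0_nn_integral_remainder:
  fixes p s
  defines "R \<equiv> \<lambda>\<theta> z. sqrt (p \<theta> z) - sqrt (p 0 z) - 1/2 * \<theta> * s z * sqrt (p 0 z)"
  assumes "qmd_at_0 p s"
  shows "((\<lambda>\<theta>. \<integral>\<^sup>+z. ennreal ((R \<theta> z)\<^sup>2 / \<theta>\<^sup>2) \<partial>square_lborel) \<longlongrightarrow> 0) (at 0)"
    and "\<bar>\<theta>\<bar> < 1 \<Longrightarrow> R \<theta> \<in> borel_measurable square_lborel"
proof -
  have p[measurable]: "p \<theta> \<in> borel_measurable square_lborel" if "\<bar>\<theta>\<bar> < 1" for \<theta>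
    using assms(2) that by (simp add: qmd_at_0_def)
  have [measurable]: "p 0 \<in> borel_measurable square_lborel" using p[of 0] by simp
  have s[measurable]: "s \<in> borel_measurable square_lborel"
    using assms(2) by (simp add: qmd_at_0_def)
  show R: "R \<theta> \<in> borel_measurable square_lborel" if "\<bar>\<theta>\<bar> < 1" for \<theta>
  proof -
    note p[OF that, measurable]
    show ?thesis unfolding R_def by measurable
  qed
  have "((\<lambda>\<theta>. (\<integral>\<^sup>+z. ennreal ((R \<theta> z)\<^sup>2) \<partial>square_lborel) / ennreal (\<theta>\<^sup>2)) \<longlongrightarrow> 0) (at 0)"
    using assms(2) by (simp add: qmd_at_0_def R_def)
  moreover have "eventually (\<lambda>\<theta>::real. \<theta> \<in> ball 0 1 \<and> \<theta> \<noteq> 0) (at 0)"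
    by (intro eventually_conj eventually_at_in_open' eventually_neq_at_within) auto
  then have "eventually (\<lambda>\<theta>. (\<integral>\<^sup>+z. ennreal ((R \<theta> z)\<^sup>2) \<partial>square_lborel) / ennreal (\<theta>\<^sup>2)
      = (\<integral>\<^sup>+z. ennreal ((R \<theta> z)\<^sup>2 / \<theta>\<^sup>2) \<partial>square_lborel)) (at 0)"
  proof eventually_elim
    case (elim \<theta>)
    then have [measurable]: "R \<theta> \<in> borel_measurable square_lborel" by (intro R) (auto simp: dist_real_def)
    show ?case
      using elim by (subst nn_integral_divide[symmetric]) (auto simp: divide_ennreal)
  qed
  ultimately show "((\<lambda>\<theta>. \<integral>\<^sup>+z. ennreal ((R \<theta> z)\<^sup>2 / \<theta>\<^sup>2) \<partial>square_lborel) \<longlongrightarrow> 0) (at 0)"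
    by (rule Lim_transform_eventually)
qed

text \<open>Both remainders contain the same increment of square roots, so their difference is
  \<open>\<theta> / 2\<close> times \<open>(s - s') * sqrt (p 0)\<close> up to sign. After division
  by \<open>\<theta>\<^sup>2\<close> the integral of its square no longer depends on
  \<open>\<theta>\<close>, yet it tends to 0. This makes the squared correlation in
  \<open>pitman_efficiency\<close> independent of the chosen score.\<close>

lemma qmd_at_0_score_unique:
  assumes s: "qmd_at_0 p s" and s': "qmd_at_0 p s'"
  shows "AE z in square_law (p 0). s z = s' z"
proof -
  define R where "R \<theta> z = sqrt (p \<theta> z) - sqrt (p 0 z) - 1/2 * \<theta> * s z * sqrt (p 0 z)" for \<theta> z
  define R' where "R' \<theta> z = sqrt (p \<theta> z) - sqrt (p 0 z) - 1/2 * \<theta> * s' z * sqrt (p 0 z)" for \<theta> z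
  define w where "w z = (s z - s' z) * sqrt (p 0 z)" for z
  note lims = qmd_at_0_nn_integral_remainder[OF s, folded R_def]
    qmd_at_0_nn_integral_remainder[OF s', folded R'_def]
  have [measurable]: "p 0 \<in> borel_measurable square_lborel" "s \<in> borel_measurable square_lborel"
     "s' \<in> borel_measurable square_lborel" using s s' by (simp_all add: qmd_at_0_def)
  have w[measurable]: "w \<in> borel_measurable square_lborel" unfolding w_def[abs_def] by measurable
  have "((\<lambda>\<theta>. 8 * ((\<integral>\<^sup>+z. ennreal ((R \<theta> z)\<^sup>2 / \<theta>\<^sup>2) \<partial>square_lborel) +
      (\<integral>\<^sup>+z. ennreal ((R' \<theta> z)\<^sup>2 / \<theta>\<^sup>2) \<partial>square_lborel))) \<longlongrightarrow> 8 * (0 + 0)) (at 0)"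
    by (intro tendsto_intros ennreal_tendsto_cmult lims) auto
  moreover have "eventually (\<lambda>\<theta>::real. \<theta> \<in> ball 0 1 \<and> \<theta> \<noteq> 0) (at 0)"
    by (intro eventually_conj eventually_at_in_open' eventually_neq_at_within) auto
  then have "eventually (\<lambda>\<theta>. (\<integral>\<^sup>+z. ennreal ((w z)\<^sup>2) \<partial>square_lborel) \<le>
      8 * ((\<integral>\<^sup>+z. ennreal ((R \<theta> z)\<^sup>2 / \<theta>\<^sup>2) \<partial>square_lborel) +
      (\<integral>\<^sup>+z. ennreal ((R' \<theta> z)\<^sup>2 / \<theta>\<^sup>2) \<partial>square_lborel))) (at 0)"
  proof eventually_elim
    case (elim \<theta>)
    then have [measurable]: "R \<theta> \<in> borel_measurable square_lborel" "R' \<theta> \<in> borel_measurable square_lborel"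
      by (auto intro!: lims simp: dist_real_def)
    \<comment> \<open>The constant 8 is 4 from squaring \<open>2 * (R' - R)\<close>, times 2 from
      the square of a difference being at most twice the sum of the squares.\<close>
    have le: "(w z)\<^sup>2 \<le> 8 * ((R \<theta> z)\<^sup>2 / \<theta>\<^sup>2 + (R' \<theta> z)\<^sup>2 / \<theta>\<^sup>2)" for z
    proof -
      have "\<theta> * w z = 2 * (R' \<theta> z - R \<theta> z)"
        by (simp add: w_def R_def R'_def algebra_simps)
      then have "\<theta>\<^sup>2 * (w z)\<^sup>2 = 4 * (R' \<theta> z - R \<theta> z)\<^sup>2"
        by (metis (no_types, lifting) power_mult_distrib four_x_squared)
      also have "\<dots> \<le> 8 * ((R \<theta> z)\<^sup>2 + (R' \<theta> z)\<^sup>2)"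
        using zero_le_power2[of "R' \<theta> z + R \<theta> z"] by (simp add: power2_sum power2_diff)
      finally show ?thesis using elim by (simp add: field_simps)
    qed
    have "(\<integral>\<^sup>+z. ennreal ((w z)\<^sup>2) \<partial>square_lborel) \<le>
        (\<integral>\<^sup>+z. 8 * (ennreal ((R \<theta> z)\<^sup>2 / \<theta>\<^sup>2) + ennreal ((R' \<theta> z)\<^sup>2 / \<theta>\<^sup>2)) \<partial>square_lborel)"
    proof (rule nn_integral_mono)
      fix z
      have "ennreal ((w z)\<^sup>2) \<le> ennreal (8 * ((R \<theta> z)\<^sup>2 / \<theta>\<^sup>2 + (R' \<theta> z)\<^sup>2 / \<theta>\<^sup>2))"
        by (rule ennreal_leI[OF le])
      then show "ennreal ((w z)\<^sup>2) \<le> 8 * (ennreal ((R \<theta> z)\<^sup>2 / \<theta>\<^sup>2) + ennreal ((R' \<theta> z)\<^sup>2 / \<theta>\<^sup>2))"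
        by (subst (asm) ennreal_mult) (simp_all add: distrib_left)
    qed
    also have "\<dots> = 8 * ((\<integral>\<^sup>+z. ennreal ((R \<theta> z)\<^sup>2 / \<theta>\<^sup>2) \<partial>square_lborel) +
      (\<integral>\<^sup>+z. ennreal ((R' \<theta> z)\<^sup>2 / \<theta>\<^sup>2) \<partial>square_lborel))"
      by (simp add: nn_integral_cmult nn_integral_add)
    finally show ?case .
  qed
  ultimately have "(\<integral>\<^sup>+z. ennreal ((w z)\<^sup>2) \<partial>square_lborel) \<le> 8 * (0 + 0)"
    by (rule tendsto_lowerbound) auto
  then have "AE z in square_lborel. ennreal ((w z)\<^sup>2) = 0"
    by (subst nn_integral_0_iff_AE[symmetric]) auto
  then have "AE z in square_lborel. 0 < ennreal (p 0 z) \<longrightarrow> s z = s' z"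
    by eventually_elim (auto simp: w_def ennreal_eq_0_iff)
  then show ?thesis
    unfolding square_law_def by (subst AE_density) auto
qed

text \<open>A single nonzero parameter suffices. The score term is a combination of the square roots
  of two integrable densities and a square integrable remainder, and on a space of finite mass
  square integrability implies integrability.\<close>

lemma qmd_at_0_score_nn_integral_finite:
  assumes qmd: "qmd_at_0 p s"
    and nonneg: "\<And>\<theta> z. \<bar>\<theta>\<bar> < 1 \<Longrightarrow> z \<in> unit_square \<Longrightarrow> 0 \<le> p \<theta> z"
    and fin: "\<And>\<theta>. \<bar>\<theta>\<bar> < 1 \<Longrightarrow> (\<integral>\<^sup>+z. ennreal (p \<theta> z) \<partial>square_lborel) < \<infinity>"
  shows "(\<integral>\<^sup>+z. ennreal \<bar>s z * sqrt (p 0 z)\<bar> \<partial>square_lborel) < \<infinity>"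
proof -
  define R where "R \<theta> z = sqrt (p \<theta> z) - sqrt (p 0 z) - 1/2 * \<theta> * s z * sqrt (p 0 z)" for \<theta> z
  note lim = qmd_at_0_nn_integral_remainder[OF qmd, folded R_def]
  have p: "p \<theta> \<in> borel_measurable square_lborel" if "\<bar>\<theta>\<bar> < 1" for \<theta>
    using qmd that by (simp add: qmd_at_0_def)
  have [measurable]: "p 0 \<in> borel_measurable square_lborel" "s \<in> borel_measurable square_lborel"
    using qmd by (simp_all add: qmd_at_0_def)
  have "eventually (\<lambda>\<theta>. (\<integral>\<^sup>+z. ennreal ((R \<theta> z)\<^sup>2 / \<theta>\<^sup>2) \<partial>square_lborel) < 1) (at 0)"
    by (rule order_tendstoD(2)[OF lim(1)]) simp
  moreover have "eventually (\<lambda>\<theta>::real. \<theta> \<in> ball 0 1 \<and> \<theta> \<noteq> 0) (at 0)"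
    by (intro eventually_conj eventually_at_in_open' eventually_neq_at_within) auto
  ultimately have "eventually (\<lambda>\<theta>. (\<integral>\<^sup>+z. ennreal ((R \<theta> z)\<^sup>2 / \<theta>\<^sup>2) \<partial>square_lborel) < 1 \<and>
      \<bar>\<theta>\<bar> < 1 \<and> \<theta> \<noteq> 0) (at 0)"
    by eventually_elim (auto simp: dist_real_def)
  then obtain \<theta> where \<theta>: "(\<integral>\<^sup>+z. ennreal ((R \<theta> z)\<^sup>2 / \<theta>\<^sup>2) \<partial>square_lborel) < 1" "\<bar>\<theta>\<bar> < 1" "\<theta> \<noteq> 0"
    using eventually_happens[of _ "at (0::real)"] by (auto simp: trivial_limit_at)
  note p[OF \<theta>(2), measurable] lim(2)[OF \<theta>(2), measurable]
  \<comment> \<open>The 3 collects one unit from \<open>\<bar>x\<bar> \<le> x\<^sup>2 + 1\<close>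
    for each of the two square roots and the remainder. Dividing the squared remainder by
    \<open>\<theta>\<^sup>2\<close>, which is at most 1, only enlarges it.\<close>
  have le: "\<bar>\<theta>\<bar> / 2 * \<bar>s z * sqrt (p 0 z)\<bar> \<le> p \<theta> z + p 0 z + (R \<theta> z)\<^sup>2 / \<theta>\<^sup>2 + 3"
    if z: "z \<in> unit_square" for z
  proof -
    have abs_le: "\<bar>x\<bar> \<le> x\<^sup>2 + 1" for x :: real
      using zero_le_power2[of "\<bar>x\<bar> - 1/2"] by (simp add: power2_diff power_divide)
    have "\<bar>\<theta>\<bar> / 2 * \<bar>s z * sqrt (p 0 z)\<bar> = \<bar>\<theta> / 2 * (s z * sqrt (p 0 z))\<bar>" by (simp add: abs_mult)
    also have "\<theta> / 2 * (s z * sqrt (p 0 z)) = sqrt (p \<theta> z) - sqrt (p 0 z) - R \<theta> z"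
      by (simp add: R_def)
    also have "\<bar>\<dots>\<bar> \<le> \<bar>sqrt (p \<theta> z)\<bar> + \<bar>sqrt (p 0 z)\<bar> + \<bar>R \<theta> z\<bar>" by linarith
    also have "\<dots> \<le> p \<theta> z + p 0 z + (R \<theta> z)\<^sup>2 + 3"
      using abs_le[of "sqrt (p \<theta> z)"] abs_le[of "sqrt (p 0 z)"] abs_le[of "R \<theta> z"]
        nonneg[OF \<theta>(2) z] nonneg[of 0, OF _ z] by simp
    also have "(R \<theta> z)\<^sup>2 \<le> (R \<theta> z)\<^sup>2 / \<theta>\<^sup>2"
    proof -
      have "\<theta>\<^sup>2 \<le> 1" using \<theta>(2) by (simp add: abs_square_le_1)
      then show ?thesis using \<theta>(3) by (simp add: pos_le_divide_eq mult_left_le)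
    qed
    finally show ?thesis by simp
  qed
  have eq: "ennreal (\<bar>\<theta>\<bar> / 2 * x) = ennreal (\<bar>\<theta>\<bar> / 2) * ennreal x" if "0 \<le> x" for x
    using that by (intro ennreal_mult) auto
  have "ennreal (\<bar>\<theta>\<bar> / 2) * (\<integral>\<^sup>+z. ennreal \<bar>s z * sqrt (p 0 z)\<bar> \<partial>square_lborel) =
      (\<integral>\<^sup>+z. ennreal (\<bar>\<theta>\<bar> / 2 * \<bar>s z * sqrt (p 0 z)\<bar>) \<partial>square_lborel)"
    unfolding eq[OF abs_ge_zero] by (rule nn_integral_cmult[symmetric]) measurable
  also have "\<dots> \<le> (\<integral>\<^sup>+z. ennreal (p \<theta> z) + ennreal (p 0 z) + ennreal ((R \<theta> z)\<^sup>2 / \<theta>\<^sup>2) + 3 \<partial>square_lborel)"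
  proof (rule nn_integral_mono)
    fix z assume "z \<in> space square_lborel"
    then have z: "z \<in> unit_square" by simp
    from ennreal_leI[OF le[OF z]] show "ennreal (\<bar>\<theta>\<bar> / 2 * \<bar>s z * sqrt (p 0 z)\<bar>) \<le>
        ennreal (p \<theta> z) + ennreal (p 0 z) + ennreal ((R \<theta> z)\<^sup>2 / \<theta>\<^sup>2) + 3"
      using nonneg[OF \<theta>(2) z] nonneg[of 0, OF _ z] by (simp add: ennreal_plus)
  qed
  also have "\<dots> < \<infinity>"
    using fin[OF \<theta>(2)] fin[of 0] order.strict_trans[OF \<theta>(1), of \<infinity>]
    by (simp add: nn_integral_add emeasure_space_square_lborel)
  finally show ?thesis
    using \<theta>(3) by (auto simp: ennreal_mult_less_top)
qed

section \<open>The null law as a product measure\<close>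

text \<open>\<open>deriv a\<close> is arbitrary where \<open>a\<close> is not differentiable, and
  \<open>ennreal\<close> cuts off negative values there. For a margin transform such points of the
  open interval form a null set.\<close>

definition marginal_density :: "(real \<Rightarrow> real) \<Rightarrow> real \<Rightarrow> ennreal" where
  "marginal_density a x = ennreal (deriv a x) * indicator {0<..<1} x"

lemma borel_measurable_square_lborel_iff:
  fixes f :: "real \<times> real \<Rightarrow> ennreal"
  shows "f \<in> borel_measurable square_lborel \<longleftrightarrow> (\<lambda>z. f z * indicator unit_square z) \<in> borel_measurable borel"
  unfolding square_lborel_def by (subst borel_measurable_restrict_space_iff_ennreal) auto

lemma borel_measurable_square_lborel_real_iff:
  fixes f :: "real \<times> real \<Rightarrow> real"
  shows "f \<in> borel_measurable square_lborel \<longleftrightarrow> (\<lambda>z. indicator unit_square z * f z) \<in> borel_measurable borel"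
  unfolding square_lborel_def by (subst borel_measurable_restrict_space_iff) auto

lemma nn_integral_square_lborel:
  "(\<integral>\<^sup>+z. f z \<partial>square_lborel) = (\<integral>\<^sup>+z. f z * indicator unit_square z \<partial>lborel)"
  unfolding square_lborel_def by (subst nn_integral_restrict_space) auto

lemma indicator_unit_square:
  "indicator unit_square (x, y) = (indicator {0<..<1} x * indicator {0<..<1} y :: 'a::semiring_1)"
  by (auto simp: unit_square_def split: split_indicator)

lemma margin_transform_exists_deriv_pos:
  assumes "a \<in> margin_transforms"
  obtains x where "x \<in> {0<..<1}" "0 < deriv a x"
proof -
  have "\<not> (\<forall>x\<in>{0<..<1}. \<not> 0 < deriv a x)"
  proof
    assume "\<forall>x\<in>{0<..<1}. \<not> 0 < deriv a x"
    then have "AE x in lborel. x \<notin> {0<..<1::real}"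
      using margin_transform_deriv_pos[OF assms] by auto
    then have "{0<..<1::real} \<in> null_sets lborel" by (simp add: AE_iff_null_sets)
    then show False by (simp add: null_sets_def)
  qed
  then show ?thesis using that by blast
qed

text \<open>Since \<open>deriv\<close> may be arbitrary on a null set, measurability is read off the
  joint density: its section at a point where the other derivative is positive, divided by that
  derivative, is the marginal density.\<close>

lemma marginal_density_measurable:
  assumes margins: "q \<in> margin_transforms" "r \<in> margin_transforms"
    and meas: "(\<lambda>z. ennreal (null_density q r z)) \<in> borel_measurable square_lborel"
  shows "marginal_density q \<in> borel_measurable borel" "marginal_density r \<in> borel_measurable borel"
proof -
  define f where "f z = ennreal (null_density q r z) * indicator unit_square z" for z
  have "f \<in> borel_measurable borel"
    using meas unfolding borel_measurable_square_lborel_iff by (simp add: f_def[abs_def])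
  then have f[measurable]: "f \<in> borel_measurable (borel \<Otimes>\<^sub>M borel)"
    by (simp add: borel_prod)
  obtain y where y: "y \<in> {0<..<1}" "0 < deriv r y"
    using margin_transform_exists_deriv_pos[OF margins(2)] .
  obtain x where x: "x \<in> {0<..<1}" "0 < deriv q x"
    using margin_transform_exists_deriv_pos[OF margins(1)] .
  have "marginal_density q t = f (t, y) / ennreal (deriv r y)" for t
    using y by (cases "t \<in> {0<..<1}") (auto simp: marginal_density_def f_def null_density_def
       indicator_unit_square ennreal_mult'' ennreal_mult_divide_eq ennreal_zero_divide)
  moreover have "(\<lambda>t. f (t, y) / ennreal (deriv r y)) \<in> borel_measurable borel" by measurable
  ultimately show "marginal_density q \<in> borel_measurable borel" by presburger
  have "marginal_density r t = f (x, t) / ennreal (deriv q x)" for t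
    using x by (cases "t \<in> {0<..<1}") (auto simp: marginal_density_def f_def null_density_def
       indicator_unit_square ennreal_mult' ennreal_mult_divide_eq mult.commute[of "ennreal (deriv q x)"]
       ennreal_zero_divide)
  moreover have "(\<lambda>t. f (x, t) / ennreal (deriv q x)) \<in> borel_measurable borel" by measurable
  ultimately show "marginal_density r \<in> borel_measurable borel" by presburger
qed

lemma sets_null_law [simp]: "sets (null_law q r) = sets square_lborel"
  by (simp add: null_law_def square_law_def)

lemma space_null_law [simp]: "space (null_law q r) = unit_square"
  by (simp add: null_law_def square_law_def)

lemma measurable_square_lborel_borelI:
  assumes "f \<in> measurable borel N"
  shows "f \<in> measurable square_lborel N"
  unfolding square_lborel_def by (rule measurable_restrict_space1) (use assms in simp)

lemma nn_integral_null_law: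
  assumes margins: "q \<in> margin_transforms" "r \<in> margin_transforms"
    and meas: "(\<lambda>z. ennreal (null_density q r z)) \<in> borel_measurable square_lborel"
    and F: "F \<in> borel_measurable square_lborel"
  shows "(\<integral>\<^sup>+z. F z \<partial>null_law q r) =
    (\<integral>\<^sup>+x. (\<integral>\<^sup>+y. F (x, y) * marginal_density r y \<partial>lborel) * marginal_density q x \<partial>lborel)"
proof -
  define f where "f z = ennreal (null_density q r z) * F z * indicator unit_square z" for z
  have "f \<in> borel_measurable borel"
    using borel_measurable_times_ennreal[OF meas F]
    unfolding borel_measurable_square_lborel_iff by (simp add: f_def[abs_def])
  then have f[measurable]: "f \<in> borel_measurable (borel \<Otimes>\<^sub>M borel)"
    by (simp add: borel_prod)
  have "(\<integral>\<^sup>+z. F z \<partial>null_law q r) = (\<integral>\<^sup>+z. f z \<partial>lborel)"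
    unfolding null_law_def square_law_def using meas F
    by (simp add: nn_integral_density nn_integral_square_lborel f_def)
  also have "\<dots> = (\<integral>\<^sup>+x. (\<integral>\<^sup>+y. f (x, y) \<partial>lborel) \<partial>lborel)"
    unfolding lborel_prod[symmetric] by (subst lborel.nn_integral_fst[symmetric]) auto
  also have "\<dots> = (\<integral>\<^sup>+x. (\<integral>\<^sup>+y. F (x, y) * marginal_density r y \<partial>lborel) * marginal_density q x \<partial>lborel)"
  proof (rule nn_integral_cong_AE)
    note md[measurable] = marginal_density_measurable[OF margins meas]
    define F' where "F' z = F z * indicator unit_square z" for z
    have "F' \<in> borel_measurable borel"
      using F unfolding borel_measurable_square_lborel_iff by (simp add: F'_def[abs_def])
    then have [measurable]: "F' \<in> borel_measurable (borel \<Otimes>\<^sub>M borel)"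
      by (simp add: borel_prod)
    \<comment> \<open>Splitting \<open>ennreal (deriv q x * deriv r y)\<close> into a product needs
      a nonnegative factor; \<open>deriv q x\<close> is one only almost everywhere.\<close>
    show "AE x in lborel. (\<integral>\<^sup>+y. f (x, y) \<partial>lborel) =
        (\<integral>\<^sup>+y. F (x, y) * marginal_density r y \<partial>lborel) * marginal_density q x"
      using margin_transform_deriv_pos[OF margins(1)]
    proof eventually_elim
      case (elim x)
      show ?case
      proof (cases "x \<in> {0<..<1}")
        case True
        have "(\<integral>\<^sup>+y. F (x, y) * marginal_density r y \<partial>lborel) =
            (\<integral>\<^sup>+y. F' (x, y) * marginal_density r y \<partial>lborel)"
          using True by (intro nn_integral_cong)
            (auto simp: F'_def marginal_density_def indicator_unit_square split: split_indicator)
        also have "\<dots> * marginal_density q x = (\<integral>\<^sup>+y. F' (x, y) * marginal_density r y * marginal_density q x \<partial>lborel)"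
          by (subst nn_integral_multc) auto
        also have "\<dots> = (\<integral>\<^sup>+y. f (x, y) \<partial>lborel)"
          using True elim by (intro nn_integral_cong)
            (auto simp: F'_def f_def marginal_density_def indicator_unit_square null_density_def
               ennreal_mult' mult_ac split: split_indicator)
        finally show ?thesis by simp
      qed (auto simp: f_def marginal_density_def indicator_unit_square)
    qed
  qed
  finally show ?thesis .
qed

text \<open>The masses \<open>c\<close> and \<open>d\<close> of the marginal densities are not known
  to be 1 each, which would require equality in the change of variables. But total mass 1 gives
  \<open>c * d = 1\<close>, and this is enough: the projections give \<open>A\<close> and
  \<open>B\<close> the masses \<open>cA * d\<close> and \<open>c * dB\<close>, whose product is the
  mass \<open>cA * dB\<close> of the rectangle.\<close>

lemma null_law_eq_pair_measure:
  assumes margins: "q \<in> margin_transforms" "r \<in> margin_transforms"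
    and meas: "(\<lambda>z. ennreal (null_density q r z)) \<in> borel_measurable square_lborel"
    and prob: "prob_space (null_law q r)"
  shows "distr (null_law q r) borel fst \<Otimes>\<^sub>M distr (null_law q r) borel snd =
    distr (null_law q r) borel (\<lambda>z. z)"
proof (rule pair_measure_eqI)
  interpret prob_space "null_law q r" by fact
  have [measurable]: "fst \<in> borel_measurable (null_law q r)" "snd \<in> borel_measurable (null_law q r)"
    "(\<lambda>z. z) \<in> borel_measurable (null_law q r)"
    unfolding measurable_cong_sets[OF sets_null_law refl]
    by (intro measurable_square_lborel_borelI; simp add: borel_prod[symmetric])+
  interpret X: prob_space "distr (null_law q r) borel fst" by (rule prob_space_distr) simp
  interpret Y: prob_space "distr (null_law q r) borel snd" by (rule prob_space_distr) simp
  show "sigma_finite_measure (distr (null_law q r) borel fst)"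
    "sigma_finite_measure (distr (null_law q r) borel snd)"
    by unfold_locales
  show "sets (distr (null_law q r) borel fst \<Otimes>\<^sub>M distr (null_law q r) borel snd) =
    sets (distr (null_law q r) borel (\<lambda>z. z))"
    by (simp add: borel_prod[symmetric] cong: sets_pair_measure_cong)
  note md[measurable] = marginal_density_measurable[OF margins meas]
  have rectI: "A \<times> B \<in> sets (borel :: (real \<times> real) measure)"
    if "A \<in> sets borel" "B \<in> sets borel" for A B
    using that by (simp add: borel_prod[symmetric])
  have rect: "emeasure (distr (null_law q r) borel (\<lambda>z. z)) (A \<times> B) =
      (\<integral>\<^sup>+x. indicator A x * marginal_density q x \<partial>lborel) *
      (\<integral>\<^sup>+y. indicator B y * marginal_density r y \<partial>lborel)"
    if [measurable]: "A \<in> sets borel" "B \<in> sets borel" for A B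
  proof -
    note AB = rectI[OF that]
    have "emeasure (distr (null_law q r) borel (\<lambda>z. z)) (A \<times> B) =
        (\<integral>\<^sup>+z. indicator (A \<times> B) z \<partial>null_law q r)"
      using AB by (subst nn_integral_indicator[symmetric]) (simp_all add: nn_integral_distr del: nn_integral_indicator)
    also have "\<dots> = (\<integral>\<^sup>+x. (\<integral>\<^sup>+y. indicator (A \<times> B) (x, y) * marginal_density r y \<partial>lborel) * marginal_density q x \<partial>lborel)"
      using AB by (intro nn_integral_null_law margins meas measurable_square_lborel_borelI) auto
    also have "\<dots> = (\<integral>\<^sup>+x. (\<integral>\<^sup>+y. indicator B y * marginal_density r y \<partial>lborel) * (indicator A x * marginal_density q x) \<partial>lborel)"
      by (intro nn_integral_cong) (auto simp: indicator_times split: split_indicator)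
    also have "\<dots> = (\<integral>\<^sup>+x. indicator A x * marginal_density q x \<partial>lborel) *
      (\<integral>\<^sup>+y. indicator B y * marginal_density r y \<partial>lborel)"
      by (subst nn_integral_cmult) (auto simp: mult.commute)
    finally show ?thesis .
  qed
  fix A B assume "A \<in> sets (distr (null_law q r) borel fst)" "B \<in> sets (distr (null_law q r) borel snd)"
  then have AB[measurable]: "A \<in> sets borel" "B \<in> sets borel" by auto
  define c d cA dB where "c = (\<integral>\<^sup>+x. marginal_density q x \<partial>lborel)"
    and "d = (\<integral>\<^sup>+x. marginal_density r x \<partial>lborel)"
    and "cA = (\<integral>\<^sup>+x. indicator A x * marginal_density q x \<partial>lborel)"
    and "dB = (\<integral>\<^sup>+x. indicator B x * marginal_density r x \<partial>lborel)"
  have "emeasure (distr (null_law q r) borel fst) A = emeasure (distr (null_law q r) borel (\<lambda>z. z)) (A \<times> UNIV)"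
    using rectI[of A UNIV] by (simp add: emeasure_distr vimage_fst)
  then have 1: "emeasure (distr (null_law q r) borel fst) A = cA * d"
    by (simp add: rect cA_def d_def)
  have "emeasure (distr (null_law q r) borel snd) B = emeasure (distr (null_law q r) borel (\<lambda>z. z)) (UNIV \<times> B)"
    using rectI[of UNIV B] by (simp add: emeasure_distr vimage_snd)
  then have 2: "emeasure (distr (null_law q r) borel snd) B = c * dB"
    by (simp add: rect c_def dB_def)
  have "emeasure (distr (null_law q r) borel (\<lambda>z. z)) (UNIV \<times> UNIV) = 1"
    using emeasure_space_1 by (simp add: emeasure_distr)
  then have "c * d = 1" by (subst (asm) rect) (auto simp: c_def d_def)
  then show "emeasure (distr (null_law q r) borel fst) A * emeasure (distr (null_law q r) borel snd) B =
      emeasure (distr (null_law q r) borel (\<lambda>z. z)) (A \<times> B)"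
    unfolding 1 2 rect[OF AB] cA_def[symmetric] dB_def[symmetric]
    by (metis (no_types, lifting) mult.assoc mult.commute mult.right_neutral)
qed

text \<open>The one-dimensional substitution is applied in each coordinate in turn. It needs
  functions on the whole line, hence the extension \<open>f'\<close> by zero; since the margins map
  almost every point into the open interval, \<open>f\<close> and \<open>f'\<close> agree where it
  matters.\<close>

lemma nn_integral_margin_transform_le:
  assumes margins: "q \<in> margin_transforms" "r \<in> margin_transforms"
    and meas: "(\<lambda>z. ennreal (null_density q r z)) \<in> borel_measurable square_lborel"
    and f: "f \<in> borel_measurable square_lborel"
    and g: "(\<lambda>(x, y). f (q x, r y)) \<in> borel_measurable square_lborel"
  shows "(\<integral>\<^sup>+(x, y). f (q x, r y) \<partial>null_law q r) \<le> (\<integral>\<^sup>+z. f z \<partial>square_lborel)"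
proof -
  note md[measurable] = marginal_density_measurable[OF margins meas]
  define f' where "f' z = f z * indicator unit_square z" for z
  have "f' \<in> borel_measurable borel"
    using f unfolding borel_measurable_square_lborel_iff by (simp add: f'_def[abs_def])
  then have f'[measurable]: "f' \<in> borel_measurable (borel \<Otimes>\<^sub>M borel)"
    by (simp add: borel_prod)
  have md_eq: "x \<in> {0<..<1} \<Longrightarrow> marginal_density a x = ennreal (deriv a x)"
    and md_0: "x \<notin> {0<..<1} \<Longrightarrow> marginal_density a x = 0" for a x
    by (auto simp: marginal_density_def)
  have "(\<integral>\<^sup>+(x, y). f (q x, r y) \<partial>null_law q r) =
      (\<integral>\<^sup>+x. (\<integral>\<^sup>+y. f (q x, r y) * marginal_density r y \<partial>lborel) * marginal_density q x \<partial>lborel)"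
    using nn_integral_null_law[OF margins meas g] by simp
  also have "\<dots> \<le> (\<integral>\<^sup>+x. (\<integral>\<^sup>+v. f' (q x, v) \<partial>lborel) * marginal_density q x \<partial>lborel)"
  proof (rule nn_integral_mono_AE)
    show "AE x in lborel. (\<integral>\<^sup>+y. f (q x, r y) * marginal_density r y \<partial>lborel) * marginal_density q x
        \<le> (\<integral>\<^sup>+v. f' (q x, v) \<partial>lborel) * marginal_density q x"
      using margin_transform_interior[OF margins(1)]
    proof eventually_elim
      case (elim x)
      show ?case
      proof (cases "x \<in> {0<..<1}")
        case True
        have "(\<integral>\<^sup>+y. f (q x, r y) * marginal_density r y \<partial>lborel) =
            (\<integral>\<^sup>+y. f' (q x, r y) * marginal_density r y \<partial>lborel)"
        proof (rule nn_integral_cong_AE)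
          show "AE y in lborel. f (q x, r y) * marginal_density r y = f' (q x, r y) * marginal_density r y"
            using margin_transform_interior[OF margins(2)]
            by eventually_elim
              (use True elim in \<open>auto simp: f'_def marginal_density_def indicator_unit_square split: split_indicator\<close>)
        qed
        also have "\<dots> \<le> (\<integral>\<^sup>+v. f' (q x, v) \<partial>lborel)"
          by (rule margin_transform_substitution_le[OF margins(2)]) (auto simp: md_eq md_0)
        finally show ?thesis by (rule mult_right_mono) simp
      qed (simp add: md_0)
    qed
  qed
  also have "\<dots> \<le> (\<integral>\<^sup>+u. (\<integral>\<^sup>+v. f' (u, v) \<partial>lborel) \<partial>lborel)"
    by (rule margin_transform_substitution_le[OF margins(1)]) (auto simp: md_eq md_0)
  also have "\<dots> = (\<integral>\<^sup>+z. f' z \<partial>lborel)"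
    unfolding lborel_prod[symmetric] by (subst lborel.nn_integral_fst[symmetric]) auto
  also have "\<dots> = (\<integral>\<^sup>+z. f z \<partial>square_lborel)"
    by (simp add: nn_integral_square_lborel f'_def)
  finally show ?thesis .
qed

section \<open>Conditional expectations and independence of coordinate vectors\<close>

lemma (in prob_space) real_cond_exp_vimage_algebra_eq:
  fixes \<pi> k g :: "_ \<Rightarrow> real"
  assumes \<pi>[measurable]: "\<pi> \<in> borel_measurable M" and g: "integrable M g"
    and k[measurable]: "k \<in> borel_measurable borel" and k\<pi>: "integrable M (\<lambda>\<omega>. k (\<pi> \<omega>))"
    and eq: "\<And>B. B \<in> sets borel \<Longrightarrow>
      expectation (\<lambda>\<omega>. indicator B (\<pi> \<omega>) * g \<omega>) = expectation (\<lambda>\<omega>. indicator B (\<pi> \<omega>) * k (\<pi> \<omega>))"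
  shows "AE \<omega> in M. real_cond_exp M (vimage_algebra (space M) \<pi> borel) g \<omega> = k (\<pi> \<omega>)"
proof -
  define F where "F = vimage_algebra (space M) \<pi> borel"
  have "subalgebra M F"
    unfolding subalgebra_def F_def by (auto simp: sets_vimage_algebra2)
  then interpret finite_measure_subalgebra M F by unfold_locales
  have "AE \<omega> in M. real_cond_exp M F g \<omega> = k (\<pi> \<omega>)"
  proof (rule real_cond_exp_charact[OF _ g k\<pi>])
    have "\<pi> \<in> borel_measurable F"
      unfolding F_def by (rule measurable_vimage_algebra1) simp
    then show "(\<lambda>\<omega>. k (\<pi> \<omega>)) \<in> borel_measurable F" by measurable
    fix A assume "A \<in> sets F"
    then obtain B where B: "B \<in> sets borel" "A = \<pi> -` B \<inter> space M"
      by (auto simp: F_def sets_vimage_algebra2)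
    have *: "(\<integral>\<omega>\<in>A. f \<omega> \<partial>M) = expectation (\<lambda>\<omega>. indicator B (\<pi> \<omega>) * f \<omega>)" for f :: "_ \<Rightarrow> real"
      unfolding set_lebesgue_integral_def B(2)
      by (rule Bochner_Integration.integral_cong) (auto split: split_indicator)
    show "(\<integral>\<omega>\<in>A. g \<omega> \<partial>M) = (\<integral>\<omega>\<in>A. k (\<pi> \<omega>) \<partial>M)"
      unfolding * by (rule eq[OF B(1)])
  qed
  then show ?thesis by (simp add: F_def)
qed

text \<open>The probability of a product event factors first over the pairs and then inside each
  pair. The Boolean index marks the coordinate, so that later all the \<open>X i\<close> and all the
  \<open>Y i\<close> can be separated as two blocks of one independent family.\<close>

lemma (in prob_space) indep_vars_pair_components:
  fixes X Y :: "'i \<Rightarrow> 'a \<Rightarrow> real"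
  assumes fin: "finite I" "I \<noteq> {}"
    and ind: "indep_vars (\<lambda>_. borel \<Otimes>\<^sub>M borel) (\<lambda>i \<omega>. (X i \<omega>, Y i \<omega>)) I"
    and comp: "\<And>i. i \<in> I \<Longrightarrow> indep_var borel (X i) borel (Y i)"
  shows "indep_vars (\<lambda>_. borel) (\<lambda>(i, b). if b then X i else Y i) (I \<times> UNIV)"
proof -
  define W where "W = (\<lambda>(i, b). if b then X i else Y i)"
  have XY: "X i \<in> borel_measurable M" "Y i \<in> borel_measurable M" if "i \<in> I" for i
    using indep_var_rv1[OF comp[OF that]] indep_var_rv2[OF comp[OF that]] by auto
  have W: "W z \<in> borel_measurable M" if "z \<in> I \<times> UNIV" for z
    using that XY by (auto simp: W_def)
  have "indep_sets (\<lambda>z. {W z -` A \<inter> space M | A. A \<in> sets borel}) (I \<times> UNIV)"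
  proof (subst indep_sets_finite)
    show "I \<times> UNIV \<noteq> {}" "finite (I \<times> (UNIV :: bool set))" using fin by auto
    show "{W z -` A \<inter> space M | A. A \<in> sets borel} \<subseteq> events" if "z \<in> I \<times> UNIV" for z
      using W[OF that] by (auto intro: measurable_sets)
    \<comment> \<open>Each of the families contains the whole space, so the product formula need
      only be checked over the full index set and not over its subsets.\<close>
    show "space M \<in> {W z -` A \<inter> space M | A. A \<in> sets borel}" if "z \<in> I \<times> UNIV" for z
      by (intro CollectI exI[of _ UNIV]) auto
    show "\<forall>A\<in>Pi (I \<times> UNIV) (\<lambda>z. {W z -` A \<inter> space M | A. A \<in> sets borel}).
        prob (\<Inter>z\<in>I \<times> UNIV. A z) = (\<Prod>z\<in>I \<times> UNIV. prob (A z))"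
    proof
      fix A assume A: "A \<in> Pi (I \<times> UNIV) (\<lambda>z. {W z -` A \<inter> space M | A. A \<in> sets borel})"
      have "\<forall>z\<in>I \<times> UNIV. \<exists>B. B \<in> sets borel \<and> A z = W z -` B \<inter> space M"
      proof
        fix z :: "'i \<times> bool" assume "z \<in> I \<times> UNIV"
        from Pi_mem[OF A this] show "\<exists>B. B \<in> sets borel \<and> A z = W z -` B \<inter> space M" by blast
      qed
      then obtain B where B: "\<And>z. z \<in> I \<times> UNIV \<Longrightarrow> B z \<in> sets borel"
          "\<And>z. z \<in> I \<times> UNIV \<Longrightarrow> A z = W z -` B z \<inter> space M"
        by metis
      define C where "C i = B (i, True) \<times> B (i, False)" for i
      have C: "C i \<in> sets (borel \<Otimes>\<^sub>M borel)" if "i \<in> I" for i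
        using B(1) that by (auto simp: C_def)
      have A_eq: "A (i, True) \<inter> A (i, False) = (\<lambda>\<omega>. (X i \<omega>, Y i \<omega>)) -` C i \<inter> space M" if "i \<in> I" for i
        using B(2) that by (auto simp: C_def W_def)
      have "(\<Inter>z\<in>I \<times> UNIV. A z) = (\<Inter>i\<in>I. A (i, True) \<inter> A (i, False))"
        by (auto simp: UNIV_bool)
      also have "\<dots> = (\<Inter>i\<in>I. (\<lambda>\<omega>. (X i \<omega>, Y i \<omega>)) -` C i \<inter> space M)"
        using A_eq by simp
      also have "prob \<dots> = (\<Prod>i\<in>I. prob ((\<lambda>\<omega>. (X i \<omega>, Y i \<omega>)) -` C i \<inter> space M))"
        by (rule indep_varsD[OF ind]) (use fin C in auto)
      also have "\<dots> = (\<Prod>i\<in>I. prob (A (i, True)) * prob (A (i, False)))"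
      proof (rule prod.cong)
        fix i assume i: "i \<in> I"
        show "prob ((\<lambda>\<omega>. (X i \<omega>, Y i \<omega>)) -` C i \<inter> space M) = prob (A (i, True)) * prob (A (i, False))"
          using indep_varD[OF comp[OF i], of "B (i, True)" "B (i, False)"] B i
          by (simp add: C_def W_def)
      qed simp
      also have "\<dots> = (\<Prod>i\<in>I. \<Prod>b\<in>UNIV. prob (A (i, b)))"
        by (simp add: UNIV_bool mult.commute)
      also have "\<dots> = (\<Prod>z\<in>I \<times> UNIV. prob (A z))"
        by (simp add: prod.cartesian_product case_prod_unfold)
      finally show "prob (\<Inter>z\<in>I \<times> UNIV. A z) = (\<Prod>z\<in>I \<times> UNIV. prob (A z))" .
    qed
  qed
  then show ?thesis
    unfolding W_def[symmetric] indep_vars_def2 using W by simp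
qed

text \<open>Disjoint blocks of an independent family form independent vectors; what remains is
  reindexing from \<open>I \<times> {b}\<close> to \<open>I\<close>.\<close>

lemma (in prob_space) indep_vars_pair_vectors:
  fixes X Y :: "'i \<Rightarrow> 'a \<Rightarrow> real"
  assumes fin: "finite I" "I \<noteq> {}"
    and ind: "indep_vars (\<lambda>_. borel \<Otimes>\<^sub>M borel) (\<lambda>i \<omega>. (X i \<omega>, Y i \<omega>)) I"
    and comp: "\<And>i. i \<in> I \<Longrightarrow> indep_var borel (X i) borel (Y i)"
  shows "indep_var (Pi\<^sub>M I (\<lambda>_. borel)) (\<lambda>\<omega>. \<lambda>i\<in>I. X i \<omega>) (Pi\<^sub>M I (\<lambda>_. borel)) (\<lambda>\<omega>. \<lambda>i\<in>I. Y i \<omega>)"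
proof -
  define W where "W = (\<lambda>(i, b). if b then X i else Y i)"
  have "indep_vars (\<lambda>_. borel) W (I \<times> UNIV)"
    unfolding W_def by (rule indep_vars_pair_components[OF assms])
  then have *: "indep_var (Pi\<^sub>M (I \<times> {True}) (\<lambda>_. borel)) (\<lambda>\<omega>. \<lambda>z\<in>I \<times> {True}. W z \<omega>)
      (Pi\<^sub>M (I \<times> {False}) (\<lambda>_. borel)) (\<lambda>\<omega>. \<lambda>z\<in>I \<times> {False}. W z \<omega>)"
    by (rule indep_var_restrict) auto
  have "(\<lambda>f. \<lambda>i\<in>I. f (i, b)) \<in> measurable (Pi\<^sub>M (I \<times> {b}) (\<lambda>_. borel :: real measure)) (Pi\<^sub>M I (\<lambda>_. borel))" for b :: bool
    by (intro measurable_restrict measurable_component_singleton) auto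
  from indep_var_compose[OF * this this]
  have "indep_var (Pi\<^sub>M I (\<lambda>_. borel)) ((\<lambda>f. \<lambda>i\<in>I. f (i, True)) \<circ> (\<lambda>\<omega>. \<lambda>z\<in>I \<times> {True}. W z \<omega>))
      (Pi\<^sub>M I (\<lambda>_. borel)) ((\<lambda>f. \<lambda>i\<in>I. f (i, False)) \<circ> (\<lambda>\<omega>. \<lambda>z\<in>I \<times> {False}. W z \<omega>))" .
  also have "((\<lambda>f. \<lambda>i\<in>I. f (i, True)) \<circ> (\<lambda>\<omega>. \<lambda>z\<in>I \<times> {True}. W z \<omega>)) = (\<lambda>\<omega>. \<lambda>i\<in>I. X i \<omega>)"
    by (auto simp: W_def fun_eq_iff)
  also have "((\<lambda>f. \<lambda>i\<in>I. f (i, False)) \<circ> (\<lambda>\<omega>. \<lambda>z\<in>I \<times> {False}. W z \<omega>)) = (\<lambda>\<omega>. \<lambda>i\<in>I. Y i \<omega>)"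
    by (auto simp: W_def fun_eq_iff)
  finally show ?thesis .
qed

section \<open>Degenerate kernels\<close>

lemma (in prob_space) expectation_mult_bounded_square_le:
  fixes f a :: "'a \<Rightarrow> real"
  assumes [measurable]: "f \<in> borel_measurable M" "a \<in> borel_measurable M"
    and a: "\<And>\<omega>. \<bar>a \<omega>\<bar> \<le> 1" and f: "integrable M (\<lambda>\<omega>. (f \<omega>)\<^sup>2)"
  shows "(expectation (\<lambda>\<omega>. a \<omega> * f \<omega>))\<^sup>2 \<le> expectation (\<lambda>\<omega>. (f \<omega>)\<^sup>2)"
proof -
  have le: "(a \<omega> * f \<omega>)\<^sup>2 \<le> (f \<omega>)\<^sup>2" for \<omega>
    unfolding power_mult_distrib
    by (rule mult_left_le_one_le) (use a[of \<omega>] in \<open>simp_all add: abs_square_le_1\<close>)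
  have int: "integrable M (\<lambda>\<omega>. (a \<omega> * f \<omega>)\<^sup>2)"
    by (rule Bochner_Integration.integrable_bound[OF f]) (use le in \<open>simp_all add: AE_I2\<close>)
  have "0 \<le> variance (\<lambda>\<omega>. a \<omega> * f \<omega>)" by simp
  also have "\<dots> = expectation (\<lambda>\<omega>. (a \<omega> * f \<omega>)\<^sup>2) - (expectation (\<lambda>\<omega>. a \<omega> * f \<omega>))\<^sup>2"
    by (rule variance_eq[OF square_integrable_imp_integrable[OF _ int] int]) measurable
  finally have "(expectation (\<lambda>\<omega>. a \<omega> * f \<omega>))\<^sup>2 \<le> expectation (\<lambda>\<omega>. (a \<omega> * f \<omega>)\<^sup>2)" by simp
  also have "\<dots> \<le> expectation (\<lambda>\<omega>. (f \<omega>)\<^sup>2)"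
    using int f le by (rule integral_mono)
  finally show ?thesis .
qed

lemma integrable_mult_square_integrable:
  fixes f g :: "'a \<Rightarrow> real"
  assumes [measurable]: "f \<in> borel_measurable M" "g \<in> borel_measurable M"
    and "integrable M (\<lambda>\<omega>. (f \<omega>)\<^sup>2)" "integrable M (\<lambda>\<omega>. (g \<omega>)\<^sup>2)"
  shows "integrable M (\<lambda>\<omega>. f \<omega> * g \<omega>)"
proof (rule Bochner_Integration.integrable_bound)
  show "integrable M (\<lambda>\<omega>. (f \<omega>)\<^sup>2 + (g \<omega>)\<^sup>2)" using assms by simp
  have "\<bar>x * y\<bar> \<le> \<bar>x\<^sup>2 + y\<^sup>2\<bar>" for x y :: real
  proof -
    have "2 * (\<bar>x\<bar> * \<bar>y\<bar>) \<le> x\<^sup>2 + y\<^sup>2"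
      using zero_le_power2[of "\<bar>x\<bar> - \<bar>y\<bar>"] by (simp add: power2_diff)
    moreover have "0 \<le> \<bar>x\<bar> * \<bar>y\<bar>" by simp
    ultimately show ?thesis unfolding abs_mult by linarith
  qed
  then show "AE \<omega> in M. norm (f \<omega> * g \<omega>) \<le> norm ((f \<omega>)\<^sup>2 + (g \<omega>)\<^sup>2)" by simp
qed measurable

lemma (in prob_space) indep_vars_sum_square:
  fixes W :: "'i \<Rightarrow> 'a \<Rightarrow> real"
  assumes fin: "finite I" and ind: "indep_vars (\<lambda>_. borel) W I"
    and sq: "\<And>i. i \<in> I \<Longrightarrow> integrable M (\<lambda>\<omega>. (W i \<omega>)\<^sup>2)"
    and mean: "\<And>i. i \<in> I \<Longrightarrow> expectation (W i) = 0"
  shows "integrable M (\<lambda>\<omega>. (\<Sum>i\<in>I. W i \<omega>)\<^sup>2)"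
    and "expectation (\<lambda>\<omega>. (\<Sum>i\<in>I. W i \<omega>)\<^sup>2) = (\<Sum>i\<in>I. expectation (\<lambda>\<omega>. (W i \<omega>)\<^sup>2))"
proof -
  have meas: "W i \<in> borel_measurable M" if "i \<in> I" for i
    using ind that by (simp add: indep_vars_def)
  have eq: "(\<Sum>i\<in>I. W i \<omega>)\<^sup>2 = (\<Sum>i\<in>I. \<Sum>j\<in>I. W i \<omega> * W j \<omega>)" for \<omega>
    by (simp add: power2_eq_square sum_product)
  have int: "integrable M (\<lambda>\<omega>. W i \<omega> * W j \<omega>)" if "i \<in> I" "j \<in> I" for i j
    using that by (intro integrable_mult_square_integrable meas sq)
  show "integrable M (\<lambda>\<omega>. (\<Sum>i\<in>I. W i \<omega>)\<^sup>2)"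
    unfolding eq by (intro Bochner_Integration.integrable_sum int)
  have cross: "expectation (\<lambda>\<omega>. W i \<omega> * W j \<omega>) = (if i = j then expectation (\<lambda>\<omega>. (W i \<omega>)\<^sup>2) else 0)"
    if ij: "i \<in> I" "j \<in> I" for i j
  proof (cases "i = j")
    case False
    have "indep_vars (\<lambda>_. borel) W {i, j}" by (rule indep_vars_subset[OF ind]) (use ij in auto)
    moreover have "integrable M (W k)" if "k \<in> {i, j}" for k
      using ij that by (auto intro: square_integrable_imp_integrable[OF meas sq])
    ultimately have "expectation (\<lambda>\<omega>. \<Prod>k\<in>{i, j}. W k \<omega>) = (\<Prod>k\<in>{i, j}. expectation (W k))"
      by (intro indep_vars_lebesgue_integral) simp_all
    then show ?thesis using False mean ij by simp
  qed (simp add: power2_eq_square)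
  have "expectation (\<lambda>\<omega>. (\<Sum>i\<in>I. W i \<omega>)\<^sup>2) = (\<Sum>i\<in>I. \<Sum>j\<in>I. expectation (\<lambda>\<omega>. W i \<omega> * W j \<omega>))"
    unfolding eq
    by (simp add: Bochner_Integration.integral_sum Bochner_Integration.integrable_sum int)
  also have "\<dots> = (\<Sum>i\<in>I. expectation (\<lambda>\<omega>. (W i \<omega>)\<^sup>2))"
    using fin by (intro sum.cong refl) (simp add: cross)
  finally show "expectation (\<lambda>\<omega>. (\<Sum>i\<in>I. W i \<omega>)\<^sup>2) = (\<Sum>i\<in>I. expectation (\<lambda>\<omega>. (W i \<omega>)\<^sup>2))" .
qed

text \<open>The \<open>W i\<close> are orthogonal with squared norms at most \<open>L\<close>, not
  normalised. Pairing \<open>b\<close> with the combination whose coefficients are its own inner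
  products \<open>\<beta> i\<close> turns the sum of squares \<open>q\<close> into an expectation.
  The bound on \<open>b\<close> then gives \<open>q\<^sup>2 \<le> q * L\<close>, and one factor
  \<open>q\<close> cancels.\<close>

lemma (in prob_space) indep_vars_Bessel:
  fixes W :: "'i \<Rightarrow> 'a \<Rightarrow> real"
  assumes fin: "finite I" and ind: "indep_vars (\<lambda>_. borel) W I"
    and sq: "\<And>i. i \<in> I \<Longrightarrow> integrable M (\<lambda>\<omega>. (W i \<omega>)\<^sup>2)"
    and mean: "\<And>i. i \<in> I \<Longrightarrow> expectation (W i) = 0"
    and L: "\<And>i. i \<in> I \<Longrightarrow> expectation (\<lambda>\<omega>. (W i \<omega>)\<^sup>2) \<le> L" "0 \<le> L"
    and b[measurable]: "b \<in> borel_measurable M" "\<And>\<omega>. \<bar>b \<omega>\<bar> \<le> 1"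
  shows "(\<Sum>i\<in>I. (expectation (\<lambda>\<omega>. b \<omega> * W i \<omega>))\<^sup>2) \<le> L"
proof -
  define \<beta> where "\<beta> i = expectation (\<lambda>\<omega>. b \<omega> * W i \<omega>)" for i
  define q where "q = (\<Sum>i\<in>I. (\<beta> i)\<^sup>2)"
  have meas: "W i \<in> borel_measurable M" if "i \<in> I" for i
    using ind that by (simp add: indep_vars_def)
  have int: "integrable M (\<lambda>\<omega>. b \<omega> * W i \<omega>)" if "i \<in> I" for i
    using that meas[OF that] square_integrable_imp_integrable[OF meas[OF that] sq[OF that]]
    by (intro Bochner_Integration.integrable_bound[of _ "W i" "\<lambda>\<omega>. b \<omega> * W i \<omega>"])
      (auto simp: abs_mult intro!: mult_left_le_one_le b)
  define W' where "W' i \<omega> = \<beta> i * W i \<omega>" for i \<omega>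
  have W'm: "(\<lambda>\<omega>. \<Sum>i\<in>I. W' i \<omega>) \<in> borel_measurable M"
    unfolding W'_def using meas by (intro borel_measurable_sum) auto
  have ind': "indep_vars (\<lambda>_. borel) W' I"
    unfolding W'_def by (rule indep_vars_compose2[OF ind]) auto
  have sq': "integrable M (\<lambda>\<omega>. (W' i \<omega>)\<^sup>2)" "expectation (W' i) = 0"
    "expectation (\<lambda>\<omega>. (W' i \<omega>)\<^sup>2) = (\<beta> i)\<^sup>2 * expectation (\<lambda>\<omega>. (W i \<omega>)\<^sup>2)" if "i \<in> I" for i
    using sq[OF that] mean[OF that] by (simp_all add: W'_def[abs_def] power_mult_distrib)
  note S = indep_vars_sum_square[OF fin ind' sq'(1,2)]
  have "q = expectation (\<lambda>\<omega>. \<Sum>i\<in>I. \<beta> i * (b \<omega> * W i \<omega>))"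
    unfolding q_def using int by (subst Bochner_Integration.integral_sum)
      (auto simp: \<beta>_def power2_eq_square)
  also have "\<dots> = expectation (\<lambda>\<omega>. b \<omega> * (\<Sum>i\<in>I. W' i \<omega>))"
    by (simp add: W'_def sum_distrib_left mult_ac)
  finally have "q\<^sup>2 \<le> expectation (\<lambda>\<omega>. (\<Sum>i\<in>I. W' i \<omega>)\<^sup>2)"
    using expectation_mult_bounded_square_le[OF W'm b S(1)] by simp
  also have "\<dots> = (\<Sum>i\<in>I. expectation (\<lambda>\<omega>. (W' i \<omega>)\<^sup>2))" by (rule S(2))
  also have "\<dots> = (\<Sum>i\<in>I. (\<beta> i)\<^sup>2 * expectation (\<lambda>\<omega>. (W i \<omega>)\<^sup>2))"
    by (rule sum.cong) (simp_all add: sq')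
  also have "\<dots> \<le> q * L"
    unfolding q_def sum_distrib_right by (intro sum_mono mult_left_mono L) auto
  finally have "q * q \<le> q * L" by (simp add: power2_eq_square)
  moreover have "0 \<le> q" by (simp add: q_def sum_nonneg)
  ultimately have "q \<le> L" using L(2) by (cases "q = 0") auto
  then show ?thesis by (simp add: q_def \<beta>_def)
qed

text \<open>
  For fixed \<open>t\<close>, the variables \<open>l (t, V i)\<close> are orthogonal, so Bessel's inequality bounds the sum
  of the squares of their inner products with \<open>b\<close>; these inner products are in turn centred at
  the independent points \<open>U i\<close>.
\<close>

lemma (in prob_space) degenerate_kernel_bound:
  fixes l :: "real \<times> real \<Rightarrow> real" and U V :: "'i \<Rightarrow> 'a \<Rightarrow> real"
  assumes fin: "finite I"
    and U: "indep_vars (\<lambda>_. borel) U I" "\<And>i. i \<in> I \<Longrightarrow> distr M borel (U i) = \<mu>"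
    and V: "indep_vars (\<lambda>_. borel) V I" "\<And>i. i \<in> I \<Longrightarrow> distr M borel (V i) = \<nu>"
    and prob: "prob_space \<mu>" "prob_space \<nu>" "sets \<mu> = sets borel" "sets \<nu> = sets borel"
    and l[measurable]: "l \<in> borel_measurable (borel \<Otimes>\<^sub>M borel)"
    and l2: "integrable (\<mu> \<Otimes>\<^sub>M \<nu>) (\<lambda>z. (l z)\<^sup>2)"
    and deg1: "AE x in \<mu>. (\<integral>y. l (x, y) \<partial>\<nu>) = 0"
    and deg2: "AE y in \<nu>. (\<integral>x. l (x, y) \<partial>\<mu>) = 0"
    and a[measurable]: "a \<in> borel_measurable M" "\<And>\<omega>. \<bar>a \<omega>\<bar> \<le> 1"
    and b[measurable]: "b \<in> borel_measurable M" "\<And>\<omega>. \<bar>b \<omega>\<bar> \<le> 1"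
  shows "(\<Sum>i\<in>I. \<integral>u. a u * (\<integral>v. b v * l (U i u, V i v) \<partial>M) \<partial>M)\<^sup>2 \<le> (\<integral>z. (l z)\<^sup>2 \<partial>(\<mu> \<Otimes>\<^sub>M \<nu>))"
proof -
  interpret X: prob_space \<mu> by fact
  interpret Y: prob_space \<nu> by fact
  interpret XY: pair_prob_space \<mu> \<nu> ..
  interpret XM: pair_prob_space \<mu> M ..
  have [measurable_cong]: "sets \<mu> = sets borel" "sets \<nu> = sets borel" by (fact prob)+
  have Um: "U i \<in> borel_measurable M" and Vm: "V i \<in> borel_measurable M" if "i \<in> I" for i
    using U(1) V(1) that by (simp_all add: indep_vars_def)
  define \<beta> where "\<beta> i t = (\<integral>v. b v * l (t, V i v) \<partial>M)" for i t
  define L where "L t = (\<integral>y. (l (t, y))\<^sup>2 \<partial>\<nu>)" for t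
  have L_int: "integrable \<mu> L" and L_eq: "(\<integral>t. L t \<partial>\<mu>) = (\<integral>z. (l z)\<^sup>2 \<partial>(\<mu> \<Otimes>\<^sub>M \<nu>))"
    using XY.integrable_fst'[OF l2] XY.integral_fst'[OF l2] by (simp_all add: L_def[abs_def])
  have \<beta>m: "\<beta> i \<in> borel_measurable borel" if "i \<in> I" for i
  proof -
    note Vm[OF that, measurable]
    show ?thesis unfolding \<beta>_def[abs_def] by measurable
  qed
  \<comment> \<open>The bound \<open>L t\<close> is that of a single variable: summing over
    \<open>i\<close> costs no factor \<open>card I\<close>. This is the gain over Cauchy-Schwarz
    that survives as \<open>1 / sqrt n\<close> in the cross terms.\<close>
  have Bessel: "AE t in \<mu>. (\<Sum>i\<in>I. (\<beta> i t)\<^sup>2) \<le> L t"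
    using XY.AE_integrable_fst'[OF l2] deg1
  proof eventually_elim
    case (elim t)
    have "expectation (\<lambda>v. f (V i v)) = (\<integral>y. f y \<partial>\<nu>)" if "i \<in> I" "f \<in> borel_measurable borel" for i and f :: "real \<Rightarrow> real"
      unfolding V(2)[OF that(1), symmetric] using that Vm by (subst integral_distr) auto
    note tr = this
    have lt[measurable]: "(\<lambda>y. l (t, y)) \<in> borel_measurable borel" by measurable
    show ?case unfolding \<beta>_def
    proof (rule indep_vars_Bessel[OF fin _ _ _ _ _ b])
      show "indep_vars (\<lambda>_. borel) (\<lambda>i v. l (t, V i v)) I"
        by (rule indep_vars_compose2[OF V(1)]) simp
      show "integrable M (\<lambda>v. (l (t, V i v))\<^sup>2)" if "i \<in> I" for i
      proof -
        have "integrable (distr M borel (V i)) (\<lambda>y. (l (t, y))\<^sup>2)" using elim(1) V(2)[OF that] by simp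
        then show ?thesis using Vm[OF that] by (subst (asm) integrable_distr_eq) auto
      qed
      show "expectation (\<lambda>v. l (t, V i v)) = 0" if "i \<in> I" for i
        using tr[OF that lt] elim(2) by simp
      show "expectation (\<lambda>v. (l (t, V i v))\<^sup>2) \<le> L t" if "i \<in> I" for i
        using tr[OF that, of "\<lambda>y. (l (t, y))\<^sup>2"] by (simp add: L_def)
      show "0 \<le> L t" by (simp add: L_def)
    qed
  qed
  have \<beta>2: "integrable \<mu> (\<lambda>t. (\<beta> i t)\<^sup>2)" if "i \<in> I" for i
  proof (rule Bochner_Integration.integrable_bound[OF L_int])
    show "AE t in \<mu>. norm ((\<beta> i t)\<^sup>2) \<le> norm (L t)"
      using Bessel
    proof eventually_elim
      case (elim t)
      have "(\<beta> i t)\<^sup>2 \<le> (\<Sum>i\<in>I. (\<beta> i t)\<^sup>2)"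
        using fin that by (intro member_le_sum) auto
      with elim show ?case by simp
    qed
    show "(\<lambda>t. (\<beta> i t)\<^sup>2) \<in> borel_measurable \<mu>" using \<beta>m[OF that] by measurable
  qed
  \<comment> \<open>The integral over \<open>t\<close> has to be taken inside the one over
    \<open>v\<close>, because \<open>b\<close> is an arbitrary function on \<open>M\<close> and does
    not factor through \<open>V i\<close>. The exchange takes place on the product of
    \<open>\<mu>\<close> with \<open>M\<close>; the inner integral then vanishes by the second
    degeneracy.\<close>
  have \<beta>0: "(\<integral>t. \<beta> i t \<partial>\<mu>) = 0" if i: "i \<in> I" for i
  proof -
    note Vm[OF i, measurable]
    have "distr \<mu> \<mu> (\<lambda>x. x) \<Otimes>\<^sub>M distr M borel (V i) =
        distr (\<mu> \<Otimes>\<^sub>M M) (\<mu> \<Otimes>\<^sub>M borel) (\<lambda>(x, y). (x, V i y))"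
      by (rule pair_measure_distr) (use V(2)[OF i] Y.sigma_finite_measure_axioms in auto)
    then have "\<mu> \<Otimes>\<^sub>M \<nu> = distr (\<mu> \<Otimes>\<^sub>M M) (\<mu> \<Otimes>\<^sub>M borel) (\<lambda>(x, y). (x, V i y))"
      unfolding V(2)[OF i] distr_id .
    moreover have "integrable (\<mu> \<Otimes>\<^sub>M \<nu>) l"
      by (rule XY.P.square_integrable_imp_integrable[OF _ l2]) measurable
    ultimately have "integrable (distr (\<mu> \<Otimes>\<^sub>M M) (\<mu> \<Otimes>\<^sub>M borel) (\<lambda>(x, y). (x, V i y))) l"
      by metis
    then have "integrable (\<mu> \<Otimes>\<^sub>M M) (\<lambda>(t, v). l (t, V i v))"
      by (subst (asm) integrable_distr_eq) (simp_all add: case_prod_unfold)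
    then have "integrable (\<mu> \<Otimes>\<^sub>M M) (\<lambda>(t, v). b v * l (t, V i v))"
    proof (rule Bochner_Integration.integrable_bound)
      have "\<bar>b v * l (t, V i v)\<bar> \<le> \<bar>l (t, V i v)\<bar>" for t v
        unfolding abs_mult by (intro mult_left_le_one_le b) auto
      then show "AE z in \<mu> \<Otimes>\<^sub>M M. norm (case z of (t, v) \<Rightarrow> b v * l (t, V i v)) \<le>
          norm (case z of (t, v) \<Rightarrow> l (t, V i v))"
        by (auto simp: case_prod_unfold)
    qed measurable
    from XM.Fubini_integral[OF this]
    have "(\<integral>t. \<beta> i t \<partial>\<mu>) = (\<integral>v. b v * (\<integral>t. l (t, V i v) \<partial>\<mu>) \<partial>M)"
      unfolding \<beta>_def by simp
    also have "\<dots> = (\<integral>v. 0 \<partial>M)"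
    proof (rule integral_cong_AE)
      have "AE y in distr M borel (V i). (\<integral>x. l (x, y) \<partial>\<mu>) = 0"
        unfolding V(2)[OF i] by (rule deg2)
      then have "AE v in M. (\<integral>x. l (x, V i v) \<partial>\<mu>) = 0" by (rule AE_distrD[rotated]) measurable
      then show "AE v in M. b v * (\<integral>t. l (t, V i v) \<partial>\<mu>) = 0" by eventually_elim simp
    qed measurable
    finally show ?thesis by simp
  qed
  have tr: "expectation (\<lambda>u. f (U i u)) = (\<integral>y. f y \<partial>\<mu>)" "integrable M (\<lambda>u. f (U i u)) \<longleftrightarrow> integrable \<mu> f"
    if "i \<in> I" "f \<in> borel_measurable borel" for i and f :: "real \<Rightarrow> real"
    unfolding U(2)[OF that(1), symmetric] using that Um by (simp_all add: integral_distr integrable_distr_eq)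
  have ind: "indep_vars (\<lambda>_. borel) (\<lambda>i u. \<beta> i (U i u)) I"
    by (rule indep_vars_compose2[OF U(1)]) (rule \<beta>m)
  have b2: "integrable M (\<lambda>u. (\<beta> i (U i u))\<^sup>2)" "expectation (\<lambda>u. \<beta> i (U i u)) = 0"
      "expectation (\<lambda>u. (\<beta> i (U i u))\<^sup>2) = (\<integral>t. (\<beta> i t)\<^sup>2 \<partial>\<mu>)" if "i \<in> I" for i
    using \<beta>m[OF that] \<beta>2[OF that] \<beta>0[OF that] tr[OF that] tr[OF that, of "\<lambda>t. (\<beta> i t)\<^sup>2"] by simp_all
  have bm: "(\<lambda>u. \<beta> i (U i u)) \<in> borel_measurable M" if "i \<in> I" for i
    using measurable_compose[OF Um[OF that] \<beta>m[OF that]] .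
  note S = indep_vars_sum_square[OF fin ind b2(1,2)]
  have "(\<Sum>i\<in>I. \<integral>u. a u * (\<integral>v. b v * l (U i u, V i v) \<partial>M) \<partial>M) = (\<Sum>i\<in>I. \<integral>u. a u * \<beta> i (U i u) \<partial>M)"
    by (simp add: \<beta>_def)
  also have "\<dots> = expectation (\<lambda>u. \<Sum>i\<in>I. a u * \<beta> i (U i u))"
  proof (rule Bochner_Integration.integral_sum[symmetric])
    fix i assume i: "i \<in> I"
    note bm[OF i, measurable]
    show "integrable M (\<lambda>u. a u * \<beta> i (U i u))"
      by (rule Bochner_Integration.integrable_bound[OF square_integrable_imp_integrable[OF bm[OF i] b2(1)[OF i]]])
        (auto simp: abs_mult intro!: mult_left_le_one_le a)
  qed
  also have "\<dots> = expectation (\<lambda>u. a u * (\<Sum>i\<in>I. \<beta> i (U i u)))"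
    by (simp add: sum_distrib_left)
  also have "\<dots>\<^sup>2 \<le> expectation (\<lambda>u. (\<Sum>i\<in>I. \<beta> i (U i u))\<^sup>2)"
    by (rule expectation_mult_bounded_square_le[OF borel_measurable_sum[OF bm] a S(1)])
  also have "\<dots> = (\<Sum>i\<in>I. expectation (\<lambda>u. (\<beta> i (U i u))\<^sup>2))" by (rule S(2))
  also have "\<dots> = (\<Sum>i\<in>I. \<integral>t. (\<beta> i t)\<^sup>2 \<partial>\<mu>)"
    by (rule sum.cong) (simp_all add: b2)
  also have "\<dots> = (\<integral>t. (\<Sum>i\<in>I. (\<beta> i t)\<^sup>2) \<partial>\<mu>)"
    using \<beta>2 by (subst Bochner_Integration.integral_sum) auto
  also have "\<dots> \<le> (\<integral>t. L t \<partial>\<mu>)"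
    using \<beta>2 L_int Bessel by (intro integral_mono_AE Bochner_Integration.integrable_sum) auto
  finally show ?thesis by (simp add: L_eq)
qed

section \<open>Asymptotic covariance and tightness\<close>

lemma cos_add_minus_first_order_le:
  fixes z w :: real
  shows "\<bar>cos (z + w) - cos z + w * sin z\<bar> \<le> w\<^sup>2 / 2"
proof -
  have "\<bar>cos (z + w) - cos z + w * sin z\<bar> = \<bar>Re (iexp z * (iexp w - (1 + \<i> * w)))\<bar>"
    by (simp add: cos_add algebra_simps flip: cis_conv_exp)
  also have "\<dots> \<le> cmod (iexp z * (iexp w - (1 + \<i> * w)))" by (rule abs_Re_le_cmod)
  also have "\<dots> = cmod (iexp w - (1 + \<i> * w))" by (simp add: norm_mult)
  also have "\<dots> \<le> w\<^sup>2 / 2" using iexp_approx1[of w 1] by (simp add: power2_eq_square numeral_2_eq_2)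
  finally show ?thesis .
qed

text \<open>The derivative at \<open>v = 0\<close> is \<open>- c * exp (- s / 2)\<close>, while a
  deviation of order \<open>v\<^sup>2\<close> forces it to be 0.\<close>

lemma exp_quadratic_flat_imp_zero:
  fixes s c J K :: real
  assumes "\<And>v. \<bar>exp (- (s + 2 * v * c + v\<^sup>2 * J) / 2) - exp (- s / 2)\<bar> \<le> K * v\<^sup>2"
  shows "c = 0"
proof -
  define \<phi> where "\<phi> v = exp (- (s + 2 * v * c + v\<^sup>2 * J) / 2)" for v
  have der: "(\<phi> has_real_derivative (- c * exp (- s / 2))) (at 0)"
    unfolding \<phi>_def by (auto intro!: derivative_eq_intros)
  have "(\<phi> has_real_derivative 0) (at 0)"
    unfolding has_field_derivative_iff
  proof (rule Lim_null_comparison)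
    have bound: "norm ((\<phi> v - \<phi> 0) / (v - 0)) \<le> \<bar>K\<bar> * \<bar>v\<bar>" if "v \<noteq> 0" for v
    proof -
      have "\<bar>\<phi> v - \<phi> 0\<bar> \<le> K * v\<^sup>2" using assms[of v] by (simp add: \<phi>_def)
      also have "\<dots> \<le> \<bar>K\<bar> * v\<^sup>2" by (intro mult_right_mono) auto
      finally show ?thesis using that by (simp add: field_simps power2_eq_square abs_mult)
    qed
    show "eventually (\<lambda>v. norm ((\<phi> v - \<phi> 0) / (v - 0)) \<le> \<bar>K\<bar> * \<bar>v\<bar>) (at 0)"
      using bound by (auto simp: eventually_at_filter)
    show "((\<lambda>v. \<bar>K\<bar> * \<bar>v\<bar>) \<longlongrightarrow> 0) (at 0)" by (auto intro!: tendsto_eq_intros)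
  qed
  from DERIV_unique[OF der this] show ?thesis by simp
qed

text \<open>\<open>Z\<close> has no moments to speak of, so the covariance is read off the limiting
  expectation of \<open>cos (Z + v * S)\<close> as its linear coefficient in \<open>v\<close>.
  Before the limit this coefficient is minus the expectation of \<open>sin Z * S\<close>, which the
  two cross terms control once \<open>Z\<close> is replaced by \<open>A + B\<close>. Bounded second
  moments of \<open>S\<close> make the quadratic error uniform in \<open>n\<close>.\<close>

lemma (in prob_space) asymptotically_uncorrelated:
  fixes Z S A B :: "nat \<Rightarrow> 'a \<Rightarrow> real"
  assumes meas[measurable]: "\<And>n. Z n \<in> borel_measurable M" "\<And>n. S n \<in> borel_measurable M"
      "\<And>n. A n \<in> borel_measurable M" "\<And>n. B n \<in> borel_measurable M"
    and R: "\<And>\<epsilon>. 0 < \<epsilon> \<Longrightarrow> (\<lambda>n. prob {\<omega> \<in> space M. \<bar>Z n \<omega> - (A n \<omega> + B n \<omega>)\<bar> > \<epsilon>}) \<longlonglongrightarrow> 0"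
    and S: "\<And>n. integrable M (\<lambda>\<omega>. (S n \<omega>)\<^sup>2)" "\<And>n. expectation (\<lambda>\<omega>. (S n \<omega>)\<^sup>2) \<le> K"
    and cross: "(\<lambda>n. expectation (\<lambda>\<omega>. sin (A n \<omega>) * cos (B n \<omega>) * S n \<omega>)) \<longlonglongrightarrow> 0"
      "(\<lambda>n. expectation (\<lambda>\<omega>. cos (A n \<omega>) * sin (B n \<omega>) * S n \<omega>)) \<longlonglongrightarrow> 0"
    and lim: "\<And>v. (\<lambda>n. expectation (\<lambda>\<omega>. cos (Z n \<omega> + v * S n \<omega>))) \<longlonglongrightarrow> exp (- (s + 2 * v * c + v\<^sup>2 * J) / 2)"
  shows "c = 0"
proof (rule exp_quadratic_flat_imp_zero)
  fix v
  define Z' where "Z' n \<omega> = A n \<omega> + B n \<omega>" for n \<omega>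
  have Z'[measurable]: "Z' n \<in> borel_measurable M" for n
    unfolding Z'_def[abs_def] by measurable
  have int_cos: "integrable M (\<lambda>\<omega>. cos (f \<omega>))" if [measurable]: "f \<in> borel_measurable M" for f :: "'a \<Rightarrow> real"
    by (rule integrable_const_bound[where B = 1]) auto
  have replace: "(\<lambda>n. expectation (\<lambda>\<omega>. cos (Z n \<omega> + w * S n \<omega>)) -
      expectation (\<lambda>\<omega>. cos (Z' n \<omega> + w * S n \<omega>))) \<longlonglongrightarrow> 0" for w
  proof (rule tendstoI)
    fix \<epsilon> :: real assume "\<epsilon> > 0"
    \<comment> \<open>Off \<open>D\<close> the Lipschitz property of the cosine gives
      \<open>\<epsilon> / 2\<close>, on \<open>D\<close> the difference is at most 2. Probability
      below \<open>\<epsilon> / 4\<close> therefore brings the total below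
      \<open>\<epsilon>\<close>.\<close>
    define D where "D n = {\<omega> \<in> space M. \<bar>Z n \<omega> - Z' n \<omega>\<bar> > \<epsilon> / 2}" for n
    have D[measurable]: "D n \<in> events" for n unfolding D_def by measurable
    have D_int: "integrable M (indicator (D n) :: 'a \<Rightarrow> real)" for n
      by (intro integrable_real_indicator D) (simp add: less_top[symmetric])
    have bound: "\<bar>expectation (\<lambda>\<omega>. cos (Z n \<omega> + w * S n \<omega>)) -
        expectation (\<lambda>\<omega>. cos (Z' n \<omega> + w * S n \<omega>))\<bar> \<le> \<epsilon> / 2 + 2 * prob (D n)" for n
    proof -
      have pt: "\<bar>cos (Z n \<omega> + w * S n \<omega>) - cos (Z' n \<omega> + w * S n \<omega>)\<bar> \<le> \<epsilon> / 2 + 2 * indicator (D n) \<omega>"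
        if "\<omega> \<in> space M" for \<omega>
      proof (cases "\<omega> \<in> D n")
        case True
        have "\<bar>cos (Z n \<omega> + w * S n \<omega>) - cos (Z' n \<omega> + w * S n \<omega>)\<bar> \<le> 1 + 1"
          by (intro order.trans[OF abs_triangle_ineq4] add_mono) auto
        with True \<open>\<epsilon> > 0\<close> show ?thesis by simp
      next
        case False
        have "\<bar>cos x - cos y\<bar> \<le> \<bar>x - y\<bar>" for x y :: real
          using abs_sin_x_le_abs_x[of "(y - x) / 2"] abs_sin_le_one[of "(x + y) / 2"]
            mult_mono[of "\<bar>sin ((x + y) / 2)\<bar>" 1 "\<bar>sin ((y - x) / 2)\<bar>" "\<bar>(y - x) / 2\<bar>"]
          by (simp add: cos_diff_cos abs_mult)
        from this[of "Z n \<omega> + w * S n \<omega>" "Z' n \<omega> + w * S n \<omega>"] False that show ?thesis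
          by (auto simp: D_def)
      qed
      have "\<bar>expectation (\<lambda>\<omega>. cos (Z n \<omega> + w * S n \<omega>)) - expectation (\<lambda>\<omega>. cos (Z' n \<omega> + w * S n \<omega>))\<bar>
          = \<bar>expectation (\<lambda>\<omega>. cos (Z n \<omega> + w * S n \<omega>) - cos (Z' n \<omega> + w * S n \<omega>))\<bar>"
        by (subst Bochner_Integration.integral_diff) (auto intro!: int_cos)
      also have "\<dots> \<le> expectation (\<lambda>\<omega>. \<bar>cos (Z n \<omega> + w * S n \<omega>) - cos (Z' n \<omega> + w * S n \<omega>)\<bar>)"
        by (rule integral_abs_bound)
      also have "\<dots> \<le> expectation (\<lambda>\<omega>. \<epsilon> / 2 + 2 * indicator (D n) \<omega>)"
        using pt D_int
        by (intro integral_mono integrable_abs Bochner_Integration.integrable_diff int_cos) auto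
      also have "\<dots> = \<epsilon> / 2 + 2 * prob (D n)"
        using D_int by (subst Bochner_Integration.integral_add) (auto simp: prob_space)
      finally show ?thesis .
    qed
    have "(\<lambda>n. prob (D n)) \<longlonglongrightarrow> 0"
      unfolding D_def Z'_def using R[of "\<epsilon> / 2"] \<open>\<epsilon> > 0\<close> by simp
    then have "eventually (\<lambda>n. prob (D n) < \<epsilon> / 4) sequentially"
      by (rule order_tendstoD) (use \<open>\<epsilon> > 0\<close> in simp)
    then show "eventually (\<lambda>n. dist (expectation (\<lambda>\<omega>. cos (Z n \<omega> + w * S n \<omega>)) -
        expectation (\<lambda>\<omega>. cos (Z' n \<omega> + w * S n \<omega>))) 0 < \<epsilon>) sequentially"
    proof eventually_elim
      case (elim n)
      then show ?case using bound[of n] by (simp add: dist_real_def)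
    qed
  qed
  have lim': "(\<lambda>n. expectation (\<lambda>\<omega>. cos (Z' n \<omega> + w * S n \<omega>))) \<longlonglongrightarrow>
      exp (- (s + 2 * w * c + w\<^sup>2 * J) / 2)" for w
    using tendsto_diff[OF lim[of w] replace[of w]] by simp
  have S1: "integrable M (S n)" for n
    using S(1) meas(2) by (rule square_integrable_imp_integrable[rotated])
  have int_mult: "integrable M (\<lambda>\<omega>. f \<omega> * S n \<omega>)" if [measurable]: "f \<in> borel_measurable M"
    and f: "\<And>\<omega>. \<bar>f \<omega>\<bar> \<le> 1" for f n
  proof (rule Bochner_Integration.integrable_bound[OF S1])
    show "AE \<omega> in M. norm (f \<omega> * S n \<omega>) \<le> norm (S n \<omega>)"
      unfolding real_norm_def abs_mult by (intro AE_I2 mult_left_le_one_le f) auto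
  qed measurable
  have abs_le: "\<bar>f x * g y\<bar> \<le> 1" if "\<bar>f x\<bar> \<le> 1" "\<bar>g y\<bar> \<le> 1" for f g :: "real \<Rightarrow> real" and x y
    using mult_mono[OF that] by (simp add: abs_mult)
  have sin_lim: "(\<lambda>n. expectation (\<lambda>\<omega>. sin (Z' n \<omega>) * S n \<omega>)) \<longlonglongrightarrow> 0"
  proof -
    have "expectation (\<lambda>\<omega>. sin (Z' n \<omega>) * S n \<omega>) =
        expectation (\<lambda>\<omega>. sin (A n \<omega>) * cos (B n \<omega>) * S n \<omega>) +
        expectation (\<lambda>\<omega>. cos (A n \<omega>) * sin (B n \<omega>) * S n \<omega>)" for n
      unfolding Z'_def sin_add distrib_right
      by (intro Bochner_Integration.integral_add int_mult abs_le) auto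
    then show ?thesis using tendsto_add[OF cross] by simp
  qed
  \<comment> \<open>Here \<open>v\<close> is fixed and \<open>n\<close> varies. The coefficient
    \<open>K / 2\<close> does not depend on \<open>n\<close>, so after the limit only the quadratic
    term is left, as the flatness criterion demands.\<close>
  have bound: "\<bar>expectation (\<lambda>\<omega>. cos (Z' n \<omega> + v * S n \<omega>)) - expectation (\<lambda>\<omega>. cos (Z' n \<omega> + 0 * S n \<omega>))\<bar>
      \<le> K / 2 * v\<^sup>2 + \<bar>v\<bar> * \<bar>expectation (\<lambda>\<omega>. sin (Z' n \<omega>) * S n \<omega>)\<bar>" for n
  proof -
    have ints: "integrable M (\<lambda>\<omega>. cos (Z' n \<omega> + v * S n \<omega>))" "integrable M (\<lambda>\<omega>. cos (Z' n \<omega>))"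
      "integrable M (\<lambda>\<omega>. v * (sin (Z' n \<omega>) * S n \<omega>))"
      by (auto intro!: int_cos int_mult)
    have "expectation (\<lambda>\<omega>. cos (Z' n \<omega> + v * S n \<omega>)) - expectation (\<lambda>\<omega>. cos (Z' n \<omega>)) +
        v * expectation (\<lambda>\<omega>. sin (Z' n \<omega>) * S n \<omega>) =
        expectation (\<lambda>\<omega>. cos (Z' n \<omega> + v * S n \<omega>) - cos (Z' n \<omega>) + v * (sin (Z' n \<omega>) * S n \<omega>))"
      using ints by simp
    also have "\<bar>\<dots>\<bar> \<le> expectation (\<lambda>\<omega>. \<bar>cos (Z' n \<omega> + v * S n \<omega>) - cos (Z' n \<omega>) + v * (sin (Z' n \<omega>) * S n \<omega>)\<bar>)"
      by (rule integral_abs_bound)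
    also have "\<dots> \<le> expectation (\<lambda>\<omega>. v\<^sup>2 / 2 * (S n \<omega>)\<^sup>2)"
    proof (rule integral_mono)
      show "integrable M (\<lambda>\<omega>. \<bar>cos (Z' n \<omega> + v * S n \<omega>) - cos (Z' n \<omega>) + v * (sin (Z' n \<omega>) * S n \<omega>)\<bar>)"
        by (intro integrable_abs Bochner_Integration.integrable_add Bochner_Integration.integrable_diff ints)
      show "integrable M (\<lambda>\<omega>. v\<^sup>2 / 2 * (S n \<omega>)\<^sup>2)" using S(1) by simp
      show "\<bar>cos (Z' n \<omega> + v * S n \<omega>) - cos (Z' n \<omega>) + v * (sin (Z' n \<omega>) * S n \<omega>)\<bar> \<le> v\<^sup>2 / 2 * (S n \<omega>)\<^sup>2" for \<omega>
        using cos_add_minus_first_order_le[of "Z' n \<omega>" "v * S n \<omega>"] by (simp add: power_mult_distrib mult_ac)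
    qed
    also have "\<dots> \<le> v\<^sup>2 / 2 * K" using S(2)[of n] by (simp add: mult_left_mono)
    also have "v\<^sup>2 / 2 * K = K / 2 * v\<^sup>2" by simp
    finally show ?thesis
      unfolding abs_mult[symmetric] mult_zero_left add_0_right by linarith
  qed
  have "(\<lambda>n. \<bar>expectation (\<lambda>\<omega>. cos (Z' n \<omega> + v * S n \<omega>)) - expectation (\<lambda>\<omega>. cos (Z' n \<omega> + 0 * S n \<omega>))\<bar>)
      \<longlonglongrightarrow> \<bar>exp (- (s + 2 * v * c + v\<^sup>2 * J) / 2) - exp (- (s + 2 * 0 * c + 0\<^sup>2 * J) / 2)\<bar>"
    by (intro tendsto_intros lim')
  moreover have "(\<lambda>n. K / 2 * v\<^sup>2 + \<bar>v\<bar> * \<bar>expectation (\<lambda>\<omega>. sin (Z' n \<omega>) * S n \<omega>)\<bar>) \<longlonglongrightarrow>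
      K / 2 * v\<^sup>2 + \<bar>v\<bar> * \<bar>0\<bar>"
    by (intro tendsto_intros sin_lim)
  ultimately have "\<bar>exp (- (s + 2 * v * c + v\<^sup>2 * J) / 2) - exp (- (s + 2 * 0 * c + 0\<^sup>2 * J) / 2)\<bar>
      \<le> K / 2 * v\<^sup>2 + \<bar>v\<bar> * \<bar>0\<bar>"
    by (rule LIMSEQ_le) (use bound in blast)
  then show "\<bar>exp (- (s + 2 * v * c + v\<^sup>2 * J) / 2) - exp (- s / 2)\<bar> \<le> K / 2 * v\<^sup>2" by simp
qed

text \<open>
  If the mean were nonzero, the normalised sums would escape to infinity; Peetre's inequality
  \<open>1 + (x - y)\<^sup>2 \<le> 2 (1 + x\<^sup>2) (1 + y\<^sup>2)\<close> turns this into a bound for the expectations.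
\<close>

lemma (in prob_space) tight_normalised_sums_imp_mean_zero:
  fixes W :: "nat \<Rightarrow> 'a \<Rightarrow> real"
  assumes ind: "indep_vars (\<lambda>_. borel) W UNIV"
    and sq: "\<And>i. integrable M (\<lambda>\<omega>. (W i \<omega>)\<^sup>2)" "\<And>i. expectation (\<lambda>\<omega>. (W i \<omega>)\<^sup>2) = K"
    and mean: "\<And>i. expectation (W i) = m"
    and lim: "(\<lambda>n. expectation (\<lambda>\<omega>. 1 / (1 + ((\<Sum>i<n. W i \<omega>) / sqrt (real n))\<^sup>2))) \<longlonglongrightarrow> L" and "0 < L"
  shows "m = 0"
proof (rule ccontr)
  assume "m \<noteq> 0"
  have Wm[measurable]: "W i \<in> borel_measurable M" for i
    using ind by (simp add: indep_vars_def)
  have W1: "integrable M (W i)" for i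
    by (rule square_integrable_imp_integrable[OF Wm sq(1)])
  define S where "S n \<omega> = (\<Sum>i<n. W i \<omega>) / sqrt (real n)" for n \<omega>
  have [measurable]: "S n \<in> borel_measurable M" for n unfolding S_def[abs_def] by measurable
  have bound: "expectation (\<lambda>\<omega>. 1 / (1 + (S n \<omega>)\<^sup>2)) \<le> 2 * (1 + K) / (1 + real n * m\<^sup>2)" if n: "n > 0" for n
  proof -
    define V where "V i \<omega> = W i \<omega> - m" for i \<omega>
    define C where "C \<omega> = (\<Sum>i<n. V i \<omega>) / sqrt (real n)" for \<omega>
    have V: "integrable M (\<lambda>\<omega>. (V i \<omega>)\<^sup>2)" "expectation (V i) = 0" "expectation (\<lambda>\<omega>. (V i \<omega>)\<^sup>2) \<le> K" for i
    proof -
      have "(V i \<omega>)\<^sup>2 = (W i \<omega>)\<^sup>2 - 2 * m * W i \<omega> + m\<^sup>2" for \<omega>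
        by (simp add: V_def power2_diff algebra_simps)
      moreover have "expectation (\<lambda>\<omega>. (W i \<omega>)\<^sup>2 - 2 * m * W i \<omega> + m\<^sup>2) = K - m\<^sup>2"
        using sq[of i] W1[of i] mean[of i] by (simp add: prob_space power2_eq_square)
      ultimately show "integrable M (\<lambda>\<omega>. (V i \<omega>)\<^sup>2)" "expectation (\<lambda>\<omega>. (V i \<omega>)\<^sup>2) \<le> K"
        using sq(1) W1 by simp_all
      show "expectation (V i) = 0"
        unfolding V_def[abs_def] using W1[of i] mean[of i] by (simp add: prob_space)
    qed
    have indV: "indep_vars (\<lambda>_. borel) V {..<n}"
      unfolding V_def[abs_def] by (rule indep_vars_compose2[OF indep_vars_subset[OF ind]]) auto
    note VS = indep_vars_sum_square[OF finite_lessThan indV V(1,2)]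
    have C2: "(C \<omega>)\<^sup>2 = (\<Sum>i<n. V i \<omega>)\<^sup>2 / real n" for \<omega> by (simp add: C_def power_divide)
    have C_int: "integrable M (\<lambda>\<omega>. (C \<omega>)\<^sup>2)" unfolding C2 using VS(1) by simp
    have "expectation (\<lambda>\<omega>. (C \<omega>)\<^sup>2) = (\<Sum>i<n. expectation (\<lambda>\<omega>. (V i \<omega>)\<^sup>2)) / real n"
      unfolding C2 by (simp add: VS(2))
    also have "\<dots> \<le> (\<Sum>i<n. K) / real n"
      by (intro divide_right_mono sum_mono V) auto
    also have "\<dots> = K" using n by simp
    finally have C_le: "expectation (\<lambda>\<omega>. (C \<omega>)\<^sup>2) \<le> K" .
    have pos: "1 + real n * m\<^sup>2 > 0" by (simp add: add_pos_nonneg)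
    \<comment> \<open>\<open>S n\<close> is the centred sum \<open>C\<close> shifted by
      \<open>sqrt n * m\<close>. The square of this shift ends up in the denominator, while the
      second moment of \<open>C\<close> stays below \<open>K\<close>.\<close>
    have pt: "1 / (1 + (S n \<omega>)\<^sup>2) \<le> 2 / (1 + real n * m\<^sup>2) * (1 + (C \<omega>)\<^sup>2)" for \<omega>
    proof -
      have "C \<omega> = S n \<omega> - sqrt (real n) * m"
        using n by (simp add: C_def S_def V_def sum_subtractf diff_divide_distrib real_div_sqrt mult.commute)
          (simp add: field_simps real_sqrt_mult_self flip: mult.assoc)
      then have "real n * m\<^sup>2 = (S n \<omega> - C \<omega>)\<^sup>2" by (simp add: power_mult_distrib)
      moreover have "1 + (x - y)\<^sup>2 \<le> 2 * (1 + y\<^sup>2) * (1 + x\<^sup>2)" for x y :: real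
      proof -
        have "0 \<le> (x + y)\<^sup>2 + 1 + 2 * (x * y)\<^sup>2" by simp
        then show ?thesis by (simp add: power2_eq_square algebra_simps)
      qed
      ultimately have "1 + real n * m\<^sup>2 \<le> 2 * (1 + (C \<omega>)\<^sup>2) * (1 + (S n \<omega>)\<^sup>2)" by simp
      then show ?thesis using pos by (simp add: divide_le_eq pos_le_divide_eq add_pos_nonneg)
    qed
    have "expectation (\<lambda>\<omega>. 1 / (1 + (S n \<omega>)\<^sup>2)) \<le> expectation (\<lambda>\<omega>. 2 / (1 + real n * m\<^sup>2) * (1 + (C \<omega>)\<^sup>2))"
    proof (rule integral_mono)
      show "integrable M (\<lambda>\<omega>. 1 / (1 + (S n \<omega>)\<^sup>2))"
        by (rule integrable_const_bound[where B = 1]) (auto simp: abs_le_iff add_pos_nonneg divide_le_eq)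
    qed (use C_int pt in auto)
    also have "\<dots> = 2 / (1 + real n * m\<^sup>2) * (1 + expectation (\<lambda>\<omega>. (C \<omega>)\<^sup>2))"
      using C_int by (simp add: prob_space)
    also have "\<dots> \<le> 2 / (1 + real n * m\<^sup>2) * (1 + K)"
      using pos C_le by (intro mult_left_mono) auto
    finally show ?thesis by simp
  qed
  have "(\<lambda>n. 2 * (1 + K) / (1 + real n * m\<^sup>2)) \<longlonglongrightarrow> 0"
  proof (rule tendsto_divide_0[OF tendsto_const])
    have "filterlim (\<lambda>n. real n * m\<^sup>2) at_top sequentially"
      using \<open>m \<noteq> 0\<close> by (intro filterlim_at_top_mult_tendsto_pos[OF tendsto_const _ filterlim_real_sequentially]) auto
    then have "filterlim (\<lambda>n. 1 + real n * m\<^sup>2) at_top sequentially"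
      by (rule filterlim_tendsto_add_at_top[OF tendsto_const])
    then show "filterlim (\<lambda>n. 1 + real n * m\<^sup>2) at_infinity sequentially"
      by (rule filterlim_at_top_imp_at_infinity)
  qed
  moreover have "eventually (\<lambda>n. expectation (\<lambda>\<omega>. 1 / (1 + (S n \<omega>)\<^sup>2)) \<le> 2 * (1 + K) / (1 + real n * m\<^sup>2)) sequentially"
    by (rule eventually_mono[OF eventually_gt_at_top[of 0] bound])
  ultimately have "L \<le> 0"
    using lim unfolding S_def[symmetric] by (intro tendsto_le[OF sequentially_bot]) auto
  with \<open>0 < L\<close> show False by simp
qed

section \<open>Conditional means of the efficient score\<close>

text \<open>The null law lives on the open square, the product of its marginals on the whole plane;
  extension by zero passes between the two.\<close>

lemma null_law_transfer:
  fixes f :: "real \<times> real \<Rightarrow> real"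
  assumes f: "f \<in> borel_measurable square_lborel"
  defines "f' \<equiv> \<lambda>z. indicator unit_square z * f z"
  shows "integral\<^sup>L (null_law q r) f = integral\<^sup>L (distr (null_law q r) borel (\<lambda>z. z)) f'"
    and "integrable (null_law q r) f \<longleftrightarrow> integrable (distr (null_law q r) borel (\<lambda>z. z)) f'"
proof -
  have id: "(\<lambda>z. z) \<in> measurable (null_law q r) borel"
    unfolding measurable_cong_sets[OF sets_null_law refl]
    by (intro measurable_square_lborel_borelI) simp
  have f': "f' \<in> borel_measurable borel"
    using f unfolding borel_measurable_square_lborel_real_iff f'_def .
  have eq: "f' z = f z" if "z \<in> space (null_law q r)" for z
    using that by (simp add: f'_def)
  show "integral\<^sup>L (null_law q r) f = integral\<^sup>L (distr (null_law q r) borel (\<lambda>z. z)) f'"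
    unfolding integral_distr[OF id f'] using eq by (intro Bochner_Integration.integral_cong) auto
  show "integrable (null_law q r) f \<longleftrightarrow> integrable (distr (null_law q r) borel (\<lambda>z. z)) f'"
    unfolding integrable_distr_eq[OF id f'] using eq by (intro Bochner_Integration.integrable_cong) auto
qed

text \<open>
  Both conditional means are minus the mean of the score, because the projections onto the two
  coordinates are independent.
\<close>

lemma efficient_score_conditional_means:
  fixes h q r
  defines "g \<equiv> \<lambda>(x, y). score_at_0 h (q x, r y)"
    and "l \<equiv> \<lambda>z. indicator unit_square z * efficient_score h q r z"
    and "P \<equiv> null_law q r"
    and "\<mu> \<equiv> distr (null_law q r) borel fst"
    and "\<nu> \<equiv> distr (null_law q r) borel snd"
  assumes prob: "prob_space P" and pair: "\<mu> \<Otimes>\<^sub>M \<nu> = distr P borel (\<lambda>z. z)"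
    and g: "g \<in> borel_measurable square_lborel" "integrable P g"
  obtains m where "AE x in \<mu>. (\<integral>y. l (x, y) \<partial>\<nu>) = m" "AE y in \<nu>. (\<integral>x. l (x, y) \<partial>\<mu>) = m"
proof -
  interpret P: prob_space P by (fact prob)
  have meas: "fst \<in> borel_measurable P" "snd \<in> borel_measurable P" "(\<lambda>z. z) \<in> borel_measurable P"
    unfolding P_def measurable_cong_sets[OF sets_null_law refl]
    by (intro measurable_square_lborel_borelI; simp add: borel_prod[symmetric])+
  note meas[measurable]
  interpret X: prob_space \<mu> unfolding \<mu>_def P_def[symmetric] by (rule P.prob_space_distr) (rule meas)
  interpret Y: prob_space \<nu> unfolding \<nu>_def P_def[symmetric] by (rule P.prob_space_distr) (rule meas)
  interpret XY: pair_prob_space \<mu> \<nu> ..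
  have sets[measurable_cong]: "sets \<mu> = sets borel" "sets \<nu> = sets borel" by (simp_all add: \<mu>_def \<nu>_def)
  define g' where "g' z = indicator unit_square z * g z" for z
  have "g' \<in> borel_measurable borel"
    using g(1) unfolding borel_measurable_square_lborel_real_iff g'_def[abs_def] .
  then have g'[measurable]: "g' \<in> borel_measurable (borel \<Otimes>\<^sub>M borel)" by (simp add: borel_prod)
  have g'_int: "integrable (\<mu> \<Otimes>\<^sub>M \<nu>) g'"
    using g(2) null_law_transfer(2)[OF g(1)] by (simp add: pair P_def g'_def[abs_def])
  then have g'_int2: "integrable (\<mu> \<Otimes>\<^sub>M \<nu>) (case_prod (\<lambda>x y. g' (x, y)))" by simp
  \<comment> \<open>Under a product law the conditional means given one coordinate are the section
    integrals over the other, so these are the candidates for the two conditional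
    expectations.\<close>
  define k1 where "k1 x = (\<integral>y. g' (x, y) \<partial>\<nu>)" for x
  define k2 where "k2 y = (\<integral>x. g' (x, y) \<partial>\<mu>)" for y
  have k[measurable]: "k1 \<in> borel_measurable borel" "k2 \<in> borel_measurable borel"
    unfolding k1_def[abs_def] k2_def[abs_def] by measurable
  have k1: "integrable \<mu> k1" and k2: "integrable \<nu> k2"
    using XY.integrable_fst[OF g'_int2] XY.integrable_snd[OF g'_int2]
    by (simp_all add: k1_def[abs_def] k2_def[abs_def])
  have mass: "(\<integral>x. k1 x \<partial>\<mu>) = (\<integral>y. k2 y \<partial>\<nu>)"
    using XY.Fubini_integral[OF g'_int2] by (simp add: k1_def k2_def)
  define G where "G = (\<integral>x. k1 x \<partial>\<mu>)"
  have ind: "P.expectation (\<lambda>z. indicator B z * g z) = (\<integral>z. indicator B z * g' z \<partial>(\<mu> \<Otimes>\<^sub>M \<nu>))"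
    if "B \<in> sets borel" for B
  proof -
    have "(\<lambda>z. indicator B z * g z) \<in> borel_measurable square_lborel"
      using measurable_square_lborel_borelI[OF borel_measurable_indicator[OF that]] g(1)
      by (rule borel_measurable_times)
    from null_law_transfer(1)[OF this, of q r]
    show ?thesis unfolding pair P_def g'_def by (simp add: mult_ac)
  qed
  have rect: "B \<times> (UNIV :: real set) \<in> sets borel" "(UNIV :: real set) \<times> B \<in> sets borel" if "B \<in> sets (borel :: real measure)"
    for B :: "real set"
    using that by (auto simp: borel_prod[symmetric])
  have ind_int: "integrable (\<mu> \<Otimes>\<^sub>M \<nu>) (\<lambda>z. indicator B z * g' z)" if "B \<in> sets borel" for B
  proof -
    have "B \<in> sets (\<mu> \<Otimes>\<^sub>M \<nu>)" unfolding pair sets_distr by (rule that)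
    from integrable_real_mult_indicator[OF this g'_int] show ?thesis by (simp add: mult.commute)
  qed
  have "AE z in P. real_cond_exp P (vimage_algebra (space P) fst borel) g z = k1 (fst z)"
  proof (rule P.real_cond_exp_vimage_algebra_eq[OF meas(1) g(2) k(1)])
    show "integrable P (\<lambda>z. k1 (fst z))"
      using k1 meas(1) k(1) unfolding \<mu>_def P_def[symmetric] by (subst (asm) integrable_distr_eq) auto
    fix B :: "real set" assume B[measurable]: "B \<in> sets borel"
    have "P.expectation (\<lambda>z. indicator B (fst z) * g z) = P.expectation (\<lambda>z. indicator (B \<times> UNIV) z * g z)"
      by (simp add: indicator_times case_prod_unfold)
    also have "\<dots> = (\<integral>z. indicator (B \<times> UNIV) z * g' z \<partial>(\<mu> \<Otimes>\<^sub>M \<nu>))"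
      by (rule ind[OF rect(1)[OF B]])
    also have "\<dots> = (\<integral>x. (\<integral>y. indicator (B \<times> UNIV) (x, y) * g' (x, y) \<partial>\<nu>) \<partial>\<mu>)"
      by (rule XY.integral_fst'[OF ind_int[OF rect(1)[OF B]], symmetric])
    also have "\<dots> = (\<integral>x. indicator B x * k1 x \<partial>\<mu>)"
      by (simp add: indicator_times k1_def)
    also have "\<dots> = P.expectation (\<lambda>z. indicator B (fst z) * k1 (fst z))"
      unfolding \<mu>_def P_def[symmetric] by (subst integral_distr) auto
    finally show "P.expectation (\<lambda>z. indicator B (fst z) * g z) = P.expectation (\<lambda>z. indicator B (fst z) * k1 (fst z))" .
  qed
  moreover have "AE z in P. real_cond_exp P (vimage_algebra (space P) snd borel) g z = k2 (snd z)"
  proof (rule P.real_cond_exp_vimage_algebra_eq[OF meas(2) g(2) k(2)])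
    show "integrable P (\<lambda>z. k2 (snd z))"
      using k2 meas(2) k(2) unfolding \<nu>_def P_def[symmetric] by (subst (asm) integrable_distr_eq) auto
    fix B :: "real set" assume B[measurable]: "B \<in> sets borel"
    have "P.expectation (\<lambda>z. indicator B (snd z) * g z) = P.expectation (\<lambda>z. indicator (UNIV \<times> B) z * g z)"
      by (simp add: indicator_times case_prod_unfold)
    also have "\<dots> = (\<integral>z. indicator (UNIV \<times> B) z * g' z \<partial>(\<mu> \<Otimes>\<^sub>M \<nu>))"
      by (rule ind[OF rect(2)[OF B]])
    also have "\<dots> = (\<integral>y. (\<integral>x. indicator (UNIV \<times> B) (x, y) * g' (x, y) \<partial>\<mu>) \<partial>\<nu>)"
    proof -
      have "integrable (\<mu> \<Otimes>\<^sub>M \<nu>) (case_prod (\<lambda>x y. indicator (UNIV \<times> B) (x, y) * g' (x, y)))"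
        unfolding case_prod_unfold prod.collapse by (rule ind_int[OF rect(2)[OF B]])
      from XY.integral_snd[OF this] show ?thesis
        unfolding case_prod_unfold prod.collapse by simp
    qed
    also have "\<dots> = (\<integral>y. indicator B y * k2 y \<partial>\<nu>)"
      by (simp add: indicator_times k2_def)
    also have "\<dots> = P.expectation (\<lambda>z. indicator B (snd z) * k2 (snd z))"
      unfolding \<nu>_def P_def[symmetric] by (subst integral_distr) auto
    finally show "P.expectation (\<lambda>z. indicator B (snd z) * g z) = P.expectation (\<lambda>z. indicator B (snd z) * k2 (snd z))" .
  qed
  ultimately have score_eq: "AE z in P. efficient_score h q r z = g z - k1 (fst z) - k2 (snd z)"
    by eventually_elim (simp add: efficient_score_def Let_def g_def P_def)
  have "efficient_score h q r \<in> borel_measurable square_lborel"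
  proof -
    have "real_cond_exp P F g \<in> borel_measurable square_lborel" for F
      using borel_measurable_cond_exp2[of P F g] by (simp add: P_def measurable_cong_sets[OF sets_null_law refl])
    then have "(\<lambda>z. g z - real_cond_exp P (vimage_algebra unit_square fst borel) g z
        - real_cond_exp P (vimage_algebra unit_square snd borel) g z) \<in> borel_measurable square_lborel"
      using g(1) by (intro borel_measurable_diff) auto
    then show ?thesis by (simp add: efficient_score_def Let_def g_def P_def)
  qed
  then have "l \<in> borel_measurable borel"
    unfolding borel_measurable_square_lborel_real_iff l_def .
  then have l[measurable]: "l \<in> borel_measurable (borel \<Otimes>\<^sub>M borel)" by (simp add: borel_prod)
  have "AE z in \<mu> \<Otimes>\<^sub>M \<nu>. l z = g' z - k1 (fst z) - k2 (snd z)"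
    unfolding pair
  proof (subst AE_distr_iff[OF meas(3)])
    have "{z \<in> space (borel \<Otimes>\<^sub>M borel). l z = g' z - k1 (fst z) - k2 (snd z)} \<in> sets (borel \<Otimes>\<^sub>M borel)"
      by measurable
    then show "{z \<in> space borel. l z = g' z - k1 (fst z) - k2 (snd z)} \<in> sets borel"
      unfolding borel_prod .
    show "AE z in P. l z = g' z - k1 (fst z) - k2 (snd z)"
      using score_eq AE_space by eventually_elim (simp add: l_def g'_def P_def)
  qed
  \<comment> \<open>The identity is needed in both orders of the quantifiers, since each conditional
    mean fixes one coordinate outside a null set before integrating over the other.\<close>
  then have eq1: "AE x in \<mu>. AE y in \<nu>. l (x, y) = g' (x, y) - k1 x - k2 y"
    using XY.AE_pair by fastforce
  moreover have "(AE x in \<mu>. AE y in \<nu>. l (x, y) = g' (x, y) - k1 x - k2 y) \<longleftrightarrow>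
      (AE y in \<nu>. AE x in \<mu>. l (x, y) = g' (x, y) - k1 x - k2 y)"
    by (rule XY.AE_commute) measurable
  ultimately have eq2: "AE y in \<nu>. AE x in \<mu>. l (x, y) = g' (x, y) - k1 x - k2 y" by simp
  have "AE x in \<mu>. (\<integral>y. l (x, y) \<partial>\<nu>) = - G"
    using eq1 XY.AE_integrable_fst'[OF g'_int]
  proof eventually_elim
    case (elim x)
    have "(\<integral>y. l (x, y) \<partial>\<nu>) = (\<integral>y. g' (x, y) - k1 x - k2 y \<partial>\<nu>)"
      using elim(1) by (intro integral_cong_AE) measurable
    also have "\<dots> = k1 x - k1 x - (\<integral>y. k2 y \<partial>\<nu>)"
      using elim(2) k2 by (simp add: k1_def Y.prob_space)
    finally show ?case by (simp add: G_def mass)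
  qed
  moreover have "AE y in \<nu>. (\<integral>x. l (x, y) \<partial>\<mu>) = - G"
    using eq2 XY.AE_integrable_snd[OF g'_int2]
  proof eventually_elim
    case (elim y)
    have "(\<integral>x. l (x, y) \<partial>\<mu>) = (\<integral>x. g' (x, y) - k1 x - k2 y \<partial>\<mu>)"
      using elim(1) by (intro integral_cong_AE) measurable
    also have "\<dots> = k2 y - (\<integral>x. k1 x \<partial>\<mu>) - k2 y"
      using elim(2) k1 by (simp add: k2_def X.prob_space)
    finally show ?case by (simp add: G_def)
  qed
  ultimately show ?thesis by (rule that)
qed

section \<open>Limits under the null law\<close>

text \<open>The limit law is used through two kinds of bounded continuous test functions only:
  cosines in the directions \<open>(1, v)\<close>, which see the covariance, and one positive
  function of the score sum, which records that its mass does not escape to infinity.\<close>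

lemma (in prob_space) joint_normal_limitD:
  assumes "joint_normal_limit M X Y T s \<sigma> \<rho> J"
  defines "Z \<equiv> \<lambda>n \<omega>. sqrt (real n) * T n (\<lambda>i. X i \<omega>) (\<lambda>i. Y i \<omega>)"
    and "S \<equiv> \<lambda>n \<omega>. (\<Sum>i<n. s (X i \<omega>, Y i \<omega>)) / sqrt (real n)"
  shows "Z n \<in> borel_measurable M" "S n \<in> borel_measurable M"
    and "(\<lambda>n. expectation (\<lambda>\<omega>. cos (Z n \<omega> + v * S n \<omega>))) \<longlonglongrightarrow>
      exp (- (\<sigma>\<^sup>2 + 2 * v * (\<rho> * \<sigma> * sqrt J) + v\<^sup>2 * J) / 2)"
    and "\<exists>L>0. (\<lambda>n. expectation (\<lambda>\<omega>. 1 / (1 + (S n \<omega>)\<^sup>2))) \<longlonglongrightarrow> L"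
proof -
  define c where "c = \<rho> * \<sigma> * sqrt J"
  define W :: "nat \<Rightarrow> 'a \<Rightarrow> real^2" where "W n \<omega> = vector [Z n \<omega>, S n \<omega>]" for n \<omega>
  obtain N :: "(real^2) measure" where N: "is_multivariate_normal 0
          (vector [vector [\<sigma>\<^sup>2, c], vector [c, J]]) N" "converges_in_distribution M W N"
    using assms(1) unfolding joint_normal_limit_def W_def Z_def S_def c_def by blast
  interpret N: prob_space N using N(1) by (simp add: is_multivariate_normal_def)
  have sets_N[measurable_cong]: "sets N = sets borel" using N(1) by (simp add: is_multivariate_normal_def)
  have W: "W n \<in> borel_measurable M" for n
    using N(2) by (simp add: converges_in_distribution_def)
  have conv: "(\<lambda>n. expectation (\<lambda>\<omega>. f (W n \<omega>))) \<longlonglongrightarrow> (LINT z|N. f z)"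
    if "continuous_on UNIV f" "bounded (range f)" for f :: "real^2 \<Rightarrow> real"
    using N(2) that by (simp add: converges_in_distribution_def)
  have comp: "(\<lambda>w. w $ i) \<in> borel_measurable (borel :: (real^2) measure)" for i :: 2
    by (intro borel_measurable_continuous_onI continuous_intros)
  show "Z n \<in> borel_measurable M" "S n \<in> borel_measurable M" for n
    using measurable_compose[OF W comp, of n 1] measurable_compose[OF W comp, of n 2]
    by (simp_all add: W_def)
  define t :: "real^2" where "t = vector [1, v]"
  have inner: "t \<bullet> w = w $ 1 + v * w $ 2" for w
    by (simp add: t_def inner_vec_def sum_2)
  have "(LINT w|N. cos (t \<bullet> w)) = Re (CLINT w|N. iexp (t \<bullet> w))"
  proof -
    have "integrable N (\<lambda>w. iexp (t \<bullet> w))"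
      by (rule N.integrable_iexp) auto
    from integral_Re[OF this] show ?thesis by (simp flip: cis_conv_exp)
  qed
  also have "\<dots> = Re (exp (\<i> * complex_of_real (t \<bullet> 0) -
      complex_of_real (t \<bullet> (vector [vector [\<sigma>\<^sup>2, c], vector [c, J]] *v t)) / 2))"
    using N(1) by (simp add: is_multivariate_normal_def)
  also have "t \<bullet> (vector [vector [\<sigma>\<^sup>2, c], vector [c, J]] *v t) = \<sigma>\<^sup>2 + 2 * v * c + v\<^sup>2 * J"
    unfolding inner by (simp add: matrix_vector_mult_def sum_2 t_def power2_eq_square algebra_simps)
  also have "Re (exp (\<i> * complex_of_real (t \<bullet> 0) - complex_of_real (\<sigma>\<^sup>2 + 2 * v * c + v\<^sup>2 * J) / 2)) =
      exp (- (\<sigma>\<^sup>2 + 2 * v * c + v\<^sup>2 * J) / 2)"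
  proof -
    have "\<i> * complex_of_real (t \<bullet> 0) - complex_of_real e / 2 = complex_of_real (- e / 2)" for e
      by simp
    then show ?thesis by (simp only: exp_of_real Re_complex_of_real)
  qed
  finally have lim: "(LINT w|N. cos (t \<bullet> w)) = exp (- (\<sigma>\<^sup>2 + 2 * v * c + v\<^sup>2 * J) / 2)" .
  have "(\<lambda>n. expectation (\<lambda>\<omega>. cos (t \<bullet> W n \<omega>))) \<longlonglongrightarrow> (LINT w|N. cos (t \<bullet> w))"
    by (intro conv continuous_intros boundedI[of _ 1]) auto
  then show "(\<lambda>n. expectation (\<lambda>\<omega>. cos (Z n \<omega> + v * S n \<omega>))) \<longlonglongrightarrow>
      exp (- (\<sigma>\<^sup>2 + 2 * v * (\<rho> * \<sigma> * sqrt J) + v\<^sup>2 * J) / 2)"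
    unfolding lim unfolding c_def inner by (simp add: W_def)
  \<comment> \<open>\<open>f\<close> is bounded, continuous and strictly positive, so its integral
    against any probability law is positive. Sums drifting to infinity would make the limit
    0.\<close>
  define f :: "real^2 \<Rightarrow> real" where "f w = 1 / (1 + (w $ 2)\<^sup>2)" for w
  have f_pos: "0 < f w" and f_le: "f w \<le> 1" for w
    by (simp_all add: f_def add_pos_nonneg divide_le_eq)
  have nz: "1 + x\<^sup>2 \<noteq> (0::real)" for x
    using zero_le_power2[of x] by linarith
  have f_cont: "continuous_on UNIV f"
    unfolding f_def[abs_def] by (intro continuous_intros) (auto simp: nz)
  have f_bdd: "bounded (range f)"
  proof (rule boundedI[of _ 1], safe)
    show "norm (f w) \<le> 1" for w using f_pos[of w] f_le[of w] by simp
  qed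
  have "f \<in> borel_measurable N"
    using borel_measurable_continuous_onI[OF f_cont] by measurable
  then have int: "integrable N f"
    by (rule N.integrable_const_bound[where B = 1, rotated]) (use f_pos f_le in \<open>auto simp: less_imp_le\<close>)
  have "0 < (LINT w|N. f w)"
  proof -
    have "(LINT w|N. f w) \<noteq> 0"
    proof
      assume "(LINT w|N. f w) = 0"
      then have "AE w in N. f w = 0"
        by (subst (asm) integral_nonneg_eq_0_iff_AE[OF int]) (use f_pos in \<open>auto simp: less_imp_le\<close>)
      then have "AE w in N. False" by eventually_elim (use f_pos less_irrefl in metis)
      then show False by (simp add: N.AE_False)
    qed
    moreover have "0 \<le> (LINT w|N. f w)" by (rule Bochner_Integration.integral_nonneg) (simp add: f_pos less_imp_le)
    ultimately show ?thesis by simp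
  qed
  moreover have "(\<lambda>n. expectation (\<lambda>\<omega>. f (W n \<omega>))) \<longlonglongrightarrow> (LINT w|N. f w)"
    by (rule conv[OF f_cont f_bdd])
  ultimately show "\<exists>L>0. (\<lambda>n. expectation (\<lambda>\<omega>. 1 / (1 + (S n \<omega>)\<^sup>2))) \<longlonglongrightarrow> L"
    by (auto simp: f_def W_def)
qed

text \<open>This replaces an arbitrary score of the submodel by the efficient one. Measurability of
  the new sums is assumed separately because \<open>M\<close> need not be complete.\<close>

lemma (in prob_space) joint_normal_limit_cong_AE:
  assumes lim: "joint_normal_limit M X Y T s \<sigma> \<rho> J"
    and meas: "\<And>n. (\<lambda>\<omega>. (\<Sum>i<n. s' (X i \<omega>, Y i \<omega>)) / sqrt (real n)) \<in> borel_measurable M"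
    and ae: "\<And>i. AE \<omega> in M. s (X i \<omega>, Y i \<omega>) = s' (X i \<omega>, Y i \<omega>)"
  shows "joint_normal_limit M X Y T s' \<sigma> \<rho> J"
proof -
  define W :: "(real \<times> real \<Rightarrow> real) \<Rightarrow> nat \<Rightarrow> 'a \<Rightarrow> real^2" where
    "W s n \<omega> = vector [sqrt (real n) * T n (\<lambda>i. X i \<omega>) (\<lambda>i. Y i \<omega>),
                         (\<Sum>i<n. s (X i \<omega>, Y i \<omega>)) / sqrt (real n)]" for s n \<omega>
  have W: "W s n \<in> borel_measurable M" for n
    using lim by (auto simp: joint_normal_limit_def converges_in_distribution_def W_def[abs_def])
  have W': "W s' n \<in> borel_measurable M" for n
  proof (subst borel_measurable_euclidean_space, rule)
    fix b :: "real^2" assume "b \<in> Basis"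
    then obtain i :: 2 where b: "b = axis i 1" by (auto simp: Basis_vec_def)
    have "W s' n \<omega> \<bullet> b = (if i = 1 then sqrt (real n) * T n (\<lambda>i. X i \<omega>) (\<lambda>i. Y i \<omega>)
        else (\<Sum>i<n. s' (X i \<omega>, Y i \<omega>)) / sqrt (real n))" for \<omega>
      using exhaust_2[of i] by (auto simp: b W_def inner_axis)
    then show "(\<lambda>\<omega>. W s' n \<omega> \<bullet> b) \<in> borel_measurable M"
      using joint_normal_limitD(1)[OF lim] meas by (cases "i = 1") simp_all
  qed
  have "AE \<omega> in M. \<forall>i. s (X i \<omega>, Y i \<omega>) = s' (X i \<omega>, Y i \<omega>)"
    using ae by (simp add: AE_all_countable)
  then have ae': "AE \<omega> in M. W s n \<omega> = W s' n \<omega>" for n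
    by eventually_elim (simp add: W_def)
  have "expectation (\<lambda>\<omega>. f (W s n \<omega>)) = expectation (\<lambda>\<omega>. f (W s' n \<omega>))"
    if "continuous_on UNIV f" for f :: "real^2 \<Rightarrow> real" and n
  proof (rule integral_cong_AE)
    note f = borel_measurable_continuous_onI[OF that]
    show "(\<lambda>\<omega>. f (W s n \<omega>)) \<in> borel_measurable M" "(\<lambda>\<omega>. f (W s' n \<omega>)) \<in> borel_measurable M"
      using measurable_compose[OF W f] measurable_compose[OF W' f] by auto
    show "AE \<omega> in M. f (W s n \<omega>) = f (W s' n \<omega>)" using ae'[of n] by eventually_elim simp
  qed
  then have "converges_in_distribution M (W s') N" if "converges_in_distribution M (W s) N" for N
    using that W' by (simp add: converges_in_distribution_def)
  then show ?thesis
    using lim unfolding joint_normal_limit_def W_def[abs_def] by blast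
qed

text \<open>The two integrals over \<open>M\<close> act as independent copies of the sample.
  Afterwards one factor depends on \<open>u\<close> alone and the other on \<open>v\<close> alone,
  which is the shape the kernel bound expects.\<close>

lemma (in prob_space) indep_var_integral_iterated:
  fixes F :: "'b \<times> 'b \<Rightarrow> real"
  assumes ind: "indep_var N1 V1 N2 V2" and F: "F \<in> borel_measurable (N1 \<Otimes>\<^sub>M N2)"
    and int: "integrable M (\<lambda>\<omega>. F (V1 \<omega>, V2 \<omega>))"
  shows "expectation (\<lambda>\<omega>. F (V1 \<omega>, V2 \<omega>)) = (\<integral>u. (\<integral>v. F (V1 u, V2 v) \<partial>M) \<partial>M)"
proof -
  have V[measurable]: "V1 \<in> measurable M N1" "V2 \<in> measurable M N2"
    using indep_var_rv1[OF ind] indep_var_rv2[OF ind] .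
  have law: "distr M N1 V1 \<Otimes>\<^sub>M distr M N2 V2 = distr M (N1 \<Otimes>\<^sub>M N2) (\<lambda>\<omega>. (V1 \<omega>, V2 \<omega>))"
    using ind indep_var_distribution_eq by blast
  interpret D1: prob_space "distr M N1 V1" by (rule prob_space_distr) (rule V)
  interpret D2: prob_space "distr M N2 V2" by (rule prob_space_distr) (rule V)
  interpret D: pair_prob_space "distr M N1 V1" "distr M N2 V2" ..
  note F[measurable]
  have "integrable (distr M N1 V1 \<Otimes>\<^sub>M distr M N2 V2) F"
    unfolding law using int by (subst integrable_distr_eq) auto
  from D.integral_fst'[OF this]
  have "(\<integral>x. (\<integral>y. F (x, y) \<partial>distr M N2 V2) \<partial>distr M N1 V1) = expectation (\<lambda>\<omega>. F (V1 \<omega>, V2 \<omega>))"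
    unfolding law by (subst (asm) (2) integral_distr) auto
  moreover have "(\<integral>x. (\<integral>y. F (x, y) \<partial>distr M N2 V2) \<partial>distr M N1 V1) =
      (\<integral>u. (\<integral>y. F (V1 u, y) \<partial>distr M N2 V2) \<partial>M)"
    by (rule integral_distr) measurable
  moreover have "(\<integral>y. F (V1 u, y) \<partial>distr M N2 V2) = (\<integral>v. F (V1 u, V2 v) \<partial>M)" if "u \<in> space M" for u
    using measurable_space[OF V(1) that] by (intro integral_distr) measurable
  ultimately show ?thesis by (simp cong: Bochner_Integration.integral_cong)
qed

section \<open>The submodel at the null parameter\<close>

lemma AE_lborel_fst_snd:
  fixes P :: "real \<Rightarrow> bool"
  assumes "AE x in lborel. P x"
  shows "AE z in (lborel :: (real \<times> real) measure). P (fst z)"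
    and "AE z in (lborel :: (real \<times> real) measure). P (snd z)"
proof -
  obtain N where N: "{x \<in> space lborel. \<not> P x} \<subseteq> N" "N \<in> null_sets lborel"
    using assms by (auto simp: eventually_ae_filter)
  then have [measurable]: "N \<in> sets lborel" by auto
  have "N \<times> UNIV \<in> null_sets (lborel \<Otimes>\<^sub>M lborel :: (real \<times> real) measure)"
    using N(2) by (auto simp: null_sets_def lborel.emeasure_pair_measure_Times)
  then show "AE z in (lborel :: (real \<times> real) measure). P (fst z)"
    unfolding lborel_prod using N(1) by (intro AE_I'[of "N \<times> UNIV"]) auto
  have "UNIV \<times> N \<in> null_sets (lborel \<Otimes>\<^sub>M lborel :: (real \<times> real) measure)"
    using N(2) by (auto simp: null_sets_def lborel.emeasure_pair_measure_Times)
  then show "AE z in (lborel :: (real \<times> real) measure). P (snd z)"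
    unfolding lborel_prod using N(1) by (intro AE_I'[of "UNIV \<times> N"]) auto
qed

text \<open>\<open>h 0\<close> is 1 on the open square only, and the margins are known to map into
  the open interval only almost everywhere, hence the almost everywhere equality. Agreement of the
  margins on \<open>{0..1}\<close> gives equal derivatives at interior points, where they agree on a
  neighbourhood.\<close>

lemma one_parameter_submodel_null:
  assumes "one_parameter_submodel h q0 r0 p" and h0: "\<And>z. z \<in> unit_square \<Longrightarrow> h 0 z = 1"
    and margins: "q0 \<in> margin_transforms" "r0 \<in> margin_transforms"
  shows "AE z in square_lborel. p 0 z = null_density q0 r0 z"
proof -
  obtain q r where p: "p 0 = generated_density h 0 q r"
    and qr: "\<And>x. x \<in> {0..1} \<Longrightarrow> q x = q0 x \<and> r x = r0 x"
    using assms(1) unfolding one_parameter_submodel_def by force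
  have deriv: "deriv q x = deriv q0 x" "deriv r x = deriv r0 x" if "x \<in> {0<..<1}" for x
  proof -
    have "eventually (\<lambda>x. x \<in> {0<..<1::real}) (nhds x)"
      using that by (intro eventually_nhds_in_open) auto
    then have "eventually (\<lambda>x. q x = q0 x) (nhds x)" "eventually (\<lambda>x. r x = r0 x) (nhds x)"
      by (auto elim!: eventually_mono simp: qr)
    then show "deriv q x = deriv q0 x" "deriv r x = deriv r0 x" by (auto intro: deriv_cong_ev)
  qed
  have "AE z in lborel. z \<in> unit_square \<longrightarrow> p 0 z = null_density q0 r0 z"
    using AE_lborel_fst_snd(1)[OF margin_transform_interior[OF margins(1)]]
      AE_lborel_fst_snd(2)[OF margin_transform_interior[OF margins(2)]]
  proof eventually_elim
    case (elim z)
    show ?case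
    proof
      assume z: "z \<in> unit_square"
      then have "(q0 (fst z), r0 (snd z)) \<in> unit_square" using elim by (auto simp: unit_square_def)
      moreover have "q (fst z) = q0 (fst z)" "r (snd z) = r0 (snd z)"
        using z qr[of "fst z"] qr[of "snd z"] by (auto simp: unit_square_def)
      ultimately show "p 0 z = null_density q0 r0 z"
        using z deriv by (auto simp: p generated_density_def null_density_def h0 unit_square_def)
    qed
  qed
  then show ?thesis
    unfolding square_lborel_def by (subst AE_restrict_space_iff) auto
qed

text \<open>Independence of the two sample vectors separates \<open>a\<close> and \<open>b\<close>
  into different integrals. The kernel bound then treats all \<open>n\<close> summands together
  without a factor \<open>n\<close>, so the normalisation \<open>1 / sqrt n\<close> is a pure
  gain.\<close>

lemma (in prob_space) cross_term_bound:
  fixes X Y :: "nat \<Rightarrow> 'a \<Rightarrow> real" and l :: "real \<times> real \<Rightarrow> real"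
    and a b :: "(nat \<Rightarrow> real) \<Rightarrow> real"
  assumes ind: "indep_vars (\<lambda>_. borel \<Otimes>\<^sub>M borel) (\<lambda>i \<omega>. (X i \<omega>, Y i \<omega>)) UNIV"
    and comp: "\<And>i. indep_var borel (X i) borel (Y i)"
    and law: "\<And>i. distr M borel (X i) = \<mu>" "\<And>i. distr M borel (Y i) = \<nu>"
    and l: "l \<in> borel_measurable (borel \<Otimes>\<^sub>M borel)" "integrable (\<mu> \<Otimes>\<^sub>M \<nu>) (\<lambda>z. (l z)\<^sup>2)"
    and deg: "AE x in \<mu>. (\<integral>y. l (x, y) \<partial>\<nu>) = 0" "AE y in \<nu>. (\<integral>x. l (x, y) \<partial>\<mu>) = 0"
    and a: "a \<in> borel_measurable (\<Pi>\<^sub>M i\<in>{..<n}. borel)" "\<And>x. \<bar>a x\<bar> \<le> 1"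
    and b: "b \<in> borel_measurable (\<Pi>\<^sub>M i\<in>{..<n}. borel)" "\<And>y. \<bar>b y\<bar> \<le> 1"
  shows "\<bar>expectation (\<lambda>\<omega>. a (\<lambda>i\<in>{..<n}. X i \<omega>) * b (\<lambda>i\<in>{..<n}. Y i \<omega>) *
      ((\<Sum>i<n. l (X i \<omega>, Y i \<omega>)) / sqrt (real n)))\<bar>
    \<le> sqrt (\<integral>z. (l z)\<^sup>2 \<partial>(\<mu> \<Otimes>\<^sub>M \<nu>)) / sqrt (real n)"
proof (cases "n = 0")
  \<comment> \<open>Independence of the vectors is available for a nonempty index set. For
    \<open>n = 0\<close> both sides are 0 because division by \<open>sqrt 0\<close> yields
    0.\<close>
  case False
  define x where "x \<omega> = (\<lambda>i\<in>{..<n}. X i \<omega>)" for \<omega>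
  define y where "y \<omega> = (\<lambda>i\<in>{..<n}. Y i \<omega>)" for \<omega>
  note l(1)[measurable] a(1)[measurable] b(1)[measurable]
  have XY[measurable]: "X i \<in> borel_measurable M" "Y i \<in> borel_measurable M" for i
    using indep_var_rv1[OF comp[of i]] indep_var_rv2[OF comp[of i]] .
  have xy: "indep_var (\<Pi>\<^sub>M i\<in>{..<n}. borel) x (\<Pi>\<^sub>M i\<in>{..<n}. borel) y"
    unfolding x_def[abs_def] y_def[abs_def]
    by (rule indep_vars_pair_vectors[OF _ _ indep_vars_subset[OF ind] comp]) (use False in auto)
  have xym[measurable]: "x \<in> measurable M (\<Pi>\<^sub>M i\<in>{..<n}. borel)" "y \<in> measurable M (\<Pi>\<^sub>M i\<in>{..<n}. borel)"
    using indep_var_rv1[OF xy] indep_var_rv2[OF xy] .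
  have prob: "prob_space \<mu>" "prob_space \<nu>"
    using prob_space_distr[OF XY(1)[of 0]] prob_space_distr[OF XY(2)[of 0]] by (simp_all add: law)
  have sets: "sets \<mu> = sets borel" "sets \<nu> = sets borel"
    using law[of 0] by (metis sets_distr)+
  have pair: "\<mu> \<Otimes>\<^sub>M \<nu> = distr M (borel \<Otimes>\<^sub>M borel) (\<lambda>\<omega>. (X i \<omega>, Y i \<omega>))" for i
    using comp[of i] unfolding indep_var_distribution_eq law by blast
  have l2: "integrable M (\<lambda>\<omega>. (l (X i \<omega>, Y i \<omega>))\<^sup>2)" for i
    using l(2) unfolding pair[of i] by (subst (asm) integrable_distr_eq) auto
  have l1: "integrable M (\<lambda>\<omega>. l (X i \<omega>, Y i \<omega>))" for i
    by (rule square_integrable_imp_integrable[OF _ l2]) measurable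
  have abl: "integrable M (\<lambda>\<omega>. a (x \<omega>) * b (y \<omega>) * l (X i \<omega>, Y i \<omega>))" for i
  proof (rule Bochner_Integration.integrable_bound[OF l1])
    have "\<bar>a (x \<omega>) * b (y \<omega>)\<bar> \<le> 1" for \<omega>
      using mult_mono[OF a(2)[of "x \<omega>"] b(2)[of "y \<omega>"]] by (simp add: abs_mult)
    then show "AE \<omega> in M. norm (a (x \<omega>) * b (y \<omega>) * l (X i \<omega>, Y i \<omega>)) \<le> norm (l (X i \<omega>, Y i \<omega>))"
      unfolding real_norm_def abs_mult[of "_ * _"] by (intro AE_I2 mult_left_le_one_le) auto
  qed measurable
  have indX: "indep_vars (\<lambda>_. borel) X {..<n}" and indY: "indep_vars (\<lambda>_. borel) Y {..<n}"
    using indep_vars_compose2[OF indep_vars_subset[OF ind], of "{..<n}" "\<lambda>_. fst" "\<lambda>_. borel"]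
      indep_vars_compose2[OF indep_vars_subset[OF ind], of "{..<n}" "\<lambda>_. snd" "\<lambda>_. borel"]
    by simp_all
  have term_eq: "expectation (\<lambda>\<omega>. a (x \<omega>) * b (y \<omega>) * l (X i \<omega>, Y i \<omega>)) =
      (\<integral>u. a (x u) * (\<integral>v. b (y v) * l (X i u, Y i v) \<partial>M) \<partial>M)" if i: "i < n" for i
  proof -
    define F where "F z = a (fst z) * b (snd z) * l (fst z i, snd z i)" for z
    have F: "F \<in> borel_measurable ((\<Pi>\<^sub>M i\<in>{..<n}. borel) \<Otimes>\<^sub>M (\<Pi>\<^sub>M i\<in>{..<n}. borel))"
    proof -
      have c: "(\<lambda>f. f i) \<in> borel_measurable (\<Pi>\<^sub>M i\<in>{..<n}. (borel :: real measure))"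
        by (rule measurable_component_singleton) (use i in simp)
      note measurable_compose[OF measurable_fst c, measurable] measurable_compose[OF measurable_snd c, measurable]
      show ?thesis unfolding F_def[abs_def] by measurable
    qed
    have Fxy: "F (x u, y v) = a (x u) * (b (y v) * l (X i u, Y i v))" for u v
      using i by (simp add: F_def x_def y_def)
    from indep_var_integral_iterated[OF xy F] abl[of i] show ?thesis
      unfolding Fxy by (simp add: mult.assoc)
  qed
  have "expectation (\<lambda>\<omega>. a (x \<omega>) * b (y \<omega>) * ((\<Sum>i<n. l (X i \<omega>, Y i \<omega>)) / sqrt (real n))) =
      expectation (\<lambda>\<omega>. \<Sum>i<n. a (x \<omega>) * b (y \<omega>) * l (X i \<omega>, Y i \<omega>)) / sqrt (real n)"
    by (simp add: sum_distrib_left)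
  also have "expectation (\<lambda>\<omega>. \<Sum>i<n. a (x \<omega>) * b (y \<omega>) * l (X i \<omega>, Y i \<omega>)) =
      (\<Sum>i<n. \<integral>u. a (x u) * (\<integral>v. b (y v) * l (X i u, Y i v) \<partial>M) \<partial>M)" (is "_ = ?D")
    using abl by (subst Bochner_Integration.integral_sum) (simp_all add: term_eq)
  finally have eq: "expectation (\<lambda>\<omega>. a (x \<omega>) * b (y \<omega>) * ((\<Sum>i<n. l (X i \<omega>, Y i \<omega>)) / sqrt (real n))) =
      ?D / sqrt (real n)" .
  have "?D\<^sup>2 \<le> (\<integral>z. (l z)\<^sup>2 \<partial>(\<mu> \<Otimes>\<^sub>M \<nu>))"
  proof (rule degenerate_kernel_bound[OF _ indX law(1) indY law(2) prob sets l deg])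
    show "(\<lambda>\<omega>. a (x \<omega>)) \<in> borel_measurable M" "(\<lambda>\<omega>. b (y \<omega>)) \<in> borel_measurable M" by measurable
  qed (use a b in auto)
  then have "\<bar>?D\<bar> \<le> sqrt (\<integral>z. (l z)\<^sup>2 \<partial>(\<mu> \<Otimes>\<^sub>M \<nu>))" by (simp add: real_le_rsqrt)
  then show ?thesis
    unfolding x_def[symmetric] y_def[symmetric] eq by (simp add: divide_right_mono)
qed simp

text \<open>\<open>\<rho> * \<sigma> * sqrt J\<close> is the off-diagonal entry of the limiting
  covariance. The score \<open>s\<close> is given on the square, and \<open>l\<close> is a Borel
  function on the plane that agrees with it along the sample. The common value \<open>m\<close> of
  the conditional means is left open here and forced to be 0 by the assumed convergence.\<close>

lemma (in prob_space) additive_statistic_uncorrelated: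
  fixes X Y :: "nat \<Rightarrow> 'a \<Rightarrow> real" and s :: "real \<times> real \<Rightarrow> real"
    and T :: "nat \<Rightarrow> (nat \<Rightarrow> real) \<Rightarrow> (nat \<Rightarrow> real) \<Rightarrow> real"
    and qx qy :: "nat \<Rightarrow> (nat \<Rightarrow> real) \<Rightarrow> real"
  assumes ind: "indep_vars (\<lambda>_. borel \<Otimes>\<^sub>M borel) (\<lambda>i \<omega>. (X i \<omega>, Y i \<omega>)) UNIV"
    and comp: "\<And>i. indep_var borel (X i) borel (Y i)"
    and law: "\<And>i. distr M borel (X i) = \<mu>" "\<And>i. distr M borel (Y i) = \<nu>"
    and l: "l \<in> borel_measurable (borel \<Otimes>\<^sub>M borel)" "integrable (\<mu> \<Otimes>\<^sub>M \<nu>) (\<lambda>z. (l z)\<^sup>2)"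
    and deg: "AE x in \<mu>. (\<integral>y. l (x, y) \<partial>\<nu>) = m" "AE y in \<nu>. (\<integral>x. l (x, y) \<partial>\<mu>) = m"
    and sl: "\<And>i \<omega>. \<omega> \<in> space M \<Longrightarrow> s (X i \<omega>, Y i \<omega>) = l (X i \<omega>, Y i \<omega>)"
    and limit: "joint_normal_limit M X Y T s \<sigma> \<rho> J"
    and qx: "\<And>n. qx n \<in> borel_measurable (\<Pi>\<^sub>M i\<in>{..<n}. borel)"
    and qy: "\<And>n. qy n \<in> borel_measurable (\<Pi>\<^sub>M i\<in>{..<n}. borel)"
    and decomposition: "converges_in_probability_to_0 M
          (\<lambda>n \<omega>. sqrt (real n) * T n (\<lambda>i. X i \<omega>) (\<lambda>i. Y i \<omega>)
                 - (qx n (\<lambda>i\<in>{..<n}. X i \<omega>) + qy n (\<lambda>i\<in>{..<n}. Y i \<omega>)))"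
  shows "\<rho> * \<sigma> * sqrt J = 0"
proof -
  define K where "K = (\<integral>z. (l z)\<^sup>2 \<partial>(\<mu> \<Otimes>\<^sub>M \<nu>))"
  define S where "S n \<omega> = (\<Sum>i<n. l (X i \<omega>, Y i \<omega>)) / sqrt (real n)" for n \<omega>
  define Z where "Z n \<omega> = sqrt (real n) * T n (\<lambda>i. X i \<omega>) (\<lambda>i. Y i \<omega>)" for n \<omega>
  define A where "A n \<omega> = qx n (\<lambda>i\<in>{..<n}. X i \<omega>)" for n \<omega>
  define B where "B n \<omega> = qy n (\<lambda>i\<in>{..<n}. Y i \<omega>)" for n \<omega>
  note l(1)[measurable]
  have XY[measurable]: "X i \<in> borel_measurable M" "Y i \<in> borel_measurable M" for i
    using indep_var_rv1[OF comp[of i]] indep_var_rv2[OF comp[of i]] .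
  have prob: "prob_space \<mu>" "prob_space \<nu>"
    using prob_space_distr[OF XY(1)[of 0]] prob_space_distr[OF XY(2)[of 0]] by (simp_all add: law)
  interpret X: prob_space \<mu> by (fact prob)
  interpret Y: prob_space \<nu> by (fact prob)
  interpret XY: pair_prob_space \<mu> \<nu> ..
  have pair: "\<mu> \<Otimes>\<^sub>M \<nu> = distr M (borel \<Otimes>\<^sub>M borel) (\<lambda>\<omega>. (X i \<omega>, Y i \<omega>))" for i
    using comp[of i] unfolding indep_var_distribution_eq law by blast
  define W where "W i \<omega> = l (X i \<omega>, Y i \<omega>)" for i \<omega>
  have W[measurable]: "W i \<in> borel_measurable M" for i unfolding W_def[abs_def] by measurable
  have W_ind: "indep_vars (\<lambda>_. borel) W UNIV"
    unfolding W_def[abs_def] by (rule indep_vars_compose2[OF ind]) (rule l)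
  have W2: "integrable M (\<lambda>\<omega>. (W i \<omega>)\<^sup>2)" "expectation (\<lambda>\<omega>. (W i \<omega>)\<^sup>2) = K" for i
  proof -
    show "integrable M (\<lambda>\<omega>. (W i \<omega>)\<^sup>2)"
      using l(2) unfolding pair[of i] W_def by (subst (asm) integrable_distr_eq) auto
    show "expectation (\<lambda>\<omega>. (W i \<omega>)\<^sup>2) = K"
      unfolding K_def pair[of i] W_def by (subst integral_distr) auto
  qed
  have W_mean: "expectation (W i) = m" for i
  proof -
    have lm: "l \<in> borel_measurable (\<mu> \<Otimes>\<^sub>M \<nu>)" unfolding pair[of i] measurable_distr_eq1 by (rule l)
    have "expectation (W i) = (\<integral>z. l z \<partial>(\<mu> \<Otimes>\<^sub>M \<nu>))"
      unfolding pair[of i] W_def[abs_def] by (subst integral_distr) auto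
    also have "\<dots> = (\<integral>x. (\<integral>y. l (x, y) \<partial>\<nu>) \<partial>\<mu>)"
      by (rule XY.integral_fst'[symmetric]) (rule XY.P.square_integrable_imp_integrable[OF lm l(2)])
    also have "\<dots> = (\<integral>x. m \<partial>\<mu>)"
    proof (rule integral_cong_AE)
      show "(\<lambda>x. \<integral>y. l (x, y) \<partial>\<nu>) \<in> borel_measurable \<mu>"
        using XY.integrable_fst'[OF XY.P.square_integrable_imp_integrable[OF lm l(2)]] by simp
    qed (use deg in simp_all)
    also have "\<dots> = m" by (simp add: X.prob_space)
    finally show ?thesis .
  qed
  have S_eq: "(\<Sum>i<n. s (X i \<omega>, Y i \<omega>)) / sqrt (real n) = S n \<omega>" if "\<omega> \<in> space M" for n \<omega>
    using that by (simp add: S_def sl)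
  have S_W: "S n \<omega> = (\<Sum>i<n. W i \<omega>) / sqrt (real n)" for n \<omega> by (simp add: S_def W_def)
  obtain L where L: "0 < L"
      "(\<lambda>n. expectation (\<lambda>\<omega>. 1 / (1 + ((\<Sum>i<n. s (X i \<omega>, Y i \<omega>)) / sqrt (real n))\<^sup>2))) \<longlonglongrightarrow> L"
    using joint_normal_limitD(4)[OF limit] by blast
  \<comment> \<open>A positive limit \<open>L\<close> excludes a drift of order
    \<open>sqrt n\<close> in the score sums, hence a nonzero mean; from here on the kernel is
    degenerate.\<close>
  have "m = 0"
  proof (rule tight_normalised_sums_imp_mean_zero[OF W_ind W2 W_mean _ L(1)])
    show "(\<lambda>n. expectation (\<lambda>\<omega>. 1 / (1 + ((\<Sum>i<n. W i \<omega>) / sqrt (real n))\<^sup>2))) \<longlonglongrightarrow> L"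
      using L(2) by (simp add: S_eq S_W cong: Bochner_Integration.integral_cong)
  qed
  note deg0 = deg[unfolded this]
  have S_meas[measurable]: "S n \<in> borel_measurable M" for n unfolding S_W[abs_def] by measurable
  have A[measurable]: "A n \<in> borel_measurable M" and B[measurable]: "B n \<in> borel_measurable M" for n
    unfolding A_def[abs_def] B_def[abs_def]
    by (rule measurable_compose[OF _ qx] measurable_compose[OF _ qy]; measurable)+
  have S2: "integrable M (\<lambda>\<omega>. (S n \<omega>)\<^sup>2)" "expectation (\<lambda>\<omega>. (S n \<omega>)\<^sup>2) \<le> K" for n
  proof -
    have eq: "(S n \<omega>)\<^sup>2 = (\<Sum>i<n. W i \<omega>)\<^sup>2 / real n" for \<omega> by (simp add: S_W power_divide)
    note sums = indep_vars_sum_square[OF finite_lessThan[of n] indep_vars_subset[OF W_ind subset_UNIV] W2(1)]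
    have 0: "expectation (W i) = 0" for i using W_mean \<open>m = 0\<close> by simp
    show "integrable M (\<lambda>\<omega>. (S n \<omega>)\<^sup>2)" unfolding eq using sums(1)[OF 0] by simp
    have "0 \<le> K" by (simp add: K_def)
    then show "expectation (\<lambda>\<omega>. (S n \<omega>)\<^sup>2) \<le> K"
      unfolding eq using sums(2)[OF 0] W2(2) by (cases "n = 0") simp_all
  qed
  \<comment> \<open>Only measurability and the bound 1 enter, so one statement covers both products
    from the addition theorem. The functions \<open>qx n\<close> and \<open>qy n\<close> may be
    unbounded; the sine and the cosine bound them.\<close>
  have cross: "(\<lambda>n. expectation (\<lambda>\<omega>. f (A n \<omega>) * g (B n \<omega>) * S n \<omega>)) \<longlonglongrightarrow> 0"
    if f: "f \<in> borel_measurable borel" "\<And>t. \<bar>f t\<bar> \<le> 1"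
      and g: "g \<in> borel_measurable borel" "\<And>t. \<bar>g t\<bar> \<le> 1" for f g :: "real \<Rightarrow> real"
  proof (rule Lim_null_comparison)
    have "norm (expectation (\<lambda>\<omega>. f (A n \<omega>) * g (B n \<omega>) * S n \<omega>)) \<le> sqrt K / sqrt (real n)" for n
      unfolding A_def B_def S_def real_norm_def K_def
      using cross_term_bound[OF ind comp law l deg0 measurable_compose[OF qx f(1)] f(2)
          measurable_compose[OF qy g(1)] g(2)] .
    then show "eventually (\<lambda>n. norm (expectation (\<lambda>\<omega>. f (A n \<omega>) * g (B n \<omega>) * S n \<omega>)) \<le>
        sqrt K / sqrt (real n)) sequentially" by simp
    show "(\<lambda>n. sqrt K / sqrt (real n)) \<longlonglongrightarrow> 0"
      by (intro tendsto_divide_0[OF tendsto_const] filterlim_at_top_imp_at_infinity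
          filterlim_compose[OF sqrt_at_top filterlim_real_sequentially])
  qed
  show ?thesis
  proof (rule asymptotically_uncorrelated[OF _ S_meas A B _ S2])
    show "Z n \<in> borel_measurable M" for n
      using joint_normal_limitD(1)[OF limit] by (simp add: Z_def[abs_def])
    show "(\<lambda>n. prob {\<omega> \<in> space M. \<epsilon> < \<bar>Z n \<omega> - (A n \<omega> + B n \<omega>)\<bar>}) \<longlonglongrightarrow> 0" if "0 < \<epsilon>" for \<epsilon>
      using decomposition that by (simp add: converges_in_probability_to_0_def Z_def A_def B_def)
    show "(\<lambda>n. expectation (\<lambda>\<omega>. cos (Z n \<omega> + v * S n \<omega>))) \<longlonglongrightarrow>
        exp (- (\<sigma>\<^sup>2 + 2 * v * (\<rho> * \<sigma> * sqrt J) + v\<^sup>2 * J) / 2)" for v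
      using joint_normal_limitD(3)[OF limit, of v]
      by (simp add: S_eq Z_def cong: Bochner_Integration.integral_cong)
  qed (rule cross; simp)+
qed

section \<open>The Pitman efficiency as a definite description\<close>

theorem proposition4p18:
  fixes h p :: "real \<Rightarrow> real \<times> real \<Rightarrow> real"
    and q0 r0 :: "real \<Rightarrow> real"
    and M :: "'a measure"
    and X Y :: "nat \<Rightarrow> 'a \<Rightarrow> real"
    and T :: "nat \<Rightarrow> (nat \<Rightarrow> real) \<Rightarrow> (nat \<Rightarrow> real) \<Rightarrow> real"
    and qx qy :: "nat \<Rightarrow> (nat \<Rightarrow> real) \<Rightarrow> real"
    and \<sigma> \<rho> I :: real
  assumes family: "copula_density_family h"
    and margins: "q0 \<in> margin_transforms" "r0 \<in> margin_transforms"
    and submodel: "one_parameter_submodel h q0 r0 p"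
    and submodel_score: "qmd_at_0 p (efficient_score h q0 r0)"
    and "prob_space M"
    and indep: "prob_space.indep_vars M (\<lambda>_. square_lborel) (\<lambda>i \<omega>. (X i \<omega>, Y i \<omega>)) UNIV"
    and ident: "\<And>i. distributed M square_lborel (\<lambda>\<omega>. (X i \<omega>, Y i \<omega>))
                       (\<lambda>z. ennreal (null_density q0 r0 z))"
    and rank: "\<And>n. rank_statistic n (T n)"
    and info: "I = (LINT z|null_law q0 r0. (efficient_score h q0 r0 z)\<^sup>2)"
    and pos: "0 < \<sigma>" "0 < I"
    and limit: "joint_normal_limit M X Y T (efficient_score h q0 r0) \<sigma> \<rho> I"
    and qx_meas: "\<And>n. qx n \<in> borel_measurable (\<Pi>\<^sub>M i\<in>{..<n}. borel)"
    and qy_meas: "\<And>n. qy n \<in> borel_measurable (\<Pi>\<^sub>M i\<in>{..<n}. borel)"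
    and decomposition: "converges_in_probability_to_0 M
          (\<lambda>n \<omega>. sqrt (real n) * T n (\<lambda>i. X i \<omega>) (\<lambda>i. Y i \<omega>)
                 - (qx n (\<lambda>i\<in>{..<n}. X i \<omega>) + qy n (\<lambda>i\<in>{..<n}. Y i \<omega>)))"
  shows "pitman_efficiency M X Y p T = \<rho>\<^sup>2 \<and> \<rho>\<^sup>2 = 0"
proof -
  interpret prob_space M by fact
  define P where "P = null_law q0 r0"
  define es where "es = efficient_score h q0 r0"
  define l where "l z = indicator unit_square z * es z" for z
  define g where "g = (\<lambda>(x, y). score_at_0 h (q0 x, r0 y))"
  define \<mu> where "\<mu> = distr P borel fst"
  define \<nu> where "\<nu> = distr P borel snd"
  have meas: "(\<lambda>z. ennreal (null_density q0 r0 z)) \<in> borel_measurable square_lborel"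
    and XY: "(\<lambda>\<omega>. (X i \<omega>, Y i \<omega>)) \<in> measurable M square_lborel"
    and law_XY: "distr M square_lborel (\<lambda>\<omega>. (X i \<omega>, Y i \<omega>)) = P" for i
    using ident[of i] by (simp_all add: distributed_def P_def null_law_def square_law_def)
  have prob: "prob_space P" using prob_space_distr[OF XY[of 0]] by (simp add: law_XY)
  have proj: "fst \<in> borel_measurable square_lborel" "snd \<in> borel_measurable square_lborel"
    "(\<lambda>z. z) \<in> measurable square_lborel (borel :: (real \<times> real) measure)"
    by (intro measurable_square_lborel_borelI; simp add: borel_prod[symmetric])+
  have Xm: "X i \<in> borel_measurable M" and Ym: "Y i \<in> borel_measurable M" for i
    using measurable_compose[OF XY proj(1)] measurable_compose[OF XY proj(2)] by simp_all
  have laws: "distr M borel (X i) = \<mu>" "distr M borel (Y i) = \<nu>"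
    "distr M borel (\<lambda>\<omega>. (X i \<omega>, Y i \<omega>)) = distr P borel (\<lambda>z. z)" for i
    unfolding \<mu>_def \<nu>_def law_XY[of i, symmetric]
    using distr_distr[OF proj(1) XY] distr_distr[OF proj(2) XY] distr_distr[OF proj(3) XY]
    by (simp_all add: comp_def)
  have pair: "\<mu> \<Otimes>\<^sub>M \<nu> = distr P borel (\<lambda>z. z)"
    unfolding \<mu>_def \<nu>_def P_def
    by (rule null_law_eq_pair_measure[OF margins meas prob[unfolded P_def]])
  have comp: "indep_var borel (X i) borel (Y i)" for i
    unfolding indep_var_distribution_eq laws pair borel_prod using Xm Ym by simp
  have ind: "indep_vars (\<lambda>_. borel \<Otimes>\<^sub>M borel) (\<lambda>i \<omega>. (X i \<omega>, Y i \<omega>)) UNIV"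
    using indep_vars_compose2[OF indep, of "\<lambda>_ z. z" "\<lambda>_. borel"] proj(3) by (simp add: borel_prod)
  have es_meas: "es \<in> borel_measurable square_lborel"
    using submodel_score by (simp add: qmd_at_0_def es_def)
  have "l \<in> borel_measurable borel"
    using es_meas unfolding borel_measurable_square_lborel_real_iff l_def[abs_def] .
  then have l: "l \<in> borel_measurable (borel \<Otimes>\<^sub>M borel)" by (simp add: borel_prod)
  \<comment> \<open>The Bochner integral of a nonintegrable function is 0, so \<open>0 < I\<close>
    already contains square integrability.\<close>
  have l2: "integrable (\<mu> \<Otimes>\<^sub>M \<nu>) (\<lambda>z. (l z)\<^sup>2)"
  proof -
    have "integrable P (\<lambda>z. (es z)\<^sup>2)"
      using pos(2) not_integrable_integral_eq[of P "\<lambda>z. (es z)\<^sup>2"] info by (auto simp: P_def es_def)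
    moreover have "(\<lambda>z. (es z)\<^sup>2) \<in> borel_measurable square_lborel" using es_meas by measurable
    ultimately have "integrable (distr P borel (\<lambda>z. z)) (\<lambda>z. indicator unit_square z * (es z)\<^sup>2)"
      using null_law_transfer(2) by (simp add: P_def)
    moreover have "indicator unit_square z * (es z)\<^sup>2 = (l z)\<^sup>2" for z
      by (simp add: l_def split: split_indicator)
    ultimately show ?thesis by (simp add: pair)
  qed
  have h0: "h 0 z = 1" if "z \<in> unit_square" for z
    using family that by (simp add: copula_density_family_def)
  \<comment> \<open>Measurability of the composed score is not obtained from the composition:
    \<open>es\<close> is measurable as a score of the submodel, real conditional expectations are
    always measurable, and adding them back to \<open>es\<close> gives \<open>g\<close>.\<close>
  have g_meas: "g \<in> borel_measurable square_lborel"
  proof -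
    define ce where "ce \<pi> = real_cond_exp P (vimage_algebra unit_square \<pi> borel) g" for \<pi> :: "real \<times> real \<Rightarrow> real"
    have "ce \<pi> \<in> borel_measurable square_lborel" for \<pi>
      using borel_measurable_cond_exp2[of P _ g]
      by (simp add: ce_def P_def measurable_cong_sets[OF sets_null_law refl])
    then have "(\<lambda>z. es z + ce fst z + ce snd z) \<in> borel_measurable square_lborel"
      using es_meas by measurable
    moreover have "(\<lambda>z. es z + ce fst z + ce snd z) = g"
      by (simp add: es_def efficient_score_def Let_def g_def ce_def P_def fun_eq_iff)
    ultimately show ?thesis by simp
  qed
  \<comment> \<open>Without integrability the conditional expectations in the efficient score could
    not be identified. The substitution reduces it to uniform coordinates, where
    \<open>h 0 = 1\<close> and differentiability in quadratic mean gives a finite first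
    moment.\<close>
  have g_int: "integrable P g"
  proof (rule integrableI_bounded)
    show "g \<in> borel_measurable P" using g_meas by (simp add: P_def measurable_cong_sets[OF sets_null_law refl])
    have qmd: "qmd_at_0 h (score_at_0 h)" using family by (simp add: copula_density_family_def)
    then have [measurable]: "score_at_0 h \<in> borel_measurable square_lborel"
      by (simp add: qmd_at_0_def)
    have sc: "(\<lambda>z. ennreal \<bar>score_at_0 h z\<bar>) \<in> borel_measurable square_lborel" by measurable
    have "(\<integral>\<^sup>+z. ennreal (norm (g z)) \<partial>P) = (\<integral>\<^sup>+(x, y). ennreal \<bar>score_at_0 h (q0 x, r0 y)\<bar> \<partial>null_law q0 r0)"
      unfolding P_def by (intro nn_integral_cong) (auto simp: g_def)
    also have "\<dots> \<le> (\<integral>\<^sup>+z. ennreal \<bar>score_at_0 h z\<bar> \<partial>square_lborel)"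
    proof (rule nn_integral_margin_transform_le[OF margins meas sc])
      have "(\<lambda>z. ennreal \<bar>g z\<bar>) \<in> borel_measurable square_lborel" using g_meas by measurable
      then show "(\<lambda>(x, y). ennreal \<bar>score_at_0 h (q0 x, r0 y)\<bar>) \<in> borel_measurable square_lborel"
        by (simp add: g_def case_prod_unfold)
    qed
    also have "\<dots> = (\<integral>\<^sup>+z. ennreal \<bar>score_at_0 h z * sqrt (h 0 z)\<bar> \<partial>square_lborel)"
      by (intro nn_integral_cong) (simp add: h0)
    also have "\<dots> < \<infinity>"
      using family by (intro qmd_at_0_score_nn_integral_finite[OF qmd]) (auto simp: copula_density_family_def)
    finally show "(\<integral>\<^sup>+z. ennreal (norm (g z)) \<partial>P) < \<infinity>" .
  qed
  obtain m where m: "AE x in \<mu>. (\<integral>y. l (x, y) \<partial>\<nu>) = m" "AE y in \<nu>. (\<integral>x. l (x, y) \<partial>\<mu>) = m"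
    using efficient_score_conditional_means[of q0 r0 h] prob pair g_meas g_int
    unfolding P_def \<mu>_def \<nu>_def g_def l_def es_def by blast
  have l_eq: "es (X i \<omega>, Y i \<omega>) = l (X i \<omega>, Y i \<omega>)" if "\<omega> \<in> space M" for i \<omega>
    using measurable_space[OF XY[of i] that] by (simp add: l_def)
  \<comment> \<open>Stated for all constants, because the description of the efficiency ranges over
    every variance and correlation and not only over the given ones.\<close>
  have uncorrelated: "\<rho>' * \<sigma>' * sqrt J = 0" if "joint_normal_limit M X Y T es \<sigma>' \<rho>' J" for \<sigma>' \<rho>' J
    using additive_statistic_uncorrelated[OF ind comp laws(1,2) l l2 m l_eq that qx_meas qy_meas decomposition] .
  then have \<rho>: "\<rho> = 0" using limit pos by (fastforce simp: es_def)
  have p0: "AE z in square_lborel. p 0 z = null_density q0 r0 z"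
    using one_parameter_submodel_null[OF submodel h0 margins] .
  have law_p0: "square_law (p 0) = P"
    unfolding P_def null_law_def square_law_def
  proof (rule density_cong)
    have "p 0 \<in> borel_measurable square_lborel" using submodel_score by (simp add: qmd_at_0_def)
    then show "(\<lambda>z. ennreal (p 0 z)) \<in> borel_measurable square_lborel" by measurable
    show "AE z in square_lborel. ennreal (p 0 z) = ennreal (null_density q0 r0 z)"
      using p0 by eventually_elim simp
  qed (rule meas)
  \<comment> \<open>Any other score of \<open>p\<close> equals \<open>es\<close> almost surely along
    the sample, so its limit is also a limit for \<open>es\<close> with the same constants.\<close>
  have "\<rho>' = 0" if s: "qmd_at_0 p s" "0 < \<sigma>'" "0 < J" "joint_normal_limit M X Y T s \<sigma>' \<rho>' J" for s \<sigma>' \<rho>' J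
  proof -
    have "AE z in P. s z = es z"
      using qmd_at_0_score_unique[OF s(1) submodel_score] unfolding law_p0 es_def .
    then have ae: "AE \<omega> in M. s (X i \<omega>, Y i \<omega>) = es (X i \<omega>, Y i \<omega>)" for i
      unfolding law_XY[of i, symmetric] by (rule AE_distrD[OF XY])
    have "joint_normal_limit M X Y T es \<sigma>' \<rho>' J"
      by (rule joint_normal_limit_cong_AE[OF s(4) _ ae])
        (use joint_normal_limitD(2)[OF limit] in \<open>simp add: es_def\<close>)
    from uncorrelated[OF this] s show ?thesis by simp
  qed
  \<comment> \<open>The witness is the efficient score with the given constants; \<open>J\<close> is
    computed under \<open>square_law (p 0)\<close>, which is the null law. Uniqueness holds because
    every admissible correlation is 0.\<close>
  then have "pitman_efficiency M X Y p T = \<rho>\<^sup>2"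
    unfolding pitman_efficiency_def
    using submodel_score info pos limit law_p0 \<rho>
    by (intro the_equality) (auto simp: P_def intro!: exI)
  with \<rho> show ?thesis by simp
qed

end
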